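(* Fix an integer $K \geq 1$ and positive integers $d_i, M_i, N_i$ for $1 \leq i \leq K$. Let $\mathcal H = \prod_{1 \leq i \neq j \leq K} \mathbb{C}^{N_i \times M_j}$ be the space of tuples $h = (H_{ij})_{i \neq j}$ of cross-channel matrices, and for $h \in \mathcal H$ let $\mathcal F(h)$ denote the variety of feasible strategies for $h$. Then for generic $h \in \mathcal H$ the following hold. (1) If $\mathcal F(h) \neq \varnothing$, then $$\dim \mathcal F(h) = \sum_{i=1}^K \big(d_i(N_i - d_i) + d_i(M_i - d_i)\big) - \sum_{1 \leq i, j \leq K,\ j \neq i} d_i d_j.$$ In particular, if this quantity is negative, then $\mathcal F(h) = \varnothing$. (2) If $\mathcal F(h) \neq \varnothing$, then $d_i \leq \min(M_i, N_i)$ for all $i$; moreover $d_i + d_j \leq \max\{N_i, M_j\}$ for all $1 \leq i \neq j \leq K$; and for every subset $A \subset \{1, \ldots, K\}$ the quantity $$t_A := \sum_{i \in A} \big(d_i(N_i - d_i) + d_i(M_i - d_i)\big) - \sum_{i, j \in A,\ i \neq j} d_i d_j$$ is non-negative.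
   Context: This concerns the $K$-user MIMO interference channel: transmitter $j$ has $M_j$ antennas, receiver $i$ has $N_i$ antennas, and the cross channel from transmitter $j$ to receiver $i$ ($i \neq j$) is a matrix $H_{ij} \in \mathbb{C}^{N_i \times M_j}$. For $h = (H_{ij})_{i\neq j}$, a feasible strategy (with signal dimensions $d_1,\dots,d_K$) is a tuple $(U_1, \ldots, U_K, V_1, \ldots, V_K)$ where $U_i \subseteq \mathbb{C}^{M_i}$ and $V_i \subseteq \mathbb{C}^{N_i}$ are linear subspaces of dimension $d_i$, such that $v^T H_{ij} u = 0$ for all $v \in V_i$, $u \in U_j$, and all $i \neq j$ (i.e. $V_i$, viewed as functionals, annihilates $H_{ij}U_j$). The variety of feasible strategies $\mathcal F(h)$ is the set of such tuples, viewed as a closed subvariety of the product of Grassmannians $\prod_{i=1}^K G(d_i, M_i) \times \prod_{i=1}^K G(d_i, N_i)$, where $G(d,n)$ is the Grassmannian of $d$-dimensional subspaces of $\mathbb{C}^n$. Its dimension is the maximum dimension of its irreducible components. A statement holds "for generic $h$" if it holds for all $h$ in some nonempty Zariski-open (hence dense) subset of $\mathcal H$. *)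

theory Defs
  imports Complex_Main "HOL-Library.Extended_Nat"
begin

text \<open>Points of an affine space are functions from a coordinate type to complex
numbers; polynomial functions are generated by constants and coordinate
functions under addition and multiplication (each depends on finitely many
coordinates).\<close>

inductive_set polyfun :: "(('v \<Rightarrow> complex) \<Rightarrow> complex) set" where
  pf_const: "(\<lambda>x. c) \<in> polyfun"
| pf_coord: "(\<lambda>x. x v) \<in> polyfun"
| pf_add: "p \<in> polyfun \<Longrightarrow> q \<in> polyfun \<Longrightarrow> (\<lambda>x. p x + q x) \<in> polyfun"
| pf_mult: "p \<in> polyfun \<Longrightarrow> q \<in> polyfun \<Longrightarrow> (\<lambda>x. p x * q x) \<in> polyfun"

definition zariski_closed_in :: "('v \<Rightarrow> complex) set \<Rightarrow> ('v \<Rightarrow> complex) set \<Rightarrow> bool" where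
  "zariski_closed_in S T \<longleftrightarrow> (\<exists>P \<subseteq> polyfun. T = {x \<in> S. \<forall>p\<in>P. p x = 0})"

definition sub_closed :: "('a set \<Rightarrow> bool) \<Rightarrow> 'a set \<Rightarrow> 'a set \<Rightarrow> bool" where
  "sub_closed cl X C \<longleftrightarrow> (\<exists>D. cl D \<and> C = X \<inter> D)"

definition irreducible_closed :: "('a set \<Rightarrow> bool) \<Rightarrow> 'a set \<Rightarrow> bool" where
  "irreducible_closed cl Z \<longleftrightarrow> cl Z \<and> Z \<noteq> {} \<and>
     (\<forall>A B. cl A \<longrightarrow> cl B \<longrightarrow> Z \<subseteq> A \<union> B \<longrightarrow> Z \<subseteq> A \<or> Z \<subseteq> B)"

definition krull_dim :: "('a set \<Rightarrow> bool) \<Rightarrow> 'a set \<Rightarrow> enat" where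
  "krull_dim cl X = Sup {enat n | n. \<exists>Z. (\<forall>k\<le>n. irreducible_closed (sub_closed cl X) (Z k))
                                        \<and> (\<forall>k<n. Z k \<subset> Z (Suc k))}"

text \<open>Vectors of C^n are functions nat => complex vanishing at indices >= n.
The column space of an n x d matrix A (entries A a k, a<n, k<d).\<close>
definition colspace :: "nat \<Rightarrow> nat \<Rightarrow> (nat \<Rightarrow> nat \<Rightarrow> complex) \<Rightarrow> (nat \<Rightarrow> complex) set" where
  "colspace n d A = {(\<lambda>a. if a < n then (\<Sum>k<d. c k * A a k) else 0) | c. True}"

definition full_rank :: "nat \<Rightarrow> nat \<Rightarrow> (nat \<Rightarrow> nat \<Rightarrow> complex) \<Rightarrow> bool" where
  "full_rank n d A \<longleftrightarrow> (\<forall>c. (\<forall>a<n. (\<Sum>k<d. c k * A a k) = 0) \<longrightarrow> (\<forall>k<d. c k = 0))"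

definition grass :: "nat \<Rightarrow> nat \<Rightarrow> (nat \<Rightarrow> complex) set set" where
  "grass d n = {colspace n d A | A. full_rank n d A}"

type_synonym strat = "(nat \<Rightarrow> (nat \<Rightarrow> complex) set) \<times> (nat \<Rightarrow> (nat \<Rightarrow> complex) set)"

definition grass_prod :: "nat \<Rightarrow> (nat \<Rightarrow> nat) \<Rightarrow> (nat \<Rightarrow> nat) \<Rightarrow> (nat \<Rightarrow> nat) \<Rightarrow> strat set" where
  "grass_prod K d M N = {(U, V). (\<forall>i<K. U i \<in> grass (d i) (M i) \<and> V i \<in> grass (d i) (N i))
                                 \<and> (\<forall>i\<ge>K. U i = {} \<and> V i = {})}"

text \<open>Tuples of full-rank matrices (Stiefel varieties): entry X (False,i,a,k) is entry (a,k)
of the M_i x d_i matrix spanning U_i, X (True,i,a,k) of the N_i x d_i matrix spanning V_i.\<close>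
definition stiefel :: "nat \<Rightarrow> (nat \<Rightarrow> nat) \<Rightarrow> (nat \<Rightarrow> nat) \<Rightarrow> (nat \<Rightarrow> nat) \<Rightarrow> (bool \<times> nat \<times> nat \<times> nat \<Rightarrow> complex) set" where
  "stiefel K d M N = {X.
     (\<forall>i a k. X (False, i, a, k) \<noteq> 0 \<longrightarrow> i < K \<and> a < M i \<and> k < d i) \<and>
     (\<forall>i a k. X (True, i, a, k) \<noteq> 0 \<longrightarrow> i < K \<and> a < N i \<and> k < d i) \<and>
     (\<forall>i<K. full_rank (M i) (d i) (\<lambda>a k. X (False, i, a, k)) \<and>
            full_rank (N i) (d i) (\<lambda>a k. X (True, i, a, k)))}"

definition strat_of :: "nat \<Rightarrow> (nat \<Rightarrow> nat) \<Rightarrow> (nat \<Rightarrow> nat) \<Rightarrow> (nat \<Rightarrow> nat) \<Rightarrow> (bool \<times> nat \<times> nat \<times> nat \<Rightarrow> complex) \<Rightarrow> strat" where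
  "strat_of K d M N X =
     ((\<lambda>i. if i < K then colspace (M i) (d i) (\<lambda>a k. X (False, i, a, k)) else {}),
      (\<lambda>i. if i < K then colspace (N i) (d i) (\<lambda>a k. X (True, i, a, k)) else {}))"

text \<open>Zariski closed subsets of the product of Grassmannians: quotient topology from the
product of Stiefel varieties (a Zariski-locally trivial principal GL-bundle).\<close>
definition grass_closed :: "nat \<Rightarrow> (nat \<Rightarrow> nat) \<Rightarrow> (nat \<Rightarrow> nat) \<Rightarrow> (nat \<Rightarrow> nat) \<Rightarrow> strat set \<Rightarrow> bool" where
  "grass_closed K d M N C \<longleftrightarrow> C \<subseteq> grass_prod K d M N \<and>
     zariski_closed_in (stiefel K d M N) {X \<in> stiefel K d M N. strat_of K d M N X \<in> C}"

text \<open>The channel space H: h (i,j,a,b) is entry (a,b) of H_ij (N_i x M_j), i \<noteq> j, i,j < K.\<close>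
definition chan_space :: "nat \<Rightarrow> (nat \<Rightarrow> nat) \<Rightarrow> (nat \<Rightarrow> nat) \<Rightarrow> (nat \<times> nat \<times> nat \<times> nat \<Rightarrow> complex) set" where
  "chan_space K M N = {h. \<forall>i j a b. h (i, j, a, b) \<noteq> 0 \<longrightarrow> i < K \<and> j < K \<and> i \<noteq> j \<and> a < N i \<and> b < M j}"

definition feasible :: "nat \<Rightarrow> (nat \<Rightarrow> nat) \<Rightarrow> (nat \<Rightarrow> nat) \<Rightarrow> (nat \<Rightarrow> nat) \<Rightarrow> (nat \<times> nat \<times> nat \<times> nat \<Rightarrow> complex) \<Rightarrow> strat set" where
  "feasible K d M N h = {(U, V) \<in> grass_prod K d M N.
     \<forall>i<K. \<forall>j<K. i \<noteq> j \<longrightarrow>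
       (\<forall>v\<in>V i. \<forall>u\<in>U j. (\<Sum>a<N i. \<Sum>b<M j. v a * h (i, j, a, b) * u b) = 0)}"

definition feas_dim :: "nat \<Rightarrow> (nat \<Rightarrow> nat) \<Rightarrow> (nat \<Rightarrow> nat) \<Rightarrow> (nat \<Rightarrow> nat) \<Rightarrow> (nat \<times> nat \<times> nat \<times> nat \<Rightarrow> complex) \<Rightarrow> enat" where
  "feas_dim K d M N h = krull_dim (grass_closed K d M N) (feasible K d M N h)"

definition generic :: "nat \<Rightarrow> (nat \<Rightarrow> nat) \<Rightarrow> (nat \<Rightarrow> nat) \<Rightarrow> ((nat \<times> nat \<times> nat \<times> nat \<Rightarrow> complex) \<Rightarrow> bool) \<Rightarrow> bool" where
  "generic K M N Q \<longleftrightarrow> (\<exists>P \<subseteq> polyfun.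
     {h \<in> chan_space K M N. \<exists>p\<in>P. p h \<noteq> 0} \<noteq> {} \<and>
     (\<forall>h \<in> chan_space K M N. (\<exists>p\<in>P. p h \<noteq> 0) \<longrightarrow> Q h))"

definition tA :: "(nat \<Rightarrow> nat) \<Rightarrow> (nat \<Rightarrow> nat) \<Rightarrow> (nat \<Rightarrow> nat) \<Rightarrow> nat set \<Rightarrow> int" where
  "tA d M N A = (\<Sum>i\<in>A. int (d i) * (int (N i) - int (d i)) + int (d i) * (int (M i) - int (d i)))
               - (\<Sum>i\<in>A. \<Sum>j\<in>A - {i}. int (d i) * int (d j))"

end

theory Submission
  imports Defs "HOL-Complex_Analysis.Conformal_Mappings" "Jordan_Normal_Form.Determinant"
    "HOL-Computational_Algebra.Fundamental_Theorem_Algebra"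
begin

text \<open>In a chart of the product of Grassmannians every interference equation contains a pivot entry
  of the channel matrices with coefficient one. Hence the incidence variety of strategies and channels
  is, in each chart, the graph of a polynomial map, irreducible, and its coordinate functions have
  transcendence degree \<open>t + dim H\<close>.

  Upper bound: any \<open>t + 1\<close> chart coordinates together with the channel entries are algebraically
  dependent, and for generic \<open>h\<close> the relation stays nontrivial on the fibre. A chain of irreducible
  closed sets of length \<open>n\<close> yields \<open>n\<close> algebraically independent functions on its top member, so
  \<open>n \<le> t\<close>. The same count for a subset \<open>A\<close> of the users gives \<open>t\<^sub>A \<ge> 0\<close>.

  Lower bound: if the projection to the channels is dominant, choose \<open>t\<close> chart coordinates that form
  a transcendence basis with the channel entries. For generic \<open>h\<close> the other coordinates are simple
  roots of polynomials in these, so some branch of the root functions stays in the fibre over a whole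
  polydisc (identity theorem). The Zariski closures of the images of a flag of coordinate polydiscs are
  irreducible, again by the identity theorem, and form a chain of length \<open>t\<close>.\<close>

section \<open>Polynomial functions in a set of coordinates\<close>

text \<open>Varieties occur only as sets of points together with the polynomial functions on them,
  and dimension only as the size of a maximal algebraically independent set of coordinates. A purely
  algebraic chain inside a fibre would have to single out components of a possibly reducible fibre.
  A holomorphic branch over a polydisc avoids this, because closures of its images are irreducible
  for free. The price is that roots must stay simple and leading coefficients nonzero. These
  conditions first live on an algebraic extension of the basis coordinates; norms push them down to
  the basis, and freezing the chosen strategy coordinates pushes them down to the channels. The
  graph has t + dim H free parameters, so a dominant projection leaves exactly t free strategy
  coordinates, while a non-dominant one makes generic fibres empty. The bound d_i + d_j <= max(N_i,
  M_j) is independent of all this: a generic H_ij has an invertible square block of the smaller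
  size, so H_ij or its transpose is injective, and orthogonality in the larger space bounds the
  dimensions.\<close>

inductive_set polyon :: "'v set \<Rightarrow> (('v \<Rightarrow> complex) \<Rightarrow> complex) set" for V where
  const: "(\<lambda>x. c) \<in> polyon V"
| coord: "v \<in> V \<Longrightarrow> (\<lambda>x. x v) \<in> polyon V"
| add: "p \<in> polyon V \<Longrightarrow> q \<in> polyon V \<Longrightarrow> (\<lambda>x. p x + q x) \<in> polyon V"
| mult: "p \<in> polyon V \<Longrightarrow> q \<in> polyon V \<Longrightarrow> (\<lambda>x. p x * q x) \<in> polyon V"

lemma polyon_mono: "p \<in> polyon V \<Longrightarrow> V \<subseteq> W \<Longrightarrow> p \<in> polyon W"
  by (induction rule: polyon.induct) (auto intro: polyon.intros)

lemma polyon_cong: "p \<in> polyon V \<Longrightarrow> (\<And>v. v \<in> V \<Longrightarrow> x v = y v) \<Longrightarrow> p x = p y"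
  by (induction rule: polyon.induct) auto

lemma polyon_polyfun: "p \<in> polyon V \<Longrightarrow> p \<in> polyfun"
  by (induction rule: polyon.induct) (auto intro: polyfun.intros)

lemma polyfun_polyon: "p \<in> polyfun \<Longrightarrow> p \<in> polyon UNIV"
  by (induction rule: polyfun.induct) (auto intro: polyon.intros)

lemma polyon_uminus: "p \<in> polyon V \<Longrightarrow> (\<lambda>x. - p x) \<in> polyon V"
  using polyon.mult[OF polyon.const[of "-1"]] by fastforce

lemma polyon_diff: "p \<in> polyon V \<Longrightarrow> q \<in> polyon V \<Longrightarrow> (\<lambda>x. p x - q x) \<in> polyon V"
  using polyon.add[OF _ polyon_uminus] by fastforce

lemma polyon_sum: "(\<And>i. i \<in> I \<Longrightarrow> f i \<in> polyon V) \<Longrightarrow> (\<lambda>x. \<Sum>i\<in>I. f i x) \<in> polyon V"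
  by (induction I rule: infinite_finite_induct) (auto intro: polyon.intros)

lemma polyon_prod: "(\<And>i. i \<in> I \<Longrightarrow> f i \<in> polyon V) \<Longrightarrow> (\<lambda>x. \<Prod>i\<in>I. f i x) \<in> polyon V"
  by (induction I rule: infinite_finite_induct) (auto intro: polyon.intros)

lemma polyon_power: "p \<in> polyon V \<Longrightarrow> (\<lambda>x. p x ^ n) \<in> polyon V"
  by (induction n) (auto intro: polyon.intros)

lemma polyon_if: "(c \<Longrightarrow> p \<in> polyon V) \<Longrightarrow> (\<not> c \<Longrightarrow> q \<in> polyon V) \<Longrightarrow> (\<lambda>x. if c then p x else q x) \<in> polyon V"
  by (cases c) auto

lemmas polyon_intros = polyon.intros polyon_uminus polyon_diff polyon_sum polyon_prod polyon_power polyon_if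

lemma polyon_subst:
  "p \<in> polyon V \<Longrightarrow> (\<And>v. v \<in> V \<Longrightarrow> f v \<in> polyon W) \<Longrightarrow> (\<lambda>x. p (\<lambda>v. f v x)) \<in> polyon W"
  by (induction rule: polyon.induct) (auto intro: polyon.intros)

text \<open>Polynomial functions carry no syntax from which coefficients could be read. Instead, the
  functions of this shape contain the generators and are closed under sums and products. The bound
  \<open>n\<close> is not a degree: any coefficient may vanish identically.\<close>

lemma polyon_expand:
  assumes "p \<in> polyon (insert v B)"
  shows "\<exists>n a. (\<forall>k. a k \<in> polyon B) \<and> (\<forall>x. p x = (\<Sum>k<n. a k x * x v ^ k))"
proof -
  define E where "E = {p. \<exists>n a. (\<forall>k::nat. a k \<in> polyon B) \<and> (\<forall>x. p x = (\<Sum>k<n. a k x * x v ^ k))}"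
  have EI: "p \<in> E" if "\<And>k. a k \<in> polyon B" "\<And>x. p x = (\<Sum>k<n. a k x * x v ^ k)" for p n a
    using that by (auto simp: E_def)
  have coeff: "p \<in> E" if "p \<in> polyon B" for p
    by (rule EI[of "\<lambda>k. p" _ "Suc 0"]) (use that in auto)
  have scale: "(\<lambda>x. q x * p x) \<in> E" if "q \<in> polyon B" "p \<in> E" for p q
  proof -
    from that(2) obtain n a where "\<forall>k. a k \<in> polyon B" "\<forall>x. p x = (\<Sum>k<n. a k x * x v ^ k)"
      by (auto simp: E_def)
    with that(1) show ?thesis
      by (intro EI[of "\<lambda>k x. q x * a k x" _ n]) (auto intro: polyon.mult simp: sum_distrib_left mult.assoc)
  qed
  have shift: "(\<lambda>x. x v * p x) \<in> E" if p: "p \<in> E" for p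
  proof -
    from p obtain n a where "\<forall>k. a k \<in> polyon B" "\<forall>x. p x = (\<Sum>k<n. a k x * x v ^ k)"
      by (auto simp: E_def)
    then show ?thesis
      by (intro EI[of "\<lambda>k. if k = 0 then (\<lambda>x. 0) else a (k - 1)" _ "Suc n"])
        (auto intro: polyon.const simp: sum_distrib_left sum.lessThan_Suc_shift ac_simps simp del: sum.lessThan_Suc)
  qed
  have add: "(\<lambda>x. p x + q x) \<in> E" if p: "p \<in> E" and q: "q \<in> E" for p q
  proof -
    from p obtain n a where a: "\<forall>k. a k \<in> polyon B" "\<forall>x. p x = (\<Sum>k<n. a k x * x v ^ k)"
      by (auto simp: E_def)
    from q obtain m b where b: "\<forall>k. b k \<in> polyon B" "\<forall>x. q x = (\<Sum>k<m. b k x * x v ^ k)"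
      by (auto simp: E_def)
    have pad: "(\<Sum>k<n. c k) = (\<Sum>k<n+m. if k < n then c k else 0)" for c :: "nat \<Rightarrow> complex" and n m
      by (rule sum.mono_neutral_cong_left) auto
    show ?thesis
      apply (rule EI[of "\<lambda>k x. (if k < n then a k x else 0) + (if k < m then b k x else 0)" _ "n + m"])
      subgoal for k using a b by (auto intro!: polyon_intros)
      subgoal for x
        using a(2) b(2) pad[of "\<lambda>k. a k x * x v ^ k" n m] pad[of "\<lambda>k. b k x * x v ^ k" m n]
        by (simp add: sum.distrib distrib_right if_distrib[of "\<lambda>c. c * _"] add.commute cong: if_cong)
      done
  qed
  have mult: "(\<lambda>x. p x * q x) \<in> E" if p: "p \<in> E" and q: "q \<in> E" for p q
  proof -
    from p obtain n a where a: "\<forall>k. a k \<in> polyon B" "\<forall>x. p x = (\<Sum>k<n. a k x * x v ^ k)"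
      by (auto simp: E_def)
    have pow: "(\<lambda>x. x v ^ k * q x) \<in> E" for k
      by (induction k) (use q shift in \<open>auto simp: mult.assoc\<close>)
    have "(\<lambda>x. \<Sum>k<n. a k x * (x v ^ k * q x)) \<in> E" for n
    proof (induction n)
      case 0
      show ?case using coeff[OF polyon.const[of 0]] by simp
    next
      case (Suc n)
      show ?case using add[OF Suc scale[OF a(1)[rule_format] pow]] by simp
    qed
    moreover have "p x * q x = (\<Sum>k<n. a k x * (x v ^ k * q x))" for x
      by (simp add: a(2) sum_distrib_right mult.assoc)
    ultimately show ?thesis by presburger
  qed
  have "p \<in> E" using assms
  proof (induction rule: polyon.induct)
    case (coord u)
    then show ?case
      using shift[OF coeff[OF polyon.const[of 1]]] by (cases "u = v") (auto intro: coeff polyon.coord)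
  qed (auto intro: add mult coeff polyon.const)
  then show ?thesis by (auto simp: E_def)
qed

text \<open>Reduces questions of nonvanishing in many variables to one variable, along the complex
  line through \<open>x\<close> (at \<open>z = 0\<close>) and \<open>y\<close> (at
  \<open>z = 1\<close>).\<close>

lemma polyon_line:
  "p \<in> polyon V \<Longrightarrow> \<exists>P. \<forall>z. p (\<lambda>v. x v + z * (y v - x v)) = poly P z"
proof (induction rule: polyon.induct)
  case (const c)
  show ?case by (rule exI[of _ "[:c:]"]) simp
next
  case (coord v)
  show ?case by (rule exI[of _ "[:x v, y v - x v:]"]) simp
next
  case (add p q)
  then obtain P Q where "\<forall>z. p (\<lambda>v. x v + z * (y v - x v)) = poly P z"
    "\<forall>z. q (\<lambda>v. x v + z * (y v - x v)) = poly Q z" by auto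
  then show ?case by (intro exI[of _ "P + Q"]) simp
next
  case (mult p q)
  then obtain P Q where "\<forall>z. p (\<lambda>v. x v + z * (y v - x v)) = poly P z"
    "\<forall>z. q (\<lambda>v. x v + z * (y v - x v)) = poly Q z" by auto
  then show ?case by (intro exI[of _ "P * Q"]) simp
qed

text \<open>On the line through \<open>x\<close> and \<open>y\<close> both functions become nonzero
  univariate polynomials, and so does their product. That the witness lies on this line matters: it
  inherits every linear condition shared by \<open>x\<close> and \<open>y\<close>.\<close>

lemma polyon_nonzero_common:
  assumes "p \<in> polyon V" "q \<in> polyon V" "p x \<noteq> 0" "q y \<noteq> 0"
  shows "\<exists>z. p (\<lambda>v. x v + z * (y v - x v)) \<noteq> 0 \<and> q (\<lambda>v. x v + z * (y v - x v)) \<noteq> 0"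
proof -
  obtain P where P: "\<And>z. p (\<lambda>v. x v + z * (y v - x v)) = poly P z"
    using polyon_line[OF assms(1)] by blast
  obtain Q where Q: "\<And>z. q (\<lambda>v. x v + z * (y v - x v)) = poly Q z"
    using polyon_line[OF assms(2)] by blast
  have "poly P 0 \<noteq> 0" "poly Q 1 \<noteq> 0" using P[of 0] Q[of 1] assms by auto
  then have "P * Q \<noteq> 0" by auto
  then obtain z where "poly (P * Q) z \<noteq> 0" using poly_all_0_iff_0 by blast
  then show ?thesis by (auto simp: P Q)
qed

lemma polyon_prod_nonzero:
  assumes "finite I" "\<And>i. i \<in> I \<Longrightarrow> p i \<in> polyon V" "\<And>i. i \<in> I \<Longrightarrow> \<exists>x. p i x \<noteq> 0"
  shows "\<exists>x. (\<Prod>i\<in>I. p i x) \<noteq> 0"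
  using assms
proof (induction I rule: finite_induct)
  case (insert i I)
  then obtain x y where "p i x \<noteq> 0" "(\<Prod>i\<in>I. p i y) \<noteq> 0" by blast
  moreover have "p i \<in> polyon V" "(\<lambda>x. \<Prod>i\<in>I. p i x) \<in> polyon V"
    using insert.prems by (auto intro: polyon_prod)
  ultimately obtain z where "p i (\<lambda>v. x v + z * (y v - x v)) \<noteq> 0"
    "(\<Prod>i\<in>I. p i (\<lambda>v. x v + z * (y v - x v))) \<noteq> 0"
    using polyon_nonzero_common[of "p i" V "\<lambda>x. \<Prod>i\<in>I. p i x"] by blast
  with insert.hyps show ?case by (intro exI[of _ "\<lambda>v. x v + z * (y v - x v)"]) simp
qed auto

section \<open>Linear systems and linear independence of monomials\<close>

text \<open>Gaussian elimination: one equation is used to eliminate one unknown \<open>i0\<close>,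
  which leaves a smaller system that still has more unknowns than equations.\<close>

lemma homogeneous_system:
  fixes c :: "'i \<Rightarrow> 'j \<Rightarrow> complex"
  assumes "finite J" "finite I" "card J < card I"
  shows "\<exists>x. (\<exists>i\<in>I. x i \<noteq> 0) \<and> (\<forall>j\<in>J. (\<Sum>i\<in>I. x i * c i j) = 0)"
  using assms
proof (induction J arbitrary: I c rule: finite_induct)
  case empty
  then show ?case by (auto intro!: exI[of _ "\<lambda>_. 1"] simp: card_gt_0_iff)
next
  case (insert j J)
  show ?case
  proof (cases "\<forall>i\<in>I. c i j = 0")
    case True
    with insert.IH[of I c] insert show ?thesis by auto
  next
    case False
    then obtain i0 where i0: "i0 \<in> I" "c i0 j \<noteq> 0" by blast
    have "card J < card (I - {i0})" using insert i0 by auto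
    then have "\<exists>x. (\<exists>i\<in>I - {i0}. x i \<noteq> 0) \<and>
        (\<forall>k\<in>J. (\<Sum>i\<in>I-{i0}. x i * (c i k - c i j / c i0 j * c i0 k)) = 0)"
      by (intro insert.IH) (use insert.prems in auto)
    then obtain x where x: "\<exists>i\<in>I - {i0}. x i \<noteq> 0"
      "\<forall>k\<in>J. (\<Sum>i\<in>I-{i0}. x i * (c i k - c i j / c i0 j * c i0 k)) = 0"
      by blast
    \<comment> \<open>The negative of the value that equation \<open>j\<close> forces on the
      eliminated unknown.\<close>
    define s where "s = (\<Sum>i\<in>I-{i0}. x i * c i j) / c i0 j"
    define y where "y = x(i0 := - s)"
    have split: "(\<Sum>i\<in>I. y i * c i k) = - s * c i0 k + (\<Sum>i\<in>I-{i0}. x i * c i k)" for k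
      using insert.prems i0 by (subst sum.remove[of _ i0]) (auto simp: y_def intro!: sum.cong)
    have "(\<Sum>i\<in>I. y i * c i j) = 0" using i0 by (simp add: split s_def)
    moreover have "(\<Sum>i\<in>I. y i * c i k) = 0" if "k \<in> J" for k
    proof -
      have "(\<Sum>i\<in>I-{i0}. x i * c i k) = (\<Sum>i\<in>I-{i0}. x i * c i j / c i0 j * c i0 k)"
        using x(2) that by (simp add: sum_subtractf right_diff_distrib mult.assoc)
      also have "\<dots> = s * c i0 k"
        by (simp add: s_def sum_distrib_right sum_divide_distrib)
      finally show ?thesis by (simp add: split)
    qed
    moreover have "\<exists>i\<in>I. y i \<noteq> 0" using x(1) by (auto simp: y_def)
    ultimately show ?thesis by auto
  qed
qed

text \<open>Collecting powers of the last variable \<open>u\<close>, the coefficient of the power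
  occurring in \<delta>0 is nonzero at some point by induction. With the other variables fixed
  there, a nonzero univariate polynomial remains.\<close>

lemma monomials_independent:
  assumes "finite F" "\<delta>0 \<in> PiE F (\<lambda>_. {..<D::nat})" "c \<delta>0 \<noteq> 0"
  shows "\<exists>w. (\<Sum>\<delta>\<in>PiE F (\<lambda>_. {..<D}). c \<delta> * (\<Prod>u\<in>F. w u ^ \<delta> u)) \<noteq> (0::complex)"
  using assms
proof (induction F arbitrary: c \<delta>0 rule: finite_induct)
  case empty
  then show ?case by (auto simp: PiE_empty_domain)
next
  case (insert u F)
  define k0 where "k0 = \<delta>0 u"
  define \<delta>1 where "\<delta>1 = restrict \<delta>0 F"
  have \<delta>1: "\<delta>1 \<in> PiE F (\<lambda>_. {..<D})" "\<delta>1(u := k0) = \<delta>0" "k0 < D"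
    using insert.prems(1) insert.hyps by (auto simp: \<delta>1_def k0_def PiE_iff extensional_def fun_eq_iff)
  then obtain w where w: "(\<Sum>\<delta>\<in>PiE F (\<lambda>_. {..<D}). c (\<delta>(u := k0)) * (\<Prod>u\<in>F. w u ^ \<delta> u)) \<noteq> 0"
    using insert.IH[of \<delta>1 "\<lambda>\<delta>. c (\<delta>(u := k0))"] insert.prems by auto
  define C where "C k = (\<Sum>\<delta>\<in>PiE F (\<lambda>_. {..<D}). c (\<delta>(u := k)) * (\<Prod>u\<in>F. w u ^ \<delta> u))" for k
  define P where "P = (\<Sum>k<D. monom (C k) k)"
  have "coeff P k0 = C k0" using \<delta>1(3) by (simp add: P_def coeff_sum sum.delta' cong: if_cong)
  then have "P \<noteq> 0" using w by (auto simp: C_def)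
  then obtain z where z: "poly P z \<noteq> 0" using poly_all_0_iff_0 by blast
  have "(\<Sum>\<delta>\<in>PiE (insert u F) (\<lambda>_. {..<D}). c \<delta> * (\<Prod>v\<in>insert u F. (w(u := z)) v ^ \<delta> v))
      = (\<Sum>(k,\<delta>)\<in>{..<D} \<times> PiE F (\<lambda>_. {..<D}). c (\<delta>(u := k)) * (\<Prod>v\<in>insert u F. (w(u := z)) v ^ (\<delta>(u := k)) v))"
    unfolding PiE_insert_eq
    using insert.hyps by (subst sum.reindex[OF inj_combinator]) (auto simp: case_prod_unfold)
  also have "\<dots> = (\<Sum>k<D. C k * z ^ k)"
    unfolding sum.cartesian_product[symmetric] C_def sum_distrib_right
  proof (intro sum.cong refl)
    fix k \<delta>
    have "(\<Prod>v\<in>F. (w(u := z)) v ^ (\<delta>(u := k)) v) = (\<Prod>v\<in>F. w v ^ \<delta> v)"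
      using insert.hyps by (intro prod.cong) auto
    then show "c (\<delta>(u := k)) * (\<Prod>v\<in>insert u F. (w(u := z)) v ^ (\<delta>(u := k)) v)
        = c (\<delta>(u := k)) * (\<Prod>u\<in>F. w u ^ \<delta> u) * z ^ k"
      using insert.hyps by (simp add: ac_simps)
  qed
  also have "\<dots> = poly P z" by (simp add: P_def poly_sum poly_monom)
  finally show ?case using z by metis
qed

section \<open>Algebraic dependence by counting monomials\<close>

text \<open>The ideal of polynomials in \<open>V\<close> vanishing on \<open>X\<close> is prime, or
  the whole ring when \<open>X\<close> is empty.\<close>

definition irred_on :: "'v set \<Rightarrow> ('v \<Rightarrow> complex) set \<Rightarrow> bool" where
  "irred_on V X \<longleftrightarrow> (\<forall>p\<in>polyon V. \<forall>q\<in>polyon V. (\<forall>x\<in>X. p x * q x = 0) \<longrightarrow>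
     (\<forall>x\<in>X. p x = 0) \<or> (\<forall>x\<in>X. q x = 0))"

text \<open>The leading coefficient must be nonzero somewhere on \<open>X\<close>. This rules out
  trivial relations, and also \<open>e = 0\<close>.\<close>

definition algebraic_on :: "('v \<Rightarrow> complex) set \<Rightarrow> 'v set \<Rightarrow> 'v \<Rightarrow> bool" where
  "algebraic_on X B v \<longleftrightarrow> (\<exists>e a. (\<forall>k. a k \<in> polyon B) \<and>
     (\<forall>x\<in>X. (\<Sum>k\<le>e. a k x * x v ^ k) = 0) \<and> (\<exists>x\<in>X. a e x \<noteq> 0))"

lemma irred_onD:
  "irred_on V X \<Longrightarrow> p \<in> polyon V \<Longrightarrow> q \<in> polyon V \<Longrightarrow> \<exists>x\<in>X. p x \<noteq> 0 \<Longrightarrow> \<exists>x\<in>X. q x \<noteq> 0 \<Longrightarrow>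
   \<exists>x\<in>X. p x * q x \<noteq> 0"
  unfolding irred_on_def by blast

lemma irred_on_prod:
  assumes "irred_on V X" "finite I" "X \<noteq> {}" "\<And>i. i \<in> I \<Longrightarrow> p i \<in> polyon V" "\<And>i. i \<in> I \<Longrightarrow> \<exists>x\<in>X. p i x \<noteq> 0"
  shows "\<exists>x\<in>X. (\<Prod>i\<in>I. p i x) \<noteq> 0"
  using assms(2,4,5)
proof (induction I rule: finite_induct)
  case empty
  then show ?case using assms(3) by auto
next
  case (insert i I)
  then have "\<exists>x\<in>X. p i x * (\<Prod>i\<in>I. p i x) \<noteq> 0"
    by (intro irred_onD[OF assms(1)] polyon_prod) auto
  then show ?case using insert.hyps by simp
qed

text \<open>On \<open>X\<close> every polynomial becomes, after multiplication by a power of \<open>a\<close>, a combination of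
  monomials in \<open>B\<close> times monomials with exponents below \<open>E\<close>. The \<open>D\<close> to the power \<open>card F\<close>
  monomials with exponents below \<open>D\<close> in a family \<open>F\<close> therefore lie in a space whose dimension grows
  only like \<open>D\<close> to the power \<open>card B\<close>.\<close>
locale common_relation =
  fixes X :: "('v \<Rightarrow> complex) set" and V B :: "'v set" and a :: "('v \<Rightarrow> complex) \<Rightarrow> complex"
    and E :: nat and c :: "'v \<Rightarrow> nat \<Rightarrow> ('v \<Rightarrow> complex) \<Rightarrow> complex"
  assumes finV: "finite V" and BV: "B \<subseteq> V" and aB: "a \<in> polyon B" and E: "0 < E"
    and cB: "\<And>v k. v \<in> V \<Longrightarrow> c v k \<in> polyon B"
    and rel: "\<And>v x. v \<in> V \<Longrightarrow> x \<in> X \<Longrightarrow> a x * x v ^ E = (\<Sum>k<E. c v k x * x v ^ k)"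
begin

lemma finB: "finite B" using finV BV finite_subset by blast

text \<open>Pairs of exponents. Since \<open>B\<close> is contained in \<open>V\<close>, coordinates
  of \<open>B\<close> may occur in both components; different pairs can give the same monomial,
  which is harmless because only an upper bound on the dimension of the span is wanted.\<close>

definition G :: "nat \<Rightarrow> (('v \<Rightarrow> nat) \<times> ('v \<Rightarrow> nat)) set" where
  "G L = PiE B (\<lambda>_. {..L}) \<times> PiE V (\<lambda>_. {..<E})"

definition m :: "('v \<Rightarrow> nat) \<times> ('v \<Rightarrow> nat) \<Rightarrow> ('v \<Rightarrow> complex) \<Rightarrow> complex" where
  "m g x = (\<Prod>v\<in>B. x v ^ fst g v) * (\<Prod>v\<in>V. x v ^ snd g v)"

text \<open>Only values on \<open>X\<close> count, so the relations that hold on \<open>X\<close>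
  may be used for rewriting.\<close>

definition Sp :: "nat \<Rightarrow> (('v \<Rightarrow> complex) \<Rightarrow> complex) set" where
  "Sp L = {f. \<exists>b. \<forall>x\<in>X. f x = (\<Sum>g\<in>G L. b g * m g x)}"

lemma finG: "finite (G L)"
  using finV finB by (simp add: G_def finite_PiE)

lemma cardG: "card (G L) = (L + 1) ^ card B * E ^ card V"
  using finV finB by (simp add: G_def card_cartesian_product card_PiE)

lemma Sp_cong: "f \<in> Sp L \<Longrightarrow> (\<And>x. x \<in> X \<Longrightarrow> f x = f' x) \<Longrightarrow> f' \<in> Sp L"
  by (auto simp: Sp_def)

lemma Sp_add: "f \<in> Sp L \<Longrightarrow> f' \<in> Sp L \<Longrightarrow> (\<lambda>x. f x + f' x) \<in> Sp L"
proof -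
  assume "f \<in> Sp L" "f' \<in> Sp L"
  then obtain b b' where "\<forall>x\<in>X. f x = (\<Sum>g\<in>G L. b g * m g x)" "\<forall>x\<in>X. f' x = (\<Sum>g\<in>G L. b' g * m g x)"
    by (auto simp: Sp_def)
  then show ?thesis
    by (auto simp: Sp_def sum.distrib distrib_right intro!: exI[of _ "\<lambda>g. b g + b' g"])
qed

lemma Sp_scale: "f \<in> Sp L \<Longrightarrow> (\<lambda>x. r * f x) \<in> Sp L"
proof -
  assume "f \<in> Sp L"
  then obtain b where "\<forall>x\<in>X. f x = (\<Sum>g\<in>G L. b g * m g x)"
    by (auto simp: Sp_def)
  then show ?thesis
    by (auto simp: Sp_def sum_distrib_left mult.assoc intro!: exI[of _ "\<lambda>g. r * b g"])
qed

lemma Sp_zero: "(\<lambda>x. 0) \<in> Sp L"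
  by (auto simp: Sp_def intro!: exI[of _ "\<lambda>_. 0"])

lemma Sp_sum: "(\<And>i. i \<in> I \<Longrightarrow> f i \<in> Sp L) \<Longrightarrow> (\<lambda>x. \<Sum>i\<in>I. f i x) \<in> Sp L"
  by (induction I rule: infinite_finite_induct) (auto intro: Sp_zero Sp_add)

lemma Sp_gen: "g \<in> G L \<Longrightarrow> m g \<in> Sp L"
  using finG[of L] by (auto simp: Sp_def sum.delta if_distrib[of "\<lambda>c. c * _"] cong: if_cong
      intro!: exI[of _ "\<lambda>h. if h = g then 1 else 0"])

lemma Sp_mult:
  assumes "\<And>g. g \<in> G L \<Longrightarrow> (\<lambda>x. q x * m g x) \<in> Sp L'" "f \<in> Sp L"
  shows "(\<lambda>x. q x * f x) \<in> Sp L'"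
proof -
  obtain b where b: "\<forall>x\<in>X. f x = (\<Sum>g\<in>G L. b g * m g x)"
    using assms(2) by (auto simp: Sp_def)
  have "(\<lambda>x. \<Sum>g\<in>G L. b g * (q x * m g x)) \<in> Sp L'"
    by (intro Sp_sum Sp_scale assms(1))
  then show ?thesis
    by (rule Sp_cong) (auto simp: b sum_distrib_left ac_simps)
qed

lemma Sp_mono: "f \<in> Sp L \<Longrightarrow> L \<le> L' \<Longrightarrow> f \<in> Sp L'"
  using Sp_mult[of L "\<lambda>_. 1" L' f] Sp_gen[of _ L'] by (auto simp: G_def PiE_iff) (meson atMost_iff le_trans)

lemma coord_Sp:
  assumes "v \<in> B" "f \<in> Sp L"
  shows "(\<lambda>x. x v * f x) \<in> Sp (Suc L)"
proof (rule Sp_mult[OF _ assms(2)])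
  fix g assume g: "g \<in> G L"
  obtain \<gamma> \<kappa> where [simp]: "g = (\<gamma>, \<kappa>)" by fastforce
  have *: "(\<gamma>(v := Suc (\<gamma> v)), \<kappa>) \<in> G (Suc L)"
    using g assms(1) by (auto simp: G_def PiE_iff extensional_def)
  have "(\<Prod>u\<in>B. x u ^ (\<gamma>(v := Suc (\<gamma> v))) u) = x v * (\<Prod>u\<in>B. x u ^ \<gamma> u)" for x :: "'v \<Rightarrow> complex"
  proof -
    have "(\<Prod>u\<in>B-{v}. x u ^ (\<gamma>(v := Suc (\<gamma> v))) u) = (\<Prod>u\<in>B-{v}. x u ^ \<gamma> u)"
      by (rule prod.cong) auto
    then show ?thesis
      by (simp add: prod.remove[OF finB assms(1)] ac_simps)
  qed
  then have "x v * m g x = m (\<gamma>(v := Suc (\<gamma> v)), \<kappa>) x" for x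
    by (simp add: m_def ac_simps)
  then show "(\<lambda>x. x v * m g x) \<in> Sp (Suc L)"
    using Sp_gen[OF *] by (intro Sp_cong[OF Sp_gen[OF *]]) simp
qed

text \<open>The shift \<open>d\<close> depends on \<open>p\<close> alone, not on \<open>L\<close> or
  \<open>f\<close>. This uniformity is what makes the bound on the exponents grow linearly under
  repeated multiplication.\<close>

lemma base_Sp:
  assumes "p \<in> polyon B"
  shows "\<exists>d. \<forall>L f. f \<in> Sp L \<longrightarrow> (\<lambda>x. p x * f x) \<in> Sp (L + d)"
  using assms
proof (induction rule: polyon.induct)
  case (const r)
  show ?case using Sp_scale by (intro exI[of _ 0]) auto
next
  case (coord v)
  show ?case using coord_Sp[OF coord] by (intro exI[of _ 1]) auto
next
  case (add p q)
  then obtain d d' where "\<forall>L f. f \<in> Sp L \<longrightarrow> (\<lambda>x. p x * f x) \<in> Sp (L + d)"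
    "\<forall>L f. f \<in> Sp L \<longrightarrow> (\<lambda>x. q x * f x) \<in> Sp (L + d')" by blast
  then have "(\<lambda>x. (p x + q x) * f x) \<in> Sp (L + max d d')" if "f \<in> Sp L" for L f
    using Sp_add[of "\<lambda>x. p x * f x" "L + max d d'" "\<lambda>x. q x * f x"] that
      Sp_mono[of "\<lambda>x. p x * f x" "L + d" "L + max d d'"] Sp_mono[of "\<lambda>x. q x * f x" "L + d'" "L + max d d'"]
    by (simp add: distrib_right)
  then show ?case by blast
next
  case (mult p q)
  then obtain d d' where *: "\<forall>L f. f \<in> Sp L \<longrightarrow> (\<lambda>x. p x * f x) \<in> Sp (L + d)"
    "\<forall>L f. f \<in> Sp L \<longrightarrow> (\<lambda>x. q x * f x) \<in> Sp (L + d')" by blast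
  have "(\<lambda>x. (p x * q x) * f x) \<in> Sp (L + (d' + d))" if "f \<in> Sp L" for L f
    using *(1)[rule_format, OF *(2)[rule_format, OF that]] by (simp add: ac_simps)
  then show ?case by blast
qed

text \<open>Multiplication by a coordinate raises one exponent. If it stays below \<open>E\<close>
  nothing is to be done; if it reaches \<open>E\<close>, the extra factor \<open>a\<close> allows
  the top power to be rewritten by the common relation.\<close>

lemma coord_mult_Sp:
  assumes "v \<in> V"
  shows "\<exists>d. \<forall>L f. f \<in> Sp L \<longrightarrow> (\<lambda>x. a x * x v * f x) \<in> Sp (L + d)"
proof -
  obtain d0 where d0: "\<And>L f. f \<in> Sp L \<Longrightarrow> (\<lambda>x. a x * f x) \<in> Sp (L + d0)"
    using base_Sp[OF aB] by blast
  obtain dc where dc: "\<And>k L f. f \<in> Sp L \<Longrightarrow> (\<lambda>x. c v k x * f x) \<in> Sp (L + dc k)"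
    using base_Sp[OF cB[OF assms]] by metis
  define d where "d = d0 + (\<Sum>k<E. dc k)"
  have dcd: "dc k \<le> d" if "k < E" for k
    using member_le_sum[of k "{..<E}" dc] that by (auto simp: d_def)
  have "(\<lambda>x. a x * x v * f x) \<in> Sp (L + d)" if f: "f \<in> Sp L" for L f
  proof (rule Sp_mult[OF _ f])
    fix g assume g: "g \<in> G L"
    obtain \<gamma> \<kappa> where gg [simp]: "g = (\<gamma>, \<kappa>)" by fastforce
    have upd: "(\<gamma>, \<kappa>(v := k)) \<in> G L" if "k < E" for k
      using g that assms by (auto simp: G_def PiE_iff extensional_def)
    have mk: "m (\<gamma>, \<kappa>(v := k)) x = x v ^ k * ((\<Prod>u\<in>B. x u ^ \<gamma> u) * (\<Prod>u\<in>V-{v}. x u ^ \<kappa> u))" for k x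
    proof -
      have "(\<Prod>u\<in>V-{v}. x u ^ (\<kappa>(v := k)) u) = (\<Prod>u\<in>V-{v}. x u ^ \<kappa> u)"
        by (rule prod.cong) auto
      then show ?thesis
        by (simp add: m_def prod.remove[OF finV assms] ac_simps)
    qed
    have mg: "m (\<gamma>, \<kappa>) x = x v ^ \<kappa> v * ((\<Prod>u\<in>B. x u ^ \<gamma> u) * (\<Prod>u\<in>V-{v}. x u ^ \<kappa> u))" for x
      using mk[of "\<kappa> v" x] by simp
    show "(\<lambda>x. a x * x v * m g x) \<in> Sp (L + d)"
    proof (cases "Suc (\<kappa> v) < E")
      case True
      have "(\<lambda>x. a x * m (\<gamma>, \<kappa>(v := Suc (\<kappa> v))) x) \<in> Sp (L + d)"
        by (rule Sp_mono[OF d0[OF Sp_gen[OF upd[OF True]]]]) (simp add: d_def)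
      then show ?thesis
        by (rule Sp_cong) (simp add: mk mg ac_simps)
    next
      case False
      have "\<kappa> v < E" using g assms by (auto simp: G_def PiE_iff)
      with False have E_eq: "Suc (\<kappa> v) = E" by simp
      have "(\<lambda>x. \<Sum>k<E. c v k x * m (\<gamma>, \<kappa>(v := k)) x) \<in> Sp (L + d)"
        by (intro Sp_sum Sp_mono[OF dc[OF Sp_gen[OF upd]]]) (auto intro: dcd)
      then show ?thesis
      proof (rule Sp_cong)
        fix x assume x: "x \<in> X"
        have "a x * x v * m g x = a x * x v ^ E * ((\<Prod>u\<in>B. x u ^ \<gamma> u) * (\<Prod>u\<in>V-{v}. x u ^ \<kappa> u))"
          by (simp add: mg E_eq[symmetric])
        also have "\<dots> = (\<Sum>k<E. c v k x * m (\<gamma>, \<kappa>(v := k)) x)"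
          by (simp add: rel[OF assms x] mk sum_distrib_right mult.assoc)
        finally show "(\<Sum>k<E. c v k x * m (\<gamma>, \<kappa>(v := k)) x) = a x * x v * m g x" by simp
      qed
    qed
  qed
  then show ?thesis by blast
qed

text \<open>Each coordinate factor costs one factor \<open>a\<close>. Summands that need different
  powers of \<open>a\<close> are first raised to a common power, which is the purpose of
  \<open>boost\<close>.\<close>

lemma poly_mult_Sp:
  assumes "p \<in> polyon V"
  shows "\<exists>j d. \<forall>L f. f \<in> Sp L \<longrightarrow> (\<lambda>x. a x ^ j * p x * f x) \<in> Sp (L + d)"
proof -
  have boost: "\<exists>d. \<forall>L f. f \<in> Sp L \<longrightarrow> (\<lambda>x. a x ^ (i + j) * p x * f x) \<in> Sp (L + d)"
    if p: "\<And>L f. f \<in> Sp L \<Longrightarrow> (\<lambda>x. a x ^ j * p x * f x) \<in> Sp (L + d)" for p d i j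
  proof -
    obtain d' where d': "\<And>L f. f \<in> Sp L \<Longrightarrow> (\<lambda>x. a x ^ i * f x) \<in> Sp (L + d')"
      using base_Sp[OF polyon_power[OF aB]] by blast
    have "(\<lambda>x. a x ^ (i + j) * p x * f x) \<in> Sp (L + (d + d'))" if "f \<in> Sp L" for L f
      using d'[OF p[OF that]] by (simp add: power_add ac_simps)
    then show ?thesis by blast
  qed
  show ?thesis using assms
  proof (induction rule: polyon.induct)
    case (const r)
    show ?case using Sp_scale by (intro exI[of _ 0]) auto
  next
    case (coord v)
    show ?case using coord_mult_Sp[OF coord] by - (rule exI[of _ 1], simp)
  next
    case (add p q)
    then obtain j d j' d' where *: "\<And>L f. f \<in> Sp L \<Longrightarrow> (\<lambda>x. a x ^ j * p x * f x) \<in> Sp (L + d)"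
      "\<And>L f. f \<in> Sp L \<Longrightarrow> (\<lambda>x. a x ^ j' * q x * f x) \<in> Sp (L + d')" by blast
    obtain e where e: "\<And>L f. f \<in> Sp L \<Longrightarrow> (\<lambda>x. a x ^ (j' + j) * p x * f x) \<in> Sp (L + e)"
      using boost[of j p d j', OF *(1)] by blast
    obtain e' where e': "\<And>L f. f \<in> Sp L \<Longrightarrow> (\<lambda>x. a x ^ (j + j') * q x * f x) \<in> Sp (L + e')"
      using boost[of j' q d' j, OF *(2)] by blast
    have "(\<lambda>x. a x ^ (j' + j) * (p x + q x) * f x) \<in> Sp (L + max e e')" if f: "f \<in> Sp L" for L f
      using Sp_add[OF Sp_mono[OF e[OF f], of "L + max e e'"] Sp_mono[OF e'[OF f], of "L + max e e'"]]
      by (simp add: distrib_right distrib_left add.commute)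
    then show ?case by blast
  next
    case (mult p q)
    then obtain j d j' d' where *: "\<And>L f. f \<in> Sp L \<Longrightarrow> (\<lambda>x. a x ^ j * p x * f x) \<in> Sp (L + d)"
      "\<And>L f. f \<in> Sp L \<Longrightarrow> (\<lambda>x. a x ^ j' * q x * f x) \<in> Sp (L + d')" by blast
    have "(\<lambda>x. a x ^ (j + j') * (p x * q x) * f x) \<in> Sp (L + (d' + d))" if "f \<in> Sp L" for L f
      using *(1)[OF *(2)[OF that]] by (simp add: power_add ac_simps)
    then show ?case by blast
  qed
qed

lemma one_Sp: "(\<lambda>x. 1) \<in> Sp 0"
proof -
  have "(restrict (\<lambda>_. 0) B, restrict (\<lambda>_. 0) V) \<in> G 0"
    using E by (auto simp: G_def)
  from Sp_gen[OF this] show ?thesis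
    by (rule Sp_cong) (simp add: m_def)
qed

text \<open>After multiplication by one power of \<open>A\<close>, there are more monomials in the
  family than spanning functions, so a nontrivial linear combination of them vanishes on
  \<open>X\<close>. The power of \<open>A\<close> is cancelled by irreducibility.\<close>

lemma dependent_family:
  fixes F :: "'u set"
  assumes X: "irred_on V X" "\<exists>x\<in>X. a x \<noteq> 0" and F: "finite F" "card B < card F"
    and f: "\<And>u. u \<in> F \<Longrightarrow> f u \<in> polyon V"
  shows "\<exists>p\<in>polyon F. (\<exists>w. p w \<noteq> 0) \<and> (\<forall>x\<in>X. p (\<lambda>u. f u x) = 0)"
proof -
  have "\<forall>u\<in>F. \<exists>j d. \<forall>L g. g \<in> Sp L \<longrightarrow> (\<lambda>x. a x ^ j * f u x * g x) \<in> Sp (L + d)"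
    using poly_mult_Sp[OF f] by blast
  then obtain j d where jd: "\<And>u L g. u \<in> F \<Longrightarrow> g \<in> Sp L \<Longrightarrow> (\<lambda>x. a x ^ j u * f u x * g x) \<in> Sp (L + d u)"
    by metis
  \<comment> \<open>A single power of \<open>a\<close> that serves every member of the
    family.\<close>
  define A where "A x = a x ^ (\<Sum>u\<in>F. j u)" for x
  have A: "A \<in> polyon B" unfolding A_def by (rule polyon_power[OF aB])
  obtain dA where dA: "\<And>L g. g \<in> Sp L \<Longrightarrow> (\<lambda>x. A x * g x) \<in> Sp (L + dA)"
    using base_Sp[OF A] by blast
  have "\<forall>u\<in>F. \<exists>d. \<forall>L g. g \<in> Sp L \<longrightarrow> (\<lambda>x. A x * f u x * g x) \<in> Sp (L + d)"
  proof
    fix u assume u: "u \<in> F"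
    define r where "r = (\<Sum>u\<in>F. j u) - j u"
    have r: "(\<Sum>u\<in>F. j u) = r + j u"
      using member_le_sum[OF u, of j] F(1) by (simp add: r_def)
    obtain d' where d': "\<And>L f. f \<in> Sp L \<Longrightarrow> (\<lambda>x. a x ^ r * f x) \<in> Sp (L + d')"
      using base_Sp[OF polyon_power[OF aB]] by blast
    have "(\<lambda>x. A x * f u x * g x) \<in> Sp (L + (d u + d'))" if "g \<in> Sp L" for L g
      using d'[OF jd[OF u that]] by (simp add: A_def r power_add ac_simps)
    then show "\<exists>d. \<forall>L g. g \<in> Sp L \<longrightarrow> (\<lambda>x. A x * f u x * g x) \<in> Sp (L + d)" by blast
  qed
  then obtain d' where d': "\<And>u L g. u \<in> F \<Longrightarrow> g \<in> Sp L \<Longrightarrow> (\<lambda>x. A x * f u x * g x) \<in> Sp (L + d' u)"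
    by metis
  define e where "e = dA + (\<Sum>u\<in>F. d' u)"
  have eA: "(\<lambda>x. A x * g x) \<in> Sp (L + e)" if "g \<in> Sp L" for g L
    by (rule Sp_mono[OF dA[OF that]]) (simp add: e_def)
  have ef: "(\<lambda>x. A x * f u x * g x) \<in> Sp (L + e)" if "u \<in> F" "g \<in> Sp L" for u g L
    by (rule Sp_mono[OF d'[OF that]]) (use member_le_sum[OF that(1), of d'] F(1) in \<open>simp add: e_def\<close>)
  have eAn: "(\<lambda>x. A x ^ n * g x) \<in> Sp (L + n * e)" if "g \<in> Sp L" for g L n
  proof (induction n)
    case (Suc n)
    from eA[OF Suc] show ?case by (simp add: ac_simps)
  qed (use that in simp)
  have efn: "(\<lambda>x. (A x * f u x) ^ n * g x) \<in> Sp (L + n * e)" if "u \<in> F" "g \<in> Sp L" for u g L n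
  proof (induction n)
    case (Suc n)
    from ef[OF that(1) Suc] show ?case by (simp add: ac_simps)
  qed (use that in simp)
  have monoSp: "(\<lambda>x. A x ^ (card F' * D) * (\<Prod>u\<in>F'. f u x ^ \<delta> u)) \<in> Sp (card F' * D * e)"
    if "F' \<subseteq> F" "\<And>u. u \<in> F' \<Longrightarrow> \<delta> u < D" for F' D and \<delta> :: "'u \<Rightarrow> nat"
    using finite_subset[OF that(1) F(1)] that
  proof (induction F' rule: finite_induct)
    case empty
    show ?case using one_Sp by simp
  next
    case (insert u F')
    then have IH: "(\<lambda>x. A x ^ (card F' * D) * (\<Prod>u\<in>F'. f u x ^ \<delta> u)) \<in> Sp (card F' * D * e)" by auto
    \<comment> \<open>The power of \<open>f u\<close> uses only \<delta>\<open>u\<close> factors of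
      \<open>A\<close>; the \<open>r\<close> missing factors are added so that all monomials share
      the same power of \<open>A\<close>.\<close>
    obtain r where r: "D = r + \<delta> u" using insert.prems(2)[of u] by (metis add.commute insertI1 less_imp_add_positive)
    from eAn[OF efn[OF _ IH, of u "\<delta> u"], of r] insert.prems
    have "(\<lambda>x. A x ^ r * ((A x * f u x) ^ \<delta> u * (A x ^ (card F' * D) * (\<Prod>u\<in>F'. f u x ^ \<delta> u))))
        \<in> Sp (card F' * D * e + \<delta> u * e + r * e)" by simp
    moreover have "card F' * D * e + \<delta> u * e + r * e = card (insert u F') * D * e"
      using insert.hyps by (simp add: r algebra_simps)
    moreover have "A x ^ r * ((A x * f u x) ^ \<delta> u * (A x ^ (card F' * D) * P))
        = A x ^ (card (insert u F') * D) * (f u x ^ \<delta> u * P)" for x P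
    proof -
      have "card (insert u F') * D = r + (\<delta> u + card F' * D)" using insert.hyps r by simp
      then show ?thesis by (simp add: power_add power_mult_distrib ac_simps)
    qed
    ultimately show ?case using insert.hyps by simp
  qed
  \<comment> \<open>With \<open>N = card F * D\<close>, the spanning set has at most a constant
    times \<open>D ^ card B\<close> elements. \<open>D\<close> exceeds that constant by one, hence
    \<open>D ^ Suc (card B)\<close> is larger.\<close>
  define D where "D = (card F * e + 1) ^ card B * E ^ card V + 1"
  define Dl where "Dl = PiE F (\<lambda>_. {..<D})"
  define N where "N = card F * D"
  have finDl: "finite Dl" using F by (simp add: Dl_def finite_PiE)
  have "(N * e + 1) ^ card B \<le> ((card F * e + 1) * D) ^ card B"
    by (rule power_mono) (auto simp: N_def D_def algebra_simps)
  then have "card (G (N * e)) \<le> (card F * e + 1) ^ card B * D ^ card B * E ^ card V"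
    unfolding cardG power_mult_distrib by (rule mult_right_mono) simp
  also have "\<dots> < D ^ card B * D"
    by (simp add: D_def algebra_simps)
  also have "\<dots> = D ^ Suc (card B)" by simp
  also have "\<dots> \<le> D ^ card F" using F(2) by (intro power_increasing) (auto simp: D_def)
  also have "\<dots> = card Dl" using F(1) by (simp add: Dl_def card_PiE)
  finally have card: "card (G (N * e)) < card Dl" .
  have "\<forall>\<delta>\<in>Dl. \<exists>b. \<forall>x\<in>X. A x ^ N * (\<Prod>u\<in>F. f u x ^ \<delta> u) = (\<Sum>g\<in>G (N * e). b g * m g x)"
  proof
    fix \<delta> assume "\<delta> \<in> Dl"
    then have "\<delta> u < D" if "u \<in> F" for u using that by (auto simp: Dl_def)
    from monoSp[OF subset_refl this] show "\<exists>b. \<forall>x\<in>X.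
        A x ^ N * (\<Prod>u\<in>F. f u x ^ \<delta> u) = (\<Sum>g\<in>G (N * e). b g * m g x)"
      by (simp add: Sp_def N_def)
  qed
  from bchoice[OF this] obtain b where b0: "\<forall>\<delta>\<in>Dl. \<forall>x\<in>X.
      A x ^ N * (\<Prod>u\<in>F. f u x ^ \<delta> u) = (\<Sum>g\<in>G (N * e). b \<delta> g * m g x)" ..
  then have b: "A x ^ N * (\<Prod>u\<in>F. f u x ^ \<delta> u) = (\<Sum>g\<in>G (N * e). b \<delta> g * m g x)"
    if "\<delta> \<in> Dl" "x \<in> X" for \<delta> x using that by blast
  obtain y where y: "\<exists>\<delta>\<in>Dl. y \<delta> \<noteq> 0" "\<forall>g\<in>G (N * e). (\<Sum>\<delta>\<in>Dl. y \<delta> * b \<delta> g) = 0"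
    using homogeneous_system[OF finG finDl card, of b] by blast
  define p where "p w = (\<Sum>\<delta>\<in>Dl. y \<delta> * (\<Prod>u\<in>F. w u ^ \<delta> u))" for w :: "'u \<Rightarrow> complex"
  have p: "p \<in> polyon F" unfolding p_def by (intro polyon_intros)
  have p0: "\<exists>w. p w \<noteq> 0"
    using y(1) monomials_independent[OF F(1)] unfolding p_def Dl_def by blast
  have pf: "(\<lambda>x. p (\<lambda>u. f u x)) \<in> polyon V"
    by (rule polyon_subst[OF p f])
  have "A x ^ N * p (\<lambda>u. f u x) = 0" if "x \<in> X" for x
  proof -
    have "A x ^ N * p (\<lambda>u. f u x) = (\<Sum>\<delta>\<in>Dl. y \<delta> * (A x ^ N * (\<Prod>u\<in>F. f u x ^ \<delta> u)))"
      by (simp add: p_def sum_distrib_left ac_simps)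
    also have "\<dots> = (\<Sum>\<delta>\<in>Dl. \<Sum>g\<in>G (N * e). y \<delta> * b \<delta> g * m g x)"
      by (intro sum.cong) (auto simp: b[OF _ that] sum_distrib_left mult.assoc)
    also have "\<dots> = (\<Sum>g\<in>G (N * e). (\<Sum>\<delta>\<in>Dl. y \<delta> * b \<delta> g) * m g x)"
      by (subst sum.swap) (simp add: sum_distrib_right)
    also have "\<dots> = 0" using y(2) by simp
    finally show ?thesis .
  qed
  moreover have "\<exists>x\<in>X. A x ^ N \<noteq> 0" using X(2) by (auto simp: A_def)
  moreover have "(\<lambda>x. A x ^ N) \<in> polyon V" using polyon_mono[OF A BV] by (rule polyon_power)
  ultimately have "\<forall>x\<in>X. p (\<lambda>u. f u x) = 0"
    using irred_onD[OF X(1) _ pf, of "\<lambda>x. A x ^ N"] by blast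
  with p p0 show ?thesis by blast
qed

end

text \<open>Supplies \<open>common_relation\<close>: the separate relations are multiplied by the
  leading coefficients of the others and by powers of their own coordinate, until all have the same
  leading coefficient \<open>A\<close> and the same degree \<open>E\<close>.\<close>

lemma dependent_of_algebraic:
  assumes X: "irred_on V X" and V: "finite V" "B \<subseteq> V" and alg: "\<And>v. v \<in> V \<Longrightarrow> algebraic_on X B v"
    and F: "finite F" "card B < card F" and f: "\<And>u. u \<in> F \<Longrightarrow> f u \<in> polyon V"
  shows "\<exists>p\<in>polyon F. (\<exists>w. p w \<noteq> 0) \<and> (\<forall>x\<in>X. p (\<lambda>u. f u x) = 0)"
proof (cases "X = {}")
  case True
  then show ?thesis by (intro bexI[of _ "\<lambda>_. 1"] polyon.const) auto
next
  case False
  from alg have "\<forall>v\<in>V. \<exists>e a. (\<forall>k. a k \<in> polyon B) \<and>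
     (\<forall>x\<in>X. (\<Sum>k\<le>e. a k x * x v ^ k) = 0) \<and> (\<exists>x\<in>X. a e x \<noteq> 0)"
    by (simp add: algebraic_on_def)
  from bchoice[OF this] obtain e where "\<forall>v\<in>V. \<exists>a. (\<forall>k. a k \<in> polyon B) \<and>
     (\<forall>x\<in>X. (\<Sum>k\<le>e v. a k x * x v ^ k) = 0) \<and> (\<exists>x\<in>X. a (e v) x \<noteq> 0)" ..
  from bchoice[OF this] obtain a where ea0: "\<forall>v\<in>V. (\<forall>k. a v k \<in> polyon B) \<and>
     (\<forall>x\<in>X. (\<Sum>k\<le>e v. a v k x * x v ^ k) = 0) \<and> (\<exists>x\<in>X. a v (e v) x \<noteq> 0)" ..
  have ea: "\<And>v k. v \<in> V \<Longrightarrow> a v k \<in> polyon B"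
     "\<And>v x. v \<in> V \<Longrightarrow> x \<in> X \<Longrightarrow> (\<Sum>k\<le>e v. a v k x * x v ^ k) = 0" "\<And>v. v \<in> V \<Longrightarrow> \<exists>x\<in>X. a v (e v) x \<noteq> 0"
    using ea0 by blast+
  define A where "A x = (\<Prod>v\<in>V. a v (e v) x)" for x
  \<comment> \<open>The sum bounds every single degree; the added one keeps \<open>E\<close>
    positive even if \<open>V\<close> is empty.\<close>
  define E where "E = (\<Sum>v\<in>V. e v) + 1"
  define c where "c v k x = (if E - e v \<le> k then - (\<Prod>u\<in>V-{v}. a u (e u) x) * a v (k - (E - e v)) x else 0)" for v k x
  interpret common_relation X V B A E c
  proof
    show "A \<in> polyon B" unfolding A_def by (intro polyon_intros ea)
    show "c v k \<in> polyon B" if "v \<in> V" for v k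
    proof -
      have "(\<lambda>x. c v k x) \<in> polyon B"
        unfolding c_def by (intro polyon_intros) (use ea(1) that in auto)
      then show ?thesis by simp
    qed
  next
    fix v x assume v: "v \<in> V" and x: "x \<in> X"
    define r where "r = E - e v"
    have Er: "E = e v + r" using member_le_sum[OF v, of e] V(1) by (simp add: r_def E_def)
    define P where "P = (\<Prod>u\<in>V-{v}. a u (e u) x)"
    have "a v (e v) x * x v ^ e v = - (\<Sum>k<e v. a v k x * x v ^ k)"
      using ea(2)[OF v x] by (simp add: lessThan_Suc_atMost[symmetric] add_eq_0_iff)
    moreover have AP: "A x = a v (e v) x * P"
      unfolding A_def P_def by (rule prod.remove[OF V(1) v])
    moreover from AP have "A x * x v ^ E = P * x v ^ r * (a v (e v) x * x v ^ e v)"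
      by (simp add: Er power_add ac_simps)
    ultimately have "A x * x v ^ E = P * x v ^ r * - (\<Sum>k<e v. a v k x * x v ^ k)"
      by simp
    also have "\<dots> = (\<Sum>k<e v. - P * a v k x * x v ^ (k + r))"
      by (simp add: sum_distrib_left sum_negf power_add ac_simps)
    also have "\<dots> = (\<Sum>k\<in>{r..<E}. - P * a v (k - r) x * x v ^ k)"
      by (rule sum.reindex_bij_witness[of _ "\<lambda>k. k - r" "\<lambda>k. k + r"]) (auto simp: Er)
    also have "\<dots> = (\<Sum>k<E. c v k x * x v ^ k)"
      by (rule sum.mono_neutral_cong_left) (auto simp: c_def r_def[symmetric] P_def)
    finally show "A x * x v ^ E = (\<Sum>k<E. c v k x * x v ^ k)" .
  qed (use V in \<open>auto simp: E_def\<close>)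
  have "\<exists>x\<in>X. A x \<noteq> 0" unfolding A_def
    by (rule irred_on_prod[OF X V(1) False]) (use ea polyon_mono[OF _ V(2)] in auto)
  from dependent_family[OF X this F f] show ?thesis .
qed

section \<open>Minimal relations and lifting of points\<close>

text \<open>Algebraic independence of the coordinate functions on \<open>X\<close>. The empty set of
  coordinates is independent exactly when \<open>X\<close> is nonempty, which is how emptiness of a
  fibre is detected later.\<close>

definition indep_on :: "('v \<Rightarrow> complex) set \<Rightarrow> 'v set \<Rightarrow> bool" where
  "indep_on X B \<longleftrightarrow> (\<forall>p\<in>polyon B. (\<forall>x\<in>X. p x = 0) \<longrightarrow> (\<forall>x. p x = 0))"

text \<open>\<open>zcl X B\<close> is the cylinder over the Zariski closure of the projection of \<open>X\<close> to the coordinates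
  in \<open>B\<close>; its points are the specializations of the ring of \<open>B\<close>-coordinate functions on \<open>X\<close>.\<close>
definition zcl :: "('v \<Rightarrow> complex) set \<Rightarrow> 'v set \<Rightarrow> ('v \<Rightarrow> complex) set" where
  "zcl X B = {w. \<forall>p\<in>polyon B. (\<forall>x\<in>X. p x = 0) \<longrightarrow> p w = 0}"

lemma indep_on_zcl: "indep_on X B \<Longrightarrow> zcl X B = UNIV"
  by (auto simp: indep_on_def zcl_def)

lemma indep_onD: "indep_on X B \<Longrightarrow> p \<in> polyon B \<Longrightarrow> p x \<noteq> 0 \<Longrightarrow> \<exists>x\<in>X. p x \<noteq> 0"
  by (auto simp: indep_on_def)

lemma algebraic_on_mono: "algebraic_on X B v \<Longrightarrow> B \<subseteq> C \<Longrightarrow> algebraic_on X C v"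
  unfolding algebraic_on_def by (meson polyon_mono)

lemma algebraic_of_graph:
  assumes "X \<noteq> {}" "g \<in> polyon B" "\<And>x. x \<in> X \<Longrightarrow> x v = g x"
  shows "algebraic_on X B v"
  unfolding algebraic_on_def
proof (intro exI conjI allI)
  let ?a = "\<lambda>k::nat. if k = 0 then (\<lambda>x. - g x) else (\<lambda>x. 1)"
  show "?a k \<in> polyon B" for k
    using polyon_uminus[OF assms(2)] by (auto intro: polyon.const)
  show "\<forall>x\<in>X. (\<Sum>k\<le>1. ?a k x * x v ^ k) = 0"
    using assms(3) by simp
  show "\<exists>x\<in>X. ?a 1 x \<noteq> 0" using assms(1) by auto
qed

text \<open>The relation is expanded in \<open>v\<close> and cut off at its highest coefficient that
  is not identically zero. That coefficient is a polynomial in \<open>B\<close>, so independence of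
  \<open>B\<close> keeps it from vanishing on all of \<open>X\<close>.\<close>

lemma algebraic_of_dependent:
  assumes "indep_on X B" "\<not> indep_on X (insert v B)"
  shows "algebraic_on X B v"
proof -
  obtain p w where p: "p \<in> polyon (insert v B)" "\<forall>x\<in>X. p x = 0" "p w \<noteq> 0"
    using assms(2) by (auto simp: indep_on_def)
  obtain n a where a: "\<And>k. a k \<in> polyon B" "\<And>x. p x = (\<Sum>k<n. a k x * x v ^ k)"
    using polyon_expand[OF p(1)] by blast
  define S where "S = {k. k < n \<and> (\<exists>x. a k x \<noteq> 0)}"
  define e where "e = Max S"
  have "S \<noteq> {}"
  proof
    assume "S = {}"
    then have "p w = 0" by (simp add: a(2) S_def)
    with p(3) show False by simp
  qed
  then have e: "e \<in> S" unfolding e_def by (intro Max_in) (auto simp: S_def)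
  have above: "a k x = 0" if "e < k" "k < n" for k x
  proof (rule ccontr)
    assume "a k x \<noteq> 0"
    then have "k \<in> S" using that by (auto simp: S_def)
    then have "k \<le> e" unfolding e_def by (intro Max_ge) (auto simp: S_def)
    with that show False by simp
  qed
  have "p x = (\<Sum>k\<le>e. a k x * x v ^ k)" for x
    unfolding a(2) by (rule sum.mono_neutral_right) (use e above in \<open>auto simp: S_def not_le\<close>)
  with p(2) have "\<forall>x\<in>X. (\<Sum>k\<le>e. a k x * x v ^ k) = 0" by simp
  moreover have "\<exists>x\<in>X. a e x \<noteq> 0"
    using e indep_onD[OF assms(1) a(1)] by (auto simp: S_def)
  ultimately show ?thesis using a(1) by (auto simp: algebraic_on_def)
qed

lemma exists_basis:
  assumes "finite V" "X \<noteq> {}" "B \<subseteq> V" "indep_on X B"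
  obtains C where "B \<subseteq> C" "C \<subseteq> V" "indep_on X C" "\<And>v. v \<in> V \<Longrightarrow> algebraic_on X C v"
proof -
  have "finite {C. C \<subseteq> V \<and> indep_on X C}" "B \<in> {C. C \<subseteq> V \<and> indep_on X C}"
    using assms by auto
  from finite_has_maximal2[OF this] obtain C where
    C: "C \<subseteq> V" "indep_on X C" "B \<subseteq> C" "\<And>D. D \<subseteq> V \<Longrightarrow> indep_on X D \<Longrightarrow> C \<subseteq> D \<Longrightarrow> C = D"
    by auto
  have "algebraic_on X C v" if "v \<in> V" for v
  proof (cases "v \<in> C")
    case True
    then show ?thesis by (intro algebraic_of_graph[OF assms(2), of "\<lambda>x. x v"]) (auto intro: polyon.coord)
  next
    case False
    then have "\<not> indep_on X (insert v C)" using C(1) C(4)[of "insert v C"] that by auto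
    then show ?thesis by (rule algebraic_of_dependent[OF C(2)])
  qed
  with C show thesis by (intro that[of C])
qed

text \<open>The dependence theorem applied to the coordinates in \<open>C\<close> themselves. Used
  in both directions it shows that all transcendence bases have the same size.\<close>

lemma card_indep_le:
  assumes "irred_on V X" "finite V" "B \<subseteq> V" "\<And>v. v \<in> V \<Longrightarrow> algebraic_on X B v"
    and "C \<subseteq> V" "indep_on X C"
  shows "card C \<le> card B"
proof (rule ccontr)
  assume "\<not> card C \<le> card B"
  then have "\<exists>p\<in>polyon C. (\<exists>w. p w \<noteq> 0) \<and> (\<forall>x\<in>X. p (\<lambda>u. x u) = 0)"
    using assms by (intro dependent_of_algebraic[OF assms(1-4)]) (auto intro: polyon.coord finite_subset)
  with assms(6) show False by (auto simp: indep_on_def)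
qed

text \<open>Up to powers of the leading coefficient every relation for \<open>v\<close> is a multiple of one of minimal
  degree, so each root of the specialized minimal relation extends the specialization.\<close>
lemma minimal_relation:
  fixes X :: "('v \<Rightarrow> complex) set"
  assumes vB: "v \<notin> B" and alg: "algebraic_on X B v"
  obtains e a where "\<And>k. a k \<in> polyon B" "0 < e" "\<exists>x\<in>X. a e x \<noteq> 0"
    "\<And>x. x \<in> X \<Longrightarrow> (\<Sum>k\<le>e. a k x * x v ^ k) = 0"
    "\<And>w \<xi>. w \<in> zcl X B \<Longrightarrow> a e w \<noteq> 0 \<Longrightarrow> (\<Sum>k\<le>e. a k w * \<xi> ^ k) = 0 \<Longrightarrow> w(v := \<xi>) \<in> zcl X (insert v B)"
    "\<exists>x\<in>X. (\<Sum>k<e. of_nat (Suc k) * a (Suc k) x * x v ^ k) \<noteq> 0"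
proof -
  define Q where "Q e \<longleftrightarrow> (\<exists>a. (\<forall>k. a k \<in> polyon B) \<and>
     (\<forall>x\<in>X. (\<Sum>k\<le>e. a k x * x v ^ k) = 0) \<and> (\<exists>x\<in>X. a e x \<noteq> 0))" for e
  define e where "e = (LEAST e. Q e)"
  have "Q e" unfolding e_def by (rule LeastI_ex) (use alg in \<open>auto simp: Q_def algebraic_on_def\<close>)
  then obtain a where a: "\<And>k. a k \<in> polyon B" "\<And>x. x \<in> X \<Longrightarrow> (\<Sum>k\<le>e. a k x * x v ^ k) = 0"
    "\<exists>x\<in>X. a e x \<noteq> 0" by (auto simp: Q_def)
  have least: "\<forall>x\<in>X. b n x = 0" if "n < e" "\<And>k. b k \<in> polyon B" "\<forall>x\<in>X. (\<Sum>k\<le>n. b k x * x v ^ k) = 0" for b n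
  proof -
    have "\<not> Q n" using not_less_Least that(1) unfolding e_def .
    with that(2,3) show ?thesis unfolding Q_def by blast
  qed
  \<comment> \<open>A relation shorter than the minimal degree is trivial on \<open>X\<close>: its
    coefficients are peeled off from the top, each vanishing by minimality.\<close>
  have small: "\<forall>k<n. \<forall>x\<in>X. b k x = 0"
    if "n \<le> e" "\<And>k. b k \<in> polyon B" "\<forall>x\<in>X. (\<Sum>k<n. b k x * x v ^ k) = 0" for b n
    using that(1,3)
  proof (induction n)
    case (Suc n)
    have "\<forall>x\<in>X. b n x = 0"
      by (rule least[OF _ that(2)]) (use Suc.prems in \<open>auto simp: lessThan_Suc_atMost\<close>)
    moreover from this have "\<forall>k<n. \<forall>x\<in>X. b k x = 0" using Suc by auto
    ultimately show ?case by (auto simp: less_Suc_eq)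
  qed simp
  have root: "(\<Sum>k<n. b k w * \<xi> ^ k) = 0"
    if w: "w \<in> zcl X B" "a e w \<noteq> 0" "(\<Sum>k\<le>e. a k w * \<xi> ^ k) = 0"
      and b: "\<And>k. b k \<in> polyon B" "\<forall>x\<in>X. (\<Sum>k<n. b k x * x v ^ k) = 0" for w \<xi> b n
    using b
  proof (induction n arbitrary: b)
    case (Suc n)
    show ?case
    proof (cases "Suc n \<le> e")
      case True
      from small[OF True Suc.prems] have "b k w = 0" if "k < Suc n" for k
        using w(1) Suc.prems(1) that by (auto simp: zcl_def)
      then show ?thesis by simp
    next
      case False
      \<comment> \<open>One step of pseudo-division: the relation times the leading coefficient
        \<open>a e\<close>, minus \<open>b n\<close> times the suitably shifted minimal relation.
        The terms of degree \<open>n\<close> cancel.\<close>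
      define b' where "b' k x = a e x * b k x - (if n - e \<le> k then b n x * a (k - (n - e)) x else 0)" for k x
      have b': "b' k \<in> polyon B" for k
      proof -
        have "(\<lambda>x. b' k x) \<in> polyon B" unfolding b'_def by (intro polyon_intros a Suc.prems)
        then show ?thesis by simp
      qed
      have id: "(\<Sum>k<n. b' k x * t ^ k)
          = a e x * (\<Sum>k<Suc n. b k x * t ^ k) - b n x * t ^ (n - e) * (\<Sum>k\<le>e. a k x * t ^ k)" for x t
      proof -
        have "(\<Sum>k\<le>e. a k x * t ^ k) * t ^ (n - e) = (\<Sum>k\<in>{n-e..n}. a (k - (n - e)) x * t ^ k)"
          unfolding sum_distrib_right
          by (rule sum.reindex_bij_witness[of _ "\<lambda>k. k - (n - e)" "\<lambda>k. k + (n - e)"])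
            (use False in \<open>auto simp: mult.assoc power_add[symmetric]\<close>)
        also have "\<dots> = (\<Sum>k<Suc n. (if n - e \<le> k then a (k - (n - e)) x else 0) * t ^ k)"
          by (rule sum.mono_neutral_cong_left) auto
        finally have "b n x * ((\<Sum>k\<le>e. a k x * t ^ k) * t ^ (n - e))
            = (\<Sum>k<Suc n. b n x * ((if n - e \<le> k then a (k - (n - e)) x else 0) * t ^ k))"
          by (simp only: sum_distrib_left)
        also have "\<dots> = (\<Sum>k<Suc n. (if n - e \<le> k then b n x * a (k - (n - e)) x else 0) * t ^ k)"
          by (rule sum.cong) auto
        finally have "b n x * t ^ (n - e) * (\<Sum>k\<le>e. a k x * t ^ k)
            = (\<Sum>k<Suc n. (if n - e \<le> k then b n x * a (k - (n - e)) x else 0) * t ^ k)"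
          by (simp only: ac_simps)
        moreover have "b' n x = 0" using False by (simp add: b'_def)
        then have "(\<Sum>k<n. b' k x * t ^ k) = (\<Sum>k<Suc n. b' k x * t ^ k)" by simp
        ultimately show ?thesis
          by (simp add: b'_def sum_subtractf left_diff_distrib sum_distrib_left mult.assoc del: sum.lessThan_Suc)
      qed
      have "(\<Sum>k<n. b' k w * \<xi> ^ k) = 0"
        by (rule Suc.IH[OF b']) (simp add: id a(2) Suc.prems(2) del: sum.lessThan_Suc)
      then show ?thesis using w by (simp add: id del: sum.lessThan_Suc)
    qed
  qed simp
  show thesis
  proof (rule that[of a e])
    show e0: "0 < e" using a(2,3) by (cases e) auto
    show "w(v := \<xi>) \<in> zcl X (insert v B)"
      if w: "w \<in> zcl X B" "a e w \<noteq> 0" "(\<Sum>k\<le>e. a k w * \<xi> ^ k) = 0" for w \<xi>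
      unfolding zcl_def
    proof (intro CollectI ballI impI)
      fix p assume p: "p \<in> polyon (insert v B)" "\<forall>x\<in>X. p x = 0"
      obtain n b where b: "\<And>k. b k \<in> polyon B" "\<And>x. p x = (\<Sum>k<n. b k x * x v ^ k)"
        using polyon_expand[OF p(1)] by blast
      have "b k (w(v := \<xi>)) = b k w" for k
        by (rule polyon_cong[OF b(1)]) (use vB in auto)
      then show "p (w(v := \<xi>)) = 0"
        using root[OF w, of b n] b(1) p(2) by (simp add: b(2))
    qed
    \<comment> \<open>Characteristic zero: the derivative has degree \<open>e - 1\<close> and top
      coefficient \<open>e\<close> times \<open>a e\<close>, so it cannot vanish on \<open>X\<close>
      without contradicting minimality.\<close>
    show "\<exists>x\<in>X. (\<Sum>k<e. of_nat (Suc k) * a (Suc k) x * x v ^ k) \<noteq> 0"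
    proof (rule ccontr)
      assume "\<not> ?thesis"
      then have "\<forall>x\<in>X. (\<Sum>k<e. (of_nat (Suc k) * a (Suc k) x) * x v ^ k) = 0" by blast
      moreover have "(\<lambda>x. of_nat (Suc k) * a (Suc k) x) \<in> polyon B" for k
        by (intro polyon_intros a)
      ultimately have "\<forall>k<e. \<forall>x\<in>X. of_nat (Suc k) * a (Suc k) x = 0"
        by (intro small[of e "\<lambda>k x. of_nat (Suc k) * a (Suc k) x"]) auto
      moreover have "e - 1 < e" "Suc (e - 1) = e" using e0 by auto
      ultimately have "\<forall>x\<in>X. of_nat e * a e x = 0" by metis
      with e0 a(3) show False by simp
    qed
  qed (use a in auto)
qed

text \<open>\<open>c\<close> is the lowest nonzero coefficient of an algebraic equation for \<open>\<beta>\<close> over \<open>B\<close>: it plays the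
  role of the norm of \<open>\<beta>\<close>.\<close>
lemma nonvanishing_norm:
  assumes X: "irred_on V X" and V: "finite V" "B \<subseteq> V" and alg: "\<And>v. v \<in> V \<Longrightarrow> algebraic_on X B v"
    and ind: "indep_on X B" and \<beta>: "\<beta> \<in> polyon V" "\<exists>x\<in>X. \<beta> x \<noteq> 0"
  obtains c where "c \<in> polyon B" "\<exists>x. c x \<noteq> 0"
    "\<And>V' w. B \<subseteq> V' \<Longrightarrow> \<beta> \<in> polyon V' \<Longrightarrow> w \<in> zcl X V' \<Longrightarrow> c w \<noteq> 0 \<Longrightarrow> \<beta> w \<noteq> 0"
proof -
  \<comment> \<open>A family with one member more than \<open>B\<close>: the index
    \<open>None\<close> stands for \<beta>, and \<open>Some b\<close> for the coordinate
    \<open>b\<close>. Its algebraic dependence is an equation for \<beta> over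
    \<open>B\<close>.\<close>
  define f where "f u x = (case u of None \<Rightarrow> \<beta> x | Some b \<Rightarrow> x b)" for u and x :: "'a \<Rightarrow> complex"
  have fs: "f (Some b) = (\<lambda>x. x b)" "f None = \<beta>" for b by (auto simp: f_def fun_eq_iff)
  have finB: "finite B" using V finite_subset by blast
  have "card (insert None (Some ` B)) = card B + 1"
    using finB by (subst card_insert_disjoint) (auto simp: card_image)
  then have "\<exists>p\<in>polyon (insert None (Some ` B)). (\<exists>w. p w \<noteq> 0) \<and> (\<forall>x\<in>X. p (\<lambda>u. f u x) = 0)"
    using finB V(2) \<beta>(1) by (intro dependent_of_algebraic[OF X V alg]) (auto simp: fs subset_iff intro!: polyon.coord)
  then obtain p z where p: "p \<in> polyon (insert None (Some ` B))" "p z \<noteq> 0" "\<And>x. x \<in> X \<Longrightarrow> p (\<lambda>u. f u x) = 0"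
    by blast
  obtain n a where a: "\<And>k. a k \<in> polyon (Some ` B)" "\<And>x. p x = (\<Sum>k<n. a k x * x None ^ k)"
    using polyon_expand[OF p(1)] by blast
  define a' where "a' k x = a k (\<lambda>u. f u x)" for k x
  have a': "a' k \<in> polyon B" for k
  proof -
    have "(\<lambda>x. a' k x) \<in> polyon B" unfolding a'_def
      by (rule polyon_subst[OF a(1)]) (auto simp: fs intro: polyon.coord)
    then show ?thesis by simp
  qed
  have a'_z: "a' k (\<lambda>b. z (Some b)) = a k z" for k
    unfolding a'_def by (rule polyon_cong[OF a(1)]) (auto simp: f_def)
  define k0 where "k0 = (LEAST k. \<exists>x. a' k x \<noteq> 0)"
  obtain k1 where k1: "k1 < n" "a k1 z \<noteq> 0"
    using p(2) unfolding a(2) by (metis (no_types, lifting) lessThan_iff mult_eq_0_iff sum.neutral)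
  then have "\<exists>x. a' k1 x \<noteq> 0" using a'_z by metis
  then have k0: "\<exists>x. a' k0 x \<noteq> 0" "k0 \<le> k1"
    unfolding k0_def by (rule LeastI, rule Least_le)
  have below: "a' k x = 0" if "k < k0" for k x
    using not_less_Least[of k "\<lambda>k. \<exists>x. a' k x \<noteq> 0"] that by (auto simp: k0_def)
  \<comment> \<open>The equation with the factor \<beta>\<open>^ k0\<close> removed. By
    irreducibility \<open>S\<close> still vanishes on \<open>X\<close>, and its constant term in
    \<beta> is the lowest coefficient; a zero of \<beta> in the closure would therefore be a zero of
    that coefficient.\<close>
  define S where "S x = (\<Sum>i<n-k0. a' (k0 + i) x * \<beta> x ^ i)" for x
  have S: "S \<in> polyon V'" if "B \<subseteq> V'" "\<beta> \<in> polyon V'" for V'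
  proof -
    have "(\<lambda>x. S x) \<in> polyon V'"
      unfolding S_def by (intro polyon_intros that polyon_mono[OF a' that(1)])
    then show ?thesis by simp
  qed
  have "\<beta> x ^ k0 * S x = 0" if "x \<in> X" for x
  proof -
    have "\<beta> x ^ k0 * S x = (\<Sum>i<n-k0. a' (k0 + i) x * \<beta> x ^ (k0 + i))"
      by (simp add: S_def sum_distrib_left power_add ac_simps)
    also have "\<dots> = (\<Sum>k\<in>{k0..<n}. a' k x * \<beta> x ^ k)"
      by (rule sum.reindex_bij_witness[of _ "\<lambda>k. k - k0" "\<lambda>k. k0 + k"]) auto
    also have "\<dots> = (\<Sum>k<n. a' k x * \<beta> x ^ k)"
      by (rule sum.mono_neutral_left) (auto simp: below)
    also have "\<dots> = 0" using p(3)[OF that] by (simp add: a(2) a'_def fs)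
    finally show ?thesis .
  qed
  moreover have "\<exists>x\<in>X. \<beta> x ^ k0 \<noteq> 0" using \<beta>(2) by auto
  ultimately have S0: "\<forall>x\<in>X. S x = 0"
    using irred_onD[OF X polyon_power[OF \<beta>(1)] S[OF V(2) \<beta>(1)]] by blast
  show thesis
  proof (rule that[OF a' k0(1)])
    fix V' w assume V': "B \<subseteq> V'" "\<beta> \<in> polyon V'" and w: "w \<in> zcl X V'" "a' k0 w \<noteq> 0"
    show "\<beta> w \<noteq> 0"
    proof
      assume "\<beta> w = 0"
      moreover obtain r where "n - k0 = Suc r" using k0(2) k1(1) by (metis Suc_diff_Suc le_less_trans)
      ultimately have "S w = a' k0 w"
        by (simp add: S_def sum.lessThan_Suc_shift del: sum.lessThan_Suc)
      moreover have "S w = 0" using S[OF V'] S0 w(1) by (auto simp: zcl_def)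
      ultimately show False using w(2) by simp
    qed
  qed
qed

definition cpoly :: "(nat \<Rightarrow> complex) \<Rightarrow> nat \<Rightarrow> complex poly" where
  "cpoly a e = (\<Sum>k\<le>e. monom (a k) k)"

lemma poly_cpoly: "poly (cpoly a e) z = (\<Sum>k\<le>e. a k * z ^ k)"
  by (simp add: cpoly_def poly_sum poly_monom)

lemma coeff_cpoly: "coeff (cpoly a e) k = (if k \<le> e then a k else 0)"
  by (simp add: cpoly_def coeff_sum sum.delta cong: if_cong)

lemma degree_cpoly: "a e \<noteq> 0 \<Longrightarrow> degree (cpoly a e) = e"
  by (intro antisym degree_le le_degree) (auto simp: coeff_cpoly)

lemma cpoly_root:
  assumes "a e \<noteq> 0" "0 < e"
  obtains z where "(\<Sum>k\<le>e. a k * z ^ k) = (0::complex)"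
proof -
  have "\<not> constant (poly (cpoly a e))"
    using assms by (simp add: constant_degree degree_cpoly)
  then obtain z where "poly (cpoly a e) z = 0" using fundamental_theorem_of_algebra by blast
  then show thesis using that by (simp add: poly_cpoly)
qed

text \<open>The coordinates outside \<open>B\<close> are adjoined one at a time, each as a root of
  its specialized minimal relation. The leading coefficient of that relation involves coordinates
  adjoined earlier, so its nonvanishing is secured by a norm condition on \<open>B\<close> alone.
  \<alpha> is the product of these conditions.\<close>

lemma lift_points:
  assumes X: "irred_on V X" and V: "finite V" "B \<subseteq> V" and alg: "\<And>v. v \<in> V \<Longrightarrow> algebraic_on X B v"
    and ind: "indep_on X B"
  obtains \<alpha> where "\<alpha> \<in> polyon B" "\<exists>x. \<alpha> x \<noteq> 0"
    "\<And>w. \<alpha> w \<noteq> 0 \<Longrightarrow> \<exists>w'\<in>zcl X V. \<forall>b\<in>B. w' b = w b"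
proof -
  have "\<exists>\<alpha>\<in>polyon B. (\<exists>x. \<alpha> x \<noteq> 0) \<and> (\<forall>w. \<alpha> w \<noteq> 0 \<longrightarrow> (\<exists>w'\<in>zcl X (B \<union> D). \<forall>b\<in>B. w' b = w b))"
    if "finite D" "D \<subseteq> V - B" for D
    using that
  proof (induction D rule: finite_induct)
    case empty
    show ?case by (rule bexI[of _ "\<lambda>_. 1"]) (auto simp: indep_on_zcl[OF ind] intro: polyon.const)
  next
    case (insert v D)
    then obtain \<alpha> where \<alpha>: "\<alpha> \<in> polyon B" "\<exists>x. \<alpha> x \<noteq> 0"
      "\<And>w. \<alpha> w \<noteq> 0 \<Longrightarrow> \<exists>w'\<in>zcl X (B \<union> D). \<forall>b\<in>B. w' b = w b" by blast
    have v: "v \<notin> B \<union> D" "algebraic_on X (B \<union> D) v"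
      using insert algebraic_on_mono[OF alg] by auto
    obtain e a where ea: "\<And>k. a k \<in> polyon (B \<union> D)" "0 < e" "\<exists>x\<in>X. a e x \<noteq> 0"
      "\<And>w \<xi>. w \<in> zcl X (B \<union> D) \<Longrightarrow> a e w \<noteq> 0 \<Longrightarrow> (\<Sum>k\<le>e. a k w * \<xi> ^ k) = 0 \<Longrightarrow>
        w(v := \<xi>) \<in> zcl X (insert v (B \<union> D))"
      by (rule minimal_relation[OF v]) blast
    have "a e \<in> polyon V" using insert.prems V by (intro polyon_mono[OF ea(1)]) auto
    then obtain c where c: "c \<in> polyon B" "\<exists>x. c x \<noteq> 0"
      "\<And>V' w. B \<subseteq> V' \<Longrightarrow> a e \<in> polyon V' \<Longrightarrow> w \<in> zcl X V' \<Longrightarrow> c w \<noteq> 0 \<Longrightarrow> a e w \<noteq> 0"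
      using nonvanishing_norm[OF X V alg ind _ ea(3)] by blast
    show ?case
    proof (rule bexI[of _ "\<lambda>x. \<alpha> x * c x"], intro conjI allI impI)
      show "(\<lambda>x. \<alpha> x * c x) \<in> polyon B" by (intro polyon_intros \<alpha> c)
      show "\<exists>x. \<alpha> x * c x \<noteq> 0" using polyon_nonzero_common[OF \<alpha>(1) c(1)] \<alpha>(2) c(2) by auto
      fix w assume w: "\<alpha> w * c w \<noteq> 0"
      then obtain w' where w': "w' \<in> zcl X (B \<union> D)" "\<forall>b\<in>B. w' b = w b" using \<alpha>(3)[of w] by auto
      have "c w' = c w" by (rule polyon_cong[OF c(1)]) (use w' in auto)
      then have "a e w' \<noteq> 0" using w c(3)[OF _ ea(1) w'(1)] by auto
      moreover from cpoly_root[of "\<lambda>k. a k w'", OF this ea(2)]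
      obtain z where "(\<Sum>k\<le>e. a k w' * z ^ k) = 0" by blast
      ultimately have "w'(v := z) \<in> zcl X (insert v (B \<union> D))" by (rule ea(4)[OF w'(1)])
      moreover have "\<forall>b\<in>B. (w'(v := z)) b = w b" using w'(2) v by auto
      ultimately show "\<exists>w'\<in>zcl X (B \<union> insert v D). \<forall>b\<in>B. w' b = w b"
        by (intro bexI[of _ "w'(v := z)"]) simp_all
    qed
  qed
  from this[of "V - B"] V that show thesis by (auto simp: Un_absorb1)
qed

section \<open>Polydiscs and locally holomorphic root functions\<close>

definition polydisc :: "'v set \<Rightarrow> real \<Rightarrow> ('v \<Rightarrow> complex) \<Rightarrow> ('v \<Rightarrow> complex) set" where
  "polydisc S \<epsilon> w0 = {w. (\<forall>v. v \<notin> S \<longrightarrow> w v = w0 v) \<and> (\<forall>v\<in>S. norm (w v - w0 v) < \<epsilon>)}"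

text \<open>Neighbourhoods of \<open>w0\<close> within the affine slice of points that agree with
  \<open>w0\<close> off \<open>S\<close>.\<close>

definition nearby :: "'v set \<Rightarrow> ('v \<Rightarrow> complex) \<Rightarrow> ('v \<Rightarrow> complex) filter" where
  "nearby S w0 = (INF \<epsilon>\<in>{0<..}. principal (polydisc S \<epsilon> w0))"

definition segm :: "('v \<Rightarrow> complex) \<Rightarrow> ('v \<Rightarrow> complex) \<Rightarrow> complex \<Rightarrow> 'v \<Rightarrow> complex" where
  "segm w w' z = (\<lambda>v. w v + z * (w' v - w v))"

lemma polydisc_center: "0 < \<epsilon> \<Longrightarrow> w0 \<in> polydisc S \<epsilon> w0"
  by (simp add: polydisc_def)

lemma polydisc_mono:
  assumes "S \<subseteq> S'" "0 < \<epsilon>" "\<epsilon> \<le> \<epsilon>'"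
  shows "polydisc S \<epsilon> w0 \<subseteq> polydisc S' \<epsilon>' w0"
proof
  fix w assume w: "w \<in> polydisc S \<epsilon> w0"
  have "norm (w v - w0 v) < \<epsilon>'" for v
    using w assms by (cases "v \<in> S") (auto simp: polydisc_def intro: less_le_trans)
  then show "w \<in> polydisc S' \<epsilon>' w0"
    using w assms(1) by (auto simp: polydisc_def subset_iff)
qed

lemma eventually_nearby:
  "eventually Q (nearby S w0) \<longleftrightarrow> (\<exists>\<epsilon>>0. \<forall>w\<in>polydisc S \<epsilon> w0. Q w)"
proof -
  have "eventually Q (nearby S w0) \<longleftrightarrow> (\<exists>\<epsilon>\<in>{0<..}. eventually Q (principal (polydisc S \<epsilon> w0)))"
    unfolding nearby_def
  proof (rule eventually_INF_base)
    fix a b :: real assume "a \<in> {0<..}" "b \<in> {0<..}"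
    then show "\<exists>x\<in>{0<..}. principal (polydisc S x w0)
        \<le> inf (principal (polydisc S a w0)) (principal (polydisc S b w0))"
      by (intro bexI[of _ "min a b"]) (auto simp: polydisc_def)
  qed auto
  then show ?thesis by (auto simp: eventually_principal)
qed

lemma tendsto_coord_nearby: "((\<lambda>w. w v) \<longlongrightarrow> w0 v) (nearby S w0)"
proof (rule tendstoI)
  fix e :: real assume "0 < e"
  then show "\<forall>\<^sub>F w in nearby S w0. dist (w v) (w0 v) < e"
    unfolding eventually_nearby
    by (intro exI[of _ e]) (cases "v \<in> S", auto simp: polydisc_def dist_norm)
qed

lemma polyon_tendsto: "p \<in> polyon V \<Longrightarrow> (p \<longlongrightarrow> p w0) (nearby S w0)"
  by (induction rule: polyon.induct) (auto intro: tendsto_intros tendsto_coord_nearby)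

lemma eventually_off: "\<forall>\<^sub>F w in nearby S w0. \<forall>v. v \<notin> S \<longrightarrow> w v = w0 v"
  unfolding eventually_nearby by (intro exI[of _ 1]) (auto simp: polydisc_def)

lemma eventually_in_polydisc:
  assumes "finite S" "w1 \<in> polydisc S \<epsilon> w0"
  shows "\<forall>\<^sub>F w in nearby S w1. w \<in> polydisc S \<epsilon> w0"
proof -
  have "\<forall>\<^sub>F w in nearby S w1. \<forall>v\<in>S. norm (w v - w0 v) < \<epsilon>"
  proof (rule eventually_ball_finite[OF assms(1)], rule ballI)
    fix v assume "v \<in> S"
    have "((\<lambda>w. norm (w v - w0 v)) \<longlongrightarrow> norm (w1 v - w0 v)) (nearby S w1)"
      by (intro tendsto_intros tendsto_coord_nearby)
    then show "\<forall>\<^sub>F w in nearby S w1. norm (w v - w0 v) < \<epsilon>"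
      by (rule order_tendstoD) (use assms(2) \<open>v \<in> S\<close> in \<open>auto simp: polydisc_def\<close>)
  qed
  with eventually_off[of S w1] show ?thesis
    by eventually_elim (use assms(2) in \<open>auto simp: polydisc_def\<close>)
qed

lemma eventually_segm:
  assumes S: "finite S" "\<And>v. v \<notin> S \<Longrightarrow> w v = w' v" and Q: "eventually Q (nearby S (segm w w' z1))"
  shows "\<forall>\<^sub>F z in nhds z1. Q (segm w w' z)"
proof -
  obtain \<epsilon> where \<epsilon>: "\<epsilon> > 0" "\<And>u. u \<in> polydisc S \<epsilon> (segm w w' z1) \<Longrightarrow> Q u"
    using Q by (auto simp: eventually_nearby)
  have "\<forall>\<^sub>F z in nhds z1. \<forall>v\<in>S. norm (segm w w' z v - segm w w' z1 v) < \<epsilon>"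
  proof (rule eventually_ball_finite[OF S(1)], rule ballI)
    fix v
    have "((\<lambda>z. norm (segm w w' z v - segm w w' z1 v)) \<longlongrightarrow> norm (segm w w' z1 v - segm w w' z1 v)) (nhds z1)"
      unfolding segm_def by (intro tendsto_intros filterlim_ident)
    then show "\<forall>\<^sub>F z in nhds z1. norm (segm w w' z v - segm w w' z1 v) < \<epsilon>"
      by (rule order_tendstoD) (use \<epsilon> in simp)
  qed
  then show ?thesis
    by eventually_elim (use S(2) in \<open>auto intro!: \<epsilon>(2) simp: polydisc_def, auto simp: segm_def\<close>)
qed

lemma off_polydisc: "w \<in> polydisc S \<epsilon> w0 \<Longrightarrow> w' \<in> polydisc S \<epsilon> w0 \<Longrightarrow> v \<notin> S \<Longrightarrow> w v = w' v"
  by (simp add: polydisc_def)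

lemma segm_ends [simp]: "segm w w' 0 = w" "segm w w' 1 = w'"
  by (auto simp: segm_def)

lemma open_segm:
  assumes "finite S" "w \<in> polydisc S \<epsilon> w0" "w' \<in> polydisc S \<epsilon> w0"
  shows "open {z. segm w w' z \<in> polydisc S \<epsilon> w0}"
  unfolding open_subopen[of "{z. segm w w' z \<in> polydisc S \<epsilon> w0}"]
proof
  fix z1 assume "z1 \<in> {z. segm w w' z \<in> polydisc S \<epsilon> w0}"
  then have "\<forall>\<^sub>F z in nhds z1. segm w w' z \<in> polydisc S \<epsilon> w0"
    using eventually_segm[OF assms(1) off_polydisc[OF assms(2,3)] eventually_in_polydisc[OF assms(1)]] by simp
  then show "\<exists>T. open T \<and> z1 \<in> T \<and> T \<subseteq> {z. segm w w' z \<in> polydisc S \<epsilon> w0}"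
    by (auto simp: eventually_nhds)
qed

text \<open>Needed for connectedness: the identity theorem is applied on this set of
  parameters.\<close>

lemma convex_segm: "convex {z. segm w w' z \<in> polydisc S \<epsilon> w0}"
proof (rule convexI)
  fix x y :: complex and u v :: real
  assume xy: "x \<in> {z. segm w w' z \<in> polydisc S \<epsilon> w0}" "y \<in> {z. segm w w' z \<in> polydisc S \<epsilon> w0}"
    and uv: "0 \<le> u" "0 \<le> v" "u + v = 1"
  have eq: "segm w w' (u *\<^sub>R x + v *\<^sub>R y) i - c = u *\<^sub>R (segm w w' x i - c) + v *\<^sub>R (segm w w' y i - c)" for i c
  proof -
    have "of_real u + of_real v = (1::complex)" using uv(3) by (metis of_real_1 of_real_add)
    then have v: "of_real v = (1::complex) - of_real u" by (simp add: algebra_simps)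
    show ?thesis unfolding segm_def scaleR_conv_of_real v by (simp add: algebra_simps)
  qed
  have "norm (segm w w' (u *\<^sub>R x + v *\<^sub>R y) i - w0 i) < \<epsilon>" if "i \<in> S" for i
  proof -
    have "segm w w' x i - w0 i \<in> ball 0 \<epsilon>" "segm w w' y i - w0 i \<in> ball 0 \<epsilon>"
      using xy that by (auto simp: polydisc_def)
    then have "u *\<^sub>R (segm w w' x i - w0 i) + v *\<^sub>R (segm w w' y i - w0 i) \<in> ball 0 \<epsilon>"
      using uv by (intro convexD[OF convex_ball]) auto
    then show ?thesis by (simp add: eq)
  qed
  moreover have "segm w w' (u *\<^sub>R x + v *\<^sub>R y) i = w0 i" if "i \<notin> S" for i
  proof -
    have "segm w w' x i - w0 i = 0" "segm w w' y i - w0 i = 0" using xy that by (auto simp: polydisc_def)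
    then show ?thesis using eq[of i "w0 i"] by simp
  qed
  ultimately show "u *\<^sub>R x + v *\<^sub>R y \<in> {z. segm w w' z \<in> polydisc S \<epsilon> w0}"
    by (simp add: polydisc_def)
qed

text \<open>Holomorphy along complex lines is all that the identity theorem on a polydisc needs.\<close>
definition line_holo :: "'v set \<Rightarrow> real \<Rightarrow> ('v \<Rightarrow> complex) \<Rightarrow> (('v \<Rightarrow> complex) \<Rightarrow> complex) \<Rightarrow> bool" where
  "line_holo S \<epsilon> w0 f \<longleftrightarrow> (\<forall>w\<in>polydisc S \<epsilon> w0. \<forall>w'\<in>polydisc S \<epsilon> w0.
     (\<lambda>z. f (segm w w' z)) holomorphic_on {z. segm w w' z \<in> polydisc S \<epsilon> w0})"

lemma line_holo_const: "line_holo S \<epsilon> w0 (\<lambda>w. c)"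
  by (simp add: line_holo_def)

lemma line_holo_coord: "line_holo S \<epsilon> w0 (\<lambda>w. w v)"
  by (auto simp: line_holo_def segm_def intro!: holomorphic_intros)

lemma line_holo_add: "line_holo S \<epsilon> w0 f \<Longrightarrow> line_holo S \<epsilon> w0 g \<Longrightarrow> line_holo S \<epsilon> w0 (\<lambda>w. f w + g w)"
  by (auto simp: line_holo_def intro!: holomorphic_on_add)

lemma line_holo_mult: "line_holo S \<epsilon> w0 f \<Longrightarrow> line_holo S \<epsilon> w0 g \<Longrightarrow> line_holo S \<epsilon> w0 (\<lambda>w. f w * g w)"
  by (auto simp: line_holo_def intro!: holomorphic_on_mult)

lemma line_holo_polyon:
  "p \<in> polyon V \<Longrightarrow> (\<And>v. v \<in> V \<Longrightarrow> line_holo S \<epsilon> w0 (f v)) \<Longrightarrow> line_holo S \<epsilon> w0 (\<lambda>w. p (\<lambda>v. f v w))"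
  by (induction rule: polyon.induct) (auto intro: line_holo_const line_holo_add line_holo_mult)

lemma line_holo_prod:
  "(\<And>i. i \<in> I \<Longrightarrow> line_holo S \<epsilon> w0 (f i)) \<Longrightarrow> line_holo S \<epsilon> w0 (\<lambda>w. \<Prod>i\<in>I. f i w)"
  by (induction I rule: infinite_finite_induct) (auto intro: line_holo_const line_holo_mult)

lemma line_holo_mono:
  assumes "line_holo S \<epsilon> w0 f" "0 < \<epsilon>'" "\<epsilon>' \<le> \<epsilon>"
  shows "line_holo S \<epsilon>' w0 f"
proof -
  have sub: "polydisc S \<epsilon>' w0 \<subseteq> polydisc S \<epsilon> w0" by (rule polydisc_mono[OF subset_refl assms(2,3)])
  show ?thesis unfolding line_holo_def
  proof (intro ballI)
    fix w w' assume "w \<in> polydisc S \<epsilon>' w0" "w' \<in> polydisc S \<epsilon>' w0"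
    with sub assms(1) have "(\<lambda>z. f (segm w w' z)) holomorphic_on {z. segm w w' z \<in> polydisc S \<epsilon> w0}"
      by (auto simp: line_holo_def)
    then show "(\<lambda>z. f (segm w w' z)) holomorphic_on {z. segm w w' z \<in> polydisc S \<epsilon>' w0}"
      by (rule holomorphic_on_subset) (use sub in auto)
  qed
qed

text \<open>On the line from \<open>w\<close> to \<open>w'\<close> the function \<open>f\<close> is
  nonzero near parameter 0. If \<open>g\<close> vanished wherever \<open>f\<close> does not, the
  identity theorem would make \<open>g\<close> vanish at parameter 1 too. Holomorphy is only assumed
  over \<open>S\<close>, but a line joining two points of the smaller polydisc never moves a
  coordinate outside \<open>S'\<close>, so the witness lies in the smaller one.\<close>

lemma line_holo_nonzero_common:
  assumes S: "finite S" "S' \<subseteq> S" and f: "line_holo S \<epsilon> w0 f" and g: "line_holo S \<epsilon> w0 g" and "0 < \<epsilon>"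
    and w: "w \<in> polydisc S' \<epsilon> w0" "f w \<noteq> 0" and w': "w' \<in> polydisc S' \<epsilon> w0" "g w' \<noteq> 0"
  shows "\<exists>u\<in>polydisc S' \<epsilon> w0. f u \<noteq> 0 \<and> g u \<noteq> 0"
proof (rule ccontr)
  assume no: "\<not> ?thesis"
  define U where "U = {z. segm w w' z \<in> polydisc S \<epsilon> w0}"
  have wS: "w \<in> polydisc S \<epsilon> w0" "w' \<in> polydisc S \<epsilon> w0"
    using w w' polydisc_mono[OF S(2) \<open>0 < \<epsilon>\<close> order_refl] by auto
  have UU: "segm w w' z \<in> polydisc S' \<epsilon> w0" if "z \<in> U" for z
  proof -
    have "segm w w' z i = w0 i" if "i \<notin> S'" for i
      using w(1) w'(1) that by (auto simp: segm_def polydisc_def)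
    then show ?thesis using \<open>z \<in> U\<close> S(2) by (auto simp: U_def polydisc_def)
  qed
  have U: "open U" "connected U" "0 \<in> U" "1 \<in> U"
    unfolding U_def using open_segm[OF S(1) wS] convex_connected[OF convex_segm] wS by auto
  have F: "(\<lambda>z. f (segm w w' z)) holomorphic_on U" and G: "(\<lambda>z. g (segm w w' z)) holomorphic_on U"
    using f g wS by (auto simp: line_holo_def U_def)
  define T where "T = U \<inter> (\<lambda>z. f (segm w w' z)) -` (- {0})"
  have "open T" unfolding T_def
    by (intro continuous_open_preimage holomorphic_on_imp_continuous_on F U(1)) auto
  moreover have "0 \<in> T" using w U by (simp add: T_def)
  then have "T \<noteq> {}" by blast
  moreover have "g (segm w w' z) = 0" if "z \<in> T" for z
    using no UU that by (auto simp: T_def)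
  moreover have "T \<subseteq> U" by (simp add: T_def)
  ultimately have "g (segm w w' 1) = 0"
    using G U(1,2,4) by (intro analytic_continuation_open[of T U "\<lambda>z. g (segm w w' z)" "\<lambda>z. 0" 1])
      (simp_all only: holomorphic_on_const not_False_eq_True)
  with w' show False by simp
qed

lemma line_holo_nonzero_finite:
  assumes "finite S" "0 < \<epsilon>" "finite I"
    and "\<And>i. i \<in> I \<Longrightarrow> line_holo S \<epsilon> w0 (f i)" "\<And>i. i \<in> I \<Longrightarrow> \<exists>w\<in>polydisc S \<epsilon> w0. f i w \<noteq> 0"
  shows "\<exists>w\<in>polydisc S \<epsilon> w0. \<forall>i\<in>I. f i w \<noteq> 0"
  using assms(3-5)
proof (induction I rule: finite_induct)
  case empty
  then show ?case using polydisc_center[OF assms(2)] by auto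
next
  case (insert i I)
  then obtain w w' where w: "w \<in> polydisc S \<epsilon> w0" "f i w \<noteq> 0"
    and w': "w' \<in> polydisc S \<epsilon> w0" "\<forall>i\<in>I. f i w' \<noteq> 0" by blast
  have "\<exists>u\<in>polydisc S \<epsilon> w0. f i u \<noteq> 0 \<and> (\<Prod>i\<in>I. f i u) \<noteq> 0"
    using insert.hyps insert.prems w w' assms(2)
    by (intro line_holo_nonzero_common[OF assms(1) subset_refl, of \<epsilon> w0 "f i" _ w w'] line_holo_prod) auto
  then show ?case using insert.hyps by auto
qed

section \<open>Holomorphic dependence of simple roots on the coefficients\<close>

text \<open>Subtracting the equations at \<open>z\<close> and \<open>z1\<close> gives
  \<open>(R z - R z1) * Q z = - (z - z1) * N z\<close>. Here \<open>Q\<close> is a divided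
  difference of powers whose limit is the derivative of the polynomial at the root, nonzero because
  the root is simple, and \<open>N\<close> collects the difference quotients of the
  coefficients.\<close>

lemma implicit_differentiable:
  fixes A :: "nat \<Rightarrow> complex \<Rightarrow> complex"
  assumes A: "\<And>k. (A k has_field_derivative A' k) (at z1)" and R: "isCont R z1"
    and zero: "\<forall>\<^sub>F z in nhds z1. (\<Sum>k\<le>e. A k z * R z ^ k) = 0"
    and simple: "(\<Sum>k<e. of_nat (Suc k) * A (Suc k) z1 * R z1 ^ k) \<noteq> 0"
  shows "R field_differentiable at z1"
proof -
  define q where "q k z = (\<Sum>i<k. R z1 ^ (k - Suc i) * R z ^ i)" for k z
  define Q where "Q z = (\<Sum>k\<le>e. A k z * q k z)" for z
  define N where "N z = (\<Sum>k\<le>e. (A k z - A k z1) / (z - z1) * R z1 ^ k)" for z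
  have lim: "(R \<longlongrightarrow> R z1) (at z1)" "(A k \<longlongrightarrow> A k z1) (at z1)" for k
    using R A[of k] DERIV_isCont by (auto simp: isCont_def)
  have "(Q \<longlongrightarrow> (\<Sum>k\<le>e. A k z1 * (\<Sum>i<k. R z1 ^ (k - Suc i) * R z1 ^ i))) (at z1)"
    unfolding Q_def q_def by (intro tendsto_intros lim)
  moreover have "(\<Sum>k\<le>e. A k z1 * (\<Sum>i<k. R z1 ^ (k - Suc i) * R z1 ^ i))
      = (\<Sum>k<e. of_nat (Suc k) * A (Suc k) z1 * R z1 ^ k)"
  proof -
    have "(\<Sum>i<k. R z1 ^ (k - Suc i) * R z1 ^ i) = of_nat k * R z1 ^ (k - 1)" for k
    proof -
      have "(\<Sum>i<k. R z1 ^ (k - Suc i) * R z1 ^ i) = (\<Sum>i<k. R z1 ^ (k - 1))"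
        by (rule sum.cong) (auto simp: power_add[symmetric])
      then show ?thesis by simp
    qed
    then show ?thesis by (simp add: sum.atMost_shift ac_simps)
  qed
  ultimately have Q: "(Q \<longlongrightarrow> (\<Sum>k<e. of_nat (Suc k) * A (Suc k) z1 * R z1 ^ k)) (at z1)" by simp
  have N: "(N \<longlongrightarrow> (\<Sum>k\<le>e. A' k * R z1 ^ k)) (at z1)"
    unfolding N_def using A by (intro tendsto_intros) (simp add: has_field_derivative_iff)
  have z1: "(\<Sum>k\<le>e. A k z1 * R z1 ^ k) = 0"
    using eventually_nhds_x_imp_x[OF zero] .
  have "\<forall>\<^sub>F z in at z1. (\<Sum>k\<le>e. A k z * R z ^ k) = 0"
    using zero by (rule filter_leD[OF at_within_le_nhds, rotated]) 
  moreover have "\<forall>\<^sub>F z in at z1. Q z \<noteq> 0"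
    using tendsto_imp_eventually_ne[OF Q simple] .
  moreover have "\<forall>\<^sub>F z in at z1. z \<noteq> z1"
    by (simp add: eventually_at_filter)
  ultimately have "\<forall>\<^sub>F z in at z1. - N z / Q z = (R z - R z1) / (z - z1)"
  proof eventually_elim
    case (elim z)
    have "(R z - R z1) * Q z = (\<Sum>k\<le>e. A k z * (R z ^ k - R z1 ^ k))"
      unfolding Q_def q_def sum_distrib_left
      by (rule sum.cong) (auto simp: power_diff_sumr2 sum_distrib_left ac_simps)
    also have "\<dots> = (\<Sum>k\<le>e. A k z * R z ^ k) - (\<Sum>k\<le>e. A k z1 * R z1 ^ k) - (\<Sum>k\<le>e. (A k z - A k z1) * R z1 ^ k)"
      by (simp add: sum_subtractf algebra_simps)
    also have "(\<Sum>k\<le>e. (A k z - A k z1) * R z1 ^ k) = (z - z1) * N z"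
      unfolding N_def sum_distrib_left by (rule sum.cong) (use elim in auto)
    finally have "(R z - R z1) * Q z = - ((z - z1) * N z)" using elim z1 by simp
    then show ?case using elim by (simp add: field_simps)
  qed
  moreover have "((\<lambda>z. - N z / Q z) \<longlongrightarrow> - (\<Sum>k\<le>e. A' k * R z1 ^ k) / (\<Sum>k<e. of_nat (Suc k) * A (Suc k) z1 * R z1 ^ k)) (at z1)"
    by (intro tendsto_intros N Q simple)
  ultimately have "((\<lambda>z. (R z - R z1) / (z - z1)) \<longlongrightarrow> - (\<Sum>k\<le>e. A' k * R z1 ^ k) / (\<Sum>k<e. of_nat (Suc k) * A (Suc k) z1 * R z1 ^ k)) (at z1)"
    using tendsto_cong by force
  then show ?thesis
    unfolding field_differentiable_def has_field_derivative_iff by blast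
qed

lemma polyon_segm_deriv: "p \<in> polyon V \<Longrightarrow> \<exists>D. ((\<lambda>z. p (segm w w' z)) has_field_derivative D) (at z)"
proof -
  assume "p \<in> polyon V"
  then obtain P where P: "\<And>z. p (segm w w' z) = poly P z"
    using polyon_line unfolding segm_def by blast
  show ?thesis unfolding P using poly_DERIV by blast
qed

lemma poly_cpoly_pderiv: "poly (pderiv (cpoly a e)) z = (\<Sum>k<e. of_nat (Suc k) * a (Suc k) * z ^ k)"
proof -
  have "pderiv (cpoly a e) = (\<Sum>k<e. monom (of_nat (Suc k) * a (Suc k)) k)"
    by (rule poly_eqI) (simp add: coeff_pderiv coeff_cpoly coeff_sum sum.delta Suc_le_eq cong: if_cong)
  then show ?thesis by (simp add: poly_sum poly_monom)
qed

lemma simple_roots_decompose: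
  assumes "a e \<noteq> 0" "\<And>\<xi>. (\<Sum>k\<le>e. a k * \<xi> ^ k) = 0 \<Longrightarrow> (\<Sum>k<e. of_nat (Suc k) * a (Suc k) * \<xi> ^ k) \<noteq> 0"
  defines "R \<equiv> {\<xi>. (\<Sum>k\<le>e. a k * \<xi> ^ k) = (0::complex)}"
  shows "finite R" "card R = e" "(\<Sum>k\<le>e. a k * z ^ k) = a e * (\<Prod>\<xi>\<in>R. z - \<xi>)"
proof -
  let ?p = "cpoly a e"
  have R: "R = {\<xi>. poly ?p \<xi> = 0}" by (simp add: R_def poly_cpoly)
  have deg: "degree ?p = e" "lead_coeff ?p = a e"
    using degree_cpoly[of a e, OF assms(1)] by (auto simp: coeff_cpoly)
  have p0: "?p \<noteq> 0" using deg(2) assms(1) by auto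
  show fin: "finite R" unfolding R using p0 by (rule poly_roots_finite)
  have "rsquarefree ?p"
    unfolding rsquarefree_roots poly_cpoly poly_cpoly_pderiv using assms(2) by blast
  from complex_poly_decompose_rsquarefree[OF this] have dec: "Polynomial.smult (a e) (\<Prod>\<xi>\<in>R. [:- \<xi>, 1:]) = ?p"
    by (simp add: R deg coeff_cpoly)
  have "degree ?p = degree (\<Prod>\<xi>\<in>R. [:- \<xi>, 1:])" using assms(1) by (subst dec[symmetric]) simp
  also have "\<dots> = card R" by (subst degree_prod_eq_sum_degree) auto
  finally show "card R = e" using deg by simp
  have "poly ?p z = a e * (\<Prod>\<xi>\<in>R. z - \<xi>)" by (subst dec[symmetric]) (simp add: poly_prod)
  then show "(\<Sum>k\<le>e. a k * z ^ k) = a e * (\<Prod>\<xi>\<in>R. z - \<xi>)" by (simp add: poly_cpoly)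
qed

text \<open>A region without degree drop and without multiple roots, so that every member of the
  family has exactly \<open>e\<close> distinct roots.\<close>

locale simple_roots =
  fixes a :: "nat \<Rightarrow> ('v \<Rightarrow> complex) \<Rightarrow> complex" and e :: nat and B S :: "'v set" and \<epsilon>0 :: real and w0
  assumes aB: "\<And>k. a k \<in> polyon B" and finS: "finite S" and \<epsilon>0: "0 < \<epsilon>0"
    and lead: "\<And>w. w \<in> polydisc S \<epsilon>0 w0 \<Longrightarrow> a e w \<noteq> 0"
    and simple: "\<And>w \<xi>. w \<in> polydisc S \<epsilon>0 w0 \<Longrightarrow> (\<Sum>k\<le>e. a k w * \<xi> ^ k) = 0 \<Longrightarrow>
      (\<Sum>k<e. of_nat (Suc k) * a (Suc k) w * \<xi> ^ k) \<noteq> 0"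
begin

definition roots where "roots w = {\<xi>. (\<Sum>k\<le>e. a k w * \<xi> ^ k) = 0}"

lemma roots:
  assumes "w \<in> polydisc S \<epsilon>0 w0"
  shows "finite (roots w)" "card (roots w) = e" "(\<Sum>k\<le>e. a k w * z ^ k) = a e w * (\<Prod>\<xi>\<in>roots w. z - \<xi>)"
  unfolding roots_def
  by (intro simple_roots_decompose[of "\<lambda>k. a k w" e] lead[OF assms] simple[OF assms]; assumption)+

text \<open>If all \<open>e\<close> roots at \<open>w\<close> were at distance at least \<eta> from
  \<xi>, the product formula would bound the value at \<xi> below by
  \<open>norm (a e w) *\<close>\<eta>\<open>^ e\<close>. But this value tends to zero as
  \<open>w\<close> tends to \<open>w1\<close>.\<close>

lemma near_root:
  assumes w1: "w1 \<in> polydisc S \<epsilon>0 w0" and \<xi>: "\<xi> \<in> roots w1" and \<eta>: "0 < \<eta>"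
  shows "\<forall>\<^sub>F w in nearby S w1. \<exists>\<xi>'\<in>roots w. norm (\<xi>' - \<xi>) < \<eta>"
proof -
  have "((\<lambda>w. norm (a e w) * \<eta> ^ e - norm (\<Sum>k\<le>e. a k w * \<xi> ^ k))
      \<longlongrightarrow> norm (a e w1) * \<eta> ^ e - norm (\<Sum>k\<le>e. a k w1 * \<xi> ^ k)) (nearby S w1)"
    by (intro tendsto_intros polyon_tendsto[OF aB])
  moreover have "norm (a e w1) * \<eta> ^ e - norm (\<Sum>k\<le>e. a k w1 * \<xi> ^ k) > 0"
    using lead[OF w1] \<eta> \<xi> by (simp add: roots_def)
  ultimately have "\<forall>\<^sub>F w in nearby S w1. norm (a e w) * \<eta> ^ e - norm (\<Sum>k\<le>e. a k w * \<xi> ^ k) > 0"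
    by (rule order_tendstoD)
  with eventually_in_polydisc[OF finS w1] show ?thesis
  proof eventually_elim
    case (elim w)
    show ?case
    proof (rule ccontr)
      assume "\<not> ?thesis"
      then have far: "\<eta> \<le> norm (\<xi> - \<xi>')" if "\<xi>' \<in> roots w" for \<xi>'
        using that by (auto simp: norm_minus_commute not_less)
      have "\<eta> ^ e = (\<Prod>\<xi>'\<in>roots w. \<eta>)" using roots(2)[OF elim(1)] by simp
      also have "\<dots> \<le> (\<Prod>\<xi>'\<in>roots w. norm (\<xi> - \<xi>'))"
        by (rule prod_mono) (use \<eta> far in auto)
      finally have "norm (a e w) * \<eta> ^ e \<le> norm (a e w) * (\<Prod>\<xi>'\<in>roots w. norm (\<xi> - \<xi>'))"
        by (rule mult_left_mono) simp
      then show False using elim(2) by (simp add: roots(3)[OF elim(1)] norm_mult prod_norm)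
    qed
  qed
qed

text \<open>The functions are indexed by the roots at the centre: each one follows the unique root
  close to its index.\<close>

lemma root_functions:
  obtains \<epsilon> R and r :: "complex \<Rightarrow> ('v \<Rightarrow> complex) \<Rightarrow> complex" where
    "0 < \<epsilon>" "\<epsilon> \<le> \<epsilon>0" "finite R" "\<And>i. i \<in> R \<Longrightarrow> line_holo S \<epsilon> w0 (r i)"
    "\<And>w \<xi>. w \<in> polydisc S \<epsilon> w0 \<Longrightarrow> (\<Sum>k\<le>e. a k w * \<xi> ^ k) = 0 \<Longrightarrow> \<exists>i\<in>R. \<xi> = r i w"
proof -
  define R where "R = roots w0"
  have w0: "w0 \<in> polydisc S \<epsilon>0 w0" by (rule polydisc_center[OF \<epsilon>0])
  have R: "finite R" "card R = e" using roots[OF w0] by (auto simp: R_def)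
  \<comment> \<open>Half the smallest distance between distinct roots at the centre, so the discs of
    radius \<rho> are disjoint. The inserted 1 keeps the minimum defined when there are fewer than
    two roots.\<close>
  obtain \<rho> where \<rho>: "\<rho> > 0" "\<And>\<xi> \<xi>'. \<xi> \<in> R \<Longrightarrow> \<xi>' \<in> R \<Longrightarrow> norm (\<xi> - \<xi>') < 2 * \<rho> \<Longrightarrow> \<xi> = \<xi>'"
  proof -
    define T where "T = (\<lambda>(\<xi>, \<xi>'). norm (\<xi> - \<xi>')) ` {(\<xi>, \<xi>') \<in> R \<times> R. \<xi> \<noteq> \<xi>'}"
    have T: "finite (insert 1 T)" unfolding T_def
      using R(1) by (auto intro!: finite_imageI intro: finite_subset[of _ "R \<times> R"])
    define \<rho> where "\<rho> = Min (insert 1 T) / 2"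
    have "\<rho> > 0" using T by (auto simp: \<rho>_def T_def)
    moreover have "\<xi> = \<xi>'" if "\<xi> \<in> R" "\<xi>' \<in> R" "norm (\<xi> - \<xi>') < 2 * \<rho>" for \<xi> \<xi>'
    proof (rule ccontr)
      assume "\<xi> \<noteq> \<xi>'"
      then have "norm (\<xi> - \<xi>') \<in> insert 1 T" using that by (auto simp: T_def)
      then have "Min (insert 1 T) \<le> norm (\<xi> - \<xi>')" using T by (intro Min_le)
      with that show False by (simp add: \<rho>_def)
    qed
    ultimately show thesis using that by blast
  qed
  have "\<forall>\<^sub>F w in nearby S w0. \<forall>\<xi>\<in>R. \<exists>\<xi>'\<in>roots w. norm (\<xi>' - \<xi>) < \<rho>"
    using near_root[OF w0 _ \<rho>(1)] by (intro eventually_ball_finite[OF R(1)]) (auto simp: R_def)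
  then obtain \<epsilon>1 where \<epsilon>1: "\<epsilon>1 > 0"
    "\<forall>w\<in>polydisc S \<epsilon>1 w0. \<forall>\<xi>\<in>R. \<exists>\<xi>'\<in>roots w. norm (\<xi>' - \<xi>) < \<rho>"
    unfolding eventually_nearby by blast
  define \<epsilon> where "\<epsilon> = min \<epsilon>0 \<epsilon>1"
  define D where "D = polydisc S \<epsilon> w0"
  have \<epsilon>: "0 < \<epsilon>" "\<epsilon> \<le> \<epsilon>0" "\<epsilon> \<le> \<epsilon>1" using \<epsilon>0 \<epsilon>1 by (auto simp: \<epsilon>_def)
  have D0: "w \<in> polydisc S \<epsilon>0 w0" and D1: "w \<in> polydisc S \<epsilon>1 w0" if "w \<in> D" for w
    using that polydisc_mono[OF subset_refl \<epsilon>(1)] \<epsilon> unfolding D_def by blast+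
  define r where "r \<xi> w = (SOME \<xi>'. \<xi>' \<in> roots w \<and> norm (\<xi>' - \<xi>) < \<rho>)" for \<xi> w
  have r: "r \<xi> w \<in> roots w" "norm (r \<xi> w - \<xi>) < \<rho>" if "w \<in> D" "\<xi> \<in> R" for w \<xi>
  proof -
    have "\<exists>\<xi>'. \<xi>' \<in> roots w \<and> norm (\<xi>' - \<xi>) < \<rho>" using \<epsilon>1(2) D1[OF that(1)] that(2) by blast
    from someI_ex[OF this] show "r \<xi> w \<in> roots w" "norm (r \<xi> w - \<xi>) < \<rho>" by (auto simp: r_def)
  qed
  have close: "\<xi> = \<xi>'" if "\<xi> \<in> R" "\<xi>' \<in> R" "norm (z - \<xi>) < \<rho>" "norm (z - \<xi>') < \<rho>" for \<xi> \<xi>' z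
  proof (rule \<rho>(2)[OF that(1,2)])
    have "norm (\<xi> - \<xi>') \<le> norm (z - \<xi>) + norm (z - \<xi>')"
      using norm_triangle_ineq4[of "z - \<xi>'" "z - \<xi>"] by simp
    with that show "norm (\<xi> - \<xi>') < 2 * \<rho>" by simp
  qed
  \<comment> \<open>Disjoint discs give distinct roots, and there are \<open>e\<close> discs as well
    as \<open>e\<close> roots, so no root is missed.\<close>
  have all: "(\<lambda>\<xi>. r \<xi> w) ` R = roots w" if w: "w \<in> D" for w
  proof (rule card_subset_eq)
    show "finite (roots w)" using roots D0[OF w] by blast
    have "inj_on (\<lambda>\<xi>. r \<xi> w) R"
      by (rule inj_onI) (metis close r(2) w)
    then show "card ((\<lambda>\<xi>. r \<xi> w) ` R) = card (roots w)"
      using roots(2)[OF D0[OF w]] R(2) by (simp add: card_image)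
  qed (use r(1) w in auto)
  have unique: "z = r \<xi> w" if h: "w \<in> D" "\<xi> \<in> R" "z \<in> roots w" "norm (z - \<xi>) < \<rho>" for z w \<xi>
  proof -
    obtain \<xi>' where "\<xi>' \<in> R" "z = r \<xi>' w" using all[OF h(1)] h(3) by blast
    with close[OF h(2), of \<xi>' z] r(2)[OF h(1)] h(4) show ?thesis by blast
  qed
  have cont: "(r \<xi> \<longlongrightarrow> r \<xi> w1) (nearby S w1)" if w1: "w1 \<in> D" and \<xi>: "\<xi> \<in> R" for \<xi> w1
  proof (rule tendstoI)
    fix \<eta> :: real assume "\<eta> > 0"
    \<comment> \<open>Small enough that a root within this distance of
      \<open>r\<close>\<xi>\<open>w1\<close> still lies in the disc around \<xi>, where it must be
      the value of the root function.\<close>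
    define \<eta>' where "\<eta>' = min \<eta> (\<rho> - norm (r \<xi> w1 - \<xi>))"
    have \<eta>': "\<eta>' > 0" using \<open>\<eta> > 0\<close> r(2)[OF w1 \<xi>] by (simp add: \<eta>'_def)
    have "\<forall>\<^sub>F w in nearby S w1. w \<in> D"
      unfolding D_def by (rule eventually_in_polydisc[OF finS w1[unfolded D_def]])
    with near_root[OF D0[OF w1] r(1)[OF w1 \<xi>] \<eta>']
    show "\<forall>\<^sub>F w in nearby S w1. dist (r \<xi> w) (r \<xi> w1) < \<eta>"
    proof eventually_elim
      case (elim w)
      then obtain z where z: "z \<in> roots w" "norm (z - r \<xi> w1) < \<eta>'" by blast
      have "norm (z - \<xi>) \<le> norm (z - r \<xi> w1) + norm (r \<xi> w1 - \<xi>)"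
        using norm_triangle_ineq[of "z - r \<xi> w1" "r \<xi> w1 - \<xi>"] by simp
      also have "\<dots> < \<rho>" using z(2) by (simp add: \<eta>'_def)
      finally have "z = r \<xi> w" by (rule unique[OF elim(2) \<xi> z(1)])
      moreover have "norm (z - r \<xi> w1) < \<eta>" using z(2) by (simp add: \<eta>'_def)
      ultimately show ?case by (simp add: dist_norm)
    qed
  qed
  have holo: "line_holo S \<epsilon> w0 (r \<xi>)" if \<xi>: "\<xi> \<in> R" for \<xi>
    unfolding line_holo_def D_def[symmetric]
  proof (intro ballI)
    fix w w' assume w: "w \<in> D" "w' \<in> D"
    have off: "w v = w' v" if "v \<notin> S" for v
      by (rule off_polydisc[OF w[unfolded D_def] that])
    have op: "open {z. segm w w' z \<in> D}"
      unfolding D_def by (rule open_segm[OF finS w[unfolded D_def]])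
    show "(\<lambda>z. r \<xi> (segm w w' z)) holomorphic_on {z. segm w w' z \<in> D}"
      unfolding holomorphic_on_open[OF op] field_differentiable_def[symmetric]
    proof
      fix z1 assume "z1 \<in> {z. segm w w' z \<in> D}"
      then have z1: "segm w w' z1 \<in> D" by simp
      have "\<forall>k. \<exists>D. ((\<lambda>z. a k (segm w w' z)) has_field_derivative D) (at z1)"
        using polyon_segm_deriv[OF aB] by blast
      then obtain A' where A': "\<And>k. ((\<lambda>z. a k (segm w w' z)) has_field_derivative A' k) (at z1)" by metis
      have ev: "\<forall>\<^sub>F z in nhds z1. Q (segm w w' z)" if "eventually Q (nearby S (segm w w' z1))" for Q
        using eventually_segm[OF finS off that] .
      have "\<forall>\<^sub>F z in nhds z1. segm w w' z \<in> D"
        using ev[OF eventually_in_polydisc[OF finS z1[unfolded D_def]]] unfolding D_def .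
      then have zero: "\<forall>\<^sub>F z in nhds z1. (\<Sum>k\<le>e. a k (segm w w' z) * r \<xi> (segm w w' z) ^ k) = 0"
        by eventually_elim (use r(1)[OF _ \<xi>] in \<open>auto simp: roots_def\<close>)
      have "((\<lambda>z. r \<xi> (segm w w' z)) \<longlongrightarrow> r \<xi> (segm w w' z1)) (nhds z1)"
        unfolding tendsto_def
      proof (intro allI impI)
        fix T assume "open T" "r \<xi> (segm w w' z1) \<in> T"
        then have "\<forall>\<^sub>F u in nearby S (segm w w' z1). r \<xi> u \<in> T"
          using cont[OF z1 \<xi>] by (auto simp: tendsto_def)
        from ev[OF this] show "\<forall>\<^sub>F z in nhds z1. r \<xi> (segm w w' z) \<in> T" .
      qed
      then have "isCont (\<lambda>z. r \<xi> (segm w w' z)) z1"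
        unfolding isCont_def by (rule tendsto_mono[OF at_within_le_nhds])
      then show "(\<lambda>z. r \<xi> (segm w w' z)) field_differentiable at z1"
        by (rule implicit_differentiable[of "\<lambda>k z. a k (segm w w' z)", OF A' _ zero])
          (use simple[OF D0[OF z1]] r(1)[OF z1 \<xi>] in \<open>auto simp: roots_def\<close>)
    qed
  qed
  show thesis
  proof (rule that[OF \<epsilon>(1,2) R(1) holo])
    fix w \<xi> assume "w \<in> polydisc S \<epsilon> w0" "(\<Sum>k\<le>e. a k w * \<xi> ^ k) = 0"
    then have "\<xi> \<in> (\<lambda>\<xi>. r \<xi> w) ` R" using all[of w] by (simp add: D_def roots_def)
    then show "\<exists>i\<in>R. \<xi> = r i w" by blast
  qed
qed

end

section \<open>Graphs of polynomial maps\<close>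

lemma polyon_mult_nonzero:
  assumes "p \<in> polyon V" "q \<in> polyon V" "\<exists>x. p x \<noteq> 0" "\<exists>x. q x \<noteq> 0"
  shows "\<exists>x. p x * q x \<noteq> 0"
proof -
  obtain x where x: "p x \<noteq> 0" using assms(3) ..
  obtain y where y: "q y \<noteq> 0" using assms(4) ..
  from polyon_nonzero_common[of p V q x y, OF assms(1,2) x y] obtain z where
    "p (\<lambda>v. x v + z * (y v - x v)) \<noteq> 0 \<and> q (\<lambda>v. x v + z * (y v - x v)) \<noteq> 0" ..
  then show ?thesis by (intro exI[of _ "\<lambda>v. x v + z * (y v - x v)"]) simp
qed

text \<open>\<open>P\<close> holds the free parameters and \<open>g\<close> expresses the other
  coordinates in \<open>V\<close> through them. Coordinates outside \<open>V\<close> stay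
  unconstrained, so the graph \<open>X\<close> is a cylinder in the full function space.\<close>

locale graph =
  fixes V P :: "'v set" and g :: "'v \<Rightarrow> ('v \<Rightarrow> complex) \<Rightarrow> complex"
  assumes finV: "finite V" and PV: "P \<subseteq> V" and gP: "\<And>u. u \<in> V - P \<Longrightarrow> g u \<in> polyon P"
begin

definition X :: "('v \<Rightarrow> complex) set" where
  "X = {x. \<forall>u\<in>V - P. x u = g u x}"

definition lift :: "('v \<Rightarrow> complex) \<Rightarrow> 'v \<Rightarrow> complex" where
  "lift x = (\<lambda>v. if v \<in> V - P then g v x else x v)"

lemma g_cong: "u \<in> V - P \<Longrightarrow> (\<And>v. v \<in> P \<Longrightarrow> x v = y v) \<Longrightarrow> g u x = g u y"
  by (rule polyon_cong[OF gP])

lemma X_cong: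
  assumes "\<And>v. v \<in> V \<Longrightarrow> x v = y v"
  shows "x \<in> X \<longleftrightarrow> y \<in> X"
proof -
  have "g u x = g u y" if "u \<in> V - P" for u
    by (rule g_cong[OF that]) (use assms PV in auto)
  then show ?thesis using assms by (simp add: X_def)
qed

lemma lift_X: "lift x \<in> X"
proof -
  have "g u (lift x) = g u x" if "u \<in> V - P" for u
    by (rule g_cong[OF that]) (simp add: lift_def)
  then show ?thesis by (simp add: X_def lift_def)
qed

lemma lift_id: "x \<in> X \<Longrightarrow> lift x = x"
  by (auto simp: X_def lift_def)

lemma X_nonempty: "X \<noteq> {}"
  using lift_X by blast

lemma lift_polyon: "p \<in> polyon V \<Longrightarrow> (\<lambda>x. p (lift x)) \<in> polyon P"
  unfolding lift_def by (rule polyon_subst) (auto intro!: polyon_if gP polyon.coord)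

text \<open>Composition with \<open>lift\<close> turns functions on the graph into polynomials on
  the affine space of parameters, which is irreducible.\<close>

lemma irred: "irred_on V X"
  unfolding irred_on_def
proof (intro ballI impI)
  fix p q assume p: "p \<in> polyon V" and q: "q \<in> polyon V" and pq: "\<forall>x\<in>X. p x * q x = 0"
  show "(\<forall>x\<in>X. p x = 0) \<or> (\<forall>x\<in>X. q x = 0)"
  proof (rule ccontr)
    assume "\<not> ?thesis"
    then obtain x y where "x \<in> X" "p x \<noteq> 0" "y \<in> X" "q y \<noteq> 0" by blast
    then have "p (lift x) \<noteq> 0" "q (lift y) \<noteq> 0" by (simp_all add: lift_id)
    then have "\<exists>x. p (lift x) * q (lift x) \<noteq> 0"
      by (intro polyon_mult_nonzero[OF lift_polyon[OF p] lift_polyon[OF q]]) blast+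
    then obtain u where "p (lift u) * q (lift u) \<noteq> 0" ..
    then show False using pq lift_X[of u] by simp
  qed
qed

lemma indep_params: "indep_on X P"
  unfolding indep_on_def
proof (intro ballI impI allI)
  fix p x assume p: "p \<in> polyon P" "\<forall>x\<in>X. p x = 0"
  have "p x = p (lift x)" by (rule polyon_cong[OF p(1)]) (simp add: lift_def)
  with p(2) lift_X show "p x = 0" by simp
qed

lemma algebraic_params:
  assumes "v \<in> V"
  shows "algebraic_on X P v"
proof (cases "v \<in> P")
  case True
  then show ?thesis by (intro algebraic_of_graph[OF X_nonempty polyon.coord]) auto
next
  case False
  with assms show ?thesis by (intro algebraic_of_graph[OF X_nonempty gP]) (auto simp: X_def)
qed

text \<open>The equations of the graph are themselves polynomials vanishing on \<open>X\<close>.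
  Hence a lifted specialization is a true point of the graph.\<close>

lemma zcl_X: "zcl X V \<subseteq> X"
proof
  fix w assume w: "w \<in> zcl X V"
  have "w u = g u w" if "u \<in> V - P" for u
  proof -
    have "(\<lambda>x. x u - g u x) \<in> polyon V"
      using that PV by (intro polyon_intros polyon_mono[OF gP[OF that]]) auto
    then have "w u - g u w = 0" using w that by (auto simp: zcl_def X_def)
    then show ?thesis by simp
  qed
  then show "w \<in> X" by (simp add: X_def)
qed

text \<open>Too many coordinates \<open>H\<close> and \<open>T\<close> together satisfy a nonzero
  relation on the graph. Fixing the \<open>T\<close> part at a point \<open>x0\<close> where the
  relation is nonzero gives a polynomial \<open>q\<close> in the \<open>H\<close> coordinates;
  wherever \<open>q\<close> is nonzero, the relation remains nontrivial after specialization to the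
  fibre. The finitely many \<open>T\<close> are handled by a product.\<close>

lemma generic_fibre_dependent:
  assumes H: "H \<subseteq> V"
  shows "\<exists>q\<in>polyon H. (\<exists>x. q x \<noteq> 0) \<and> (\<forall>h. q h \<noteq> 0 \<longrightarrow>
    (\<forall>T. T \<subseteq> V - H \<longrightarrow> card P < card H + card T \<longrightarrow> \<not> indep_on {x \<in> X. \<forall>v\<in>H. x v = h v} T))"
proof -
  define \<T> where "\<T> = {T. T \<subseteq> V - H \<and> card P < card H + card T}"
  have fin: "finite \<T>" unfolding \<T>_def using finV by auto
  have "\<exists>q\<in>polyon H. (\<exists>x. q x \<noteq> 0) \<and> (\<forall>h. q h \<noteq> 0 \<longrightarrow> \<not> indep_on {x \<in> X. \<forall>v\<in>H. x v = h v} T)"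
    if "T \<in> \<T>" for T
  proof -
    have T: "T \<subseteq> V - H" "card P < card H + card T" using that by (auto simp: \<T>_def)
    have "card (H \<union> T) = card H + card T"
      using T(1) H finV by (intro card_Un_disjoint) (auto intro: finite_subset)
    then have "\<not> card (H \<union> T) \<le> card P" using T(2) by simp
    moreover have "H \<union> T \<subseteq> V" using H T(1) by auto
    ultimately have "\<not> indep_on X (H \<union> T)"
      using card_indep_le[OF irred finV PV algebraic_params] by blast
    then obtain p x0 where p: "p \<in> polyon (H \<union> T)" "\<forall>x\<in>X. p x = 0" "p x0 \<noteq> 0"
      by (auto simp: indep_on_def)
    define q where "q h = p (\<lambda>v. if v \<in> H then h v else x0 v)" for h
    have "(\<lambda>h. q h) \<in> polyon H"
      unfolding q_def by (rule polyon_subst[OF p(1)]) (auto intro!: polyon_if polyon.const polyon.coord)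
    then have q: "q \<in> polyon H" by simp
    have "\<not> indep_on {x \<in> X. \<forall>v\<in>H. x v = h v} T" if h: "q h \<noteq> 0" for h
    proof
      assume ind: "indep_on {x \<in> X. \<forall>v\<in>H. x v = h v} T"
      define p' where "p' x = p (\<lambda>v. if v \<in> H then h v else x v)" for x
      have "(\<lambda>x. p' x) \<in> polyon T"
        unfolding p'_def by (rule polyon_subst[OF p(1)]) (auto intro!: polyon_if polyon.const polyon.coord)
      then have "p' \<in> polyon T" by simp
      moreover have "p' x0 \<noteq> 0" using h by (simp add: p'_def q_def)
      moreover have "p' x = 0" if x: "x \<in> X" "\<forall>v\<in>H. x v = h v" for x
      proof -
        have "(\<lambda>v. if v \<in> H then h v else x v) = x" using x(2) by auto
        with p(2) x(1) show ?thesis by (simp add: p'_def)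
      qed
      ultimately show False using ind unfolding indep_on_def by blast
    qed
    moreover have "q x0 \<noteq> 0" using p(3) by (simp add: q_def)
    ultimately show ?thesis using q by blast
  qed
  from bchoice[OF ballI[OF this[unfolded Bex_def]]] obtain q where
    q: "\<forall>T\<in>\<T>. q T \<in> polyon H \<and> (\<exists>x. q T x \<noteq> 0) \<and> (\<forall>h. q T h \<noteq> 0 \<longrightarrow> \<not> indep_on {x \<in> X. \<forall>v\<in>H. x v = h v} T)" ..
  show ?thesis
  proof (rule bexI[of _ "\<lambda>x. \<Prod>T\<in>\<T>. q T x"], intro conjI allI impI)
    show "(\<lambda>x. \<Prod>T\<in>\<T>. q T x) \<in> polyon H" using q by (intro polyon_prod) blast
    show "\<exists>x. (\<Prod>T\<in>\<T>. q T x) \<noteq> 0" using q by (intro polyon_prod_nonzero[OF fin]) blast+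
    fix h T assume h: "(\<Prod>T\<in>\<T>. q T h) \<noteq> 0" and T: "T \<subseteq> V - H" "card P < card H + card T"
    then have "T \<in> \<T>" by (simp add: \<T>_def)
    moreover from this h fin have "q T h \<noteq> 0" by auto
    ultimately show "\<not> indep_on {x \<in> X. \<forall>v\<in>H. x v = h v} T" using q by blast
  qed
qed

text \<open>\<open>H\<close> is completed to a transcendence basis \<open>B\<close>; the added
  coordinates \<open>S\<close> are free directions inside the fibre. All other coordinates are roots
  of polynomials over \<open>B\<close>, hence locally finitely many holomorphic functions of the
  point.\<close>

lemma generic_branch:
  assumes H: "H \<subseteq> V" "indep_on X H"
  shows "\<exists>q\<in>polyon H. (\<exists>x. q x \<noteq> 0) \<and> (\<forall>h. q h \<noteq> 0 \<longrightarrow>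
    (\<exists>S \<epsilon> w0 \<phi>. S \<subseteq> V - H \<and> card H + card S = card P \<and> 0 < \<epsilon> \<and> (\<forall>v\<in>H. w0 v = h v) \<and>
      (\<forall>w\<in>polydisc S \<epsilon> w0. \<phi> w \<in> X \<and> (\<forall>v\<in>H \<union> S. \<phi> w v = w v)) \<and>
      (\<forall>v\<in>V. line_holo S \<epsilon> w0 (\<lambda>w. \<phi> w v))))"
proof -
  obtain B where B: "H \<subseteq> B" "B \<subseteq> V" "indep_on X B" and algB: "\<And>v. v \<in> V \<Longrightarrow> algebraic_on X B v"
    using exists_basis[OF finV X_nonempty H] by blast
  \<comment> \<open>\<open>B\<close> and \<open>P\<close> are both transcendence bases of the
    graph.\<close>
  have cardB: "card B = card P"
    using card_indep_le[OF irred finV B(2) algB PV indep_params]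
      card_indep_le[OF irred finV PV algebraic_params B(2,3)] by simp
  define S where "S = B - H"
  have finB: "finite B" and finS: "finite S" and finVB: "finite (V - B)"
    using B(2) finV by (auto simp: S_def intro: finite_subset)
  have cardS: "card H + card S = card P"
    unfolding S_def using B(1) finB cardB by (metis card_Diff_subset card_mono finite_subset le_add_diff_inverse)
  obtain \<alpha> where \<alpha>: "\<alpha> \<in> polyon B" "\<exists>x. \<alpha> x \<noteq> 0"
    "\<And>w. \<alpha> w \<noteq> 0 \<Longrightarrow> \<exists>w'\<in>zcl X V. \<forall>b\<in>B. w' b = w b"
    by (rule lift_points[OF irred finV B(2) algB B(3)]) (assumption, rule that, assumption+)
  \<comment> \<open>For one remaining coordinate: its relation over \<open>B\<close>, and a
    polynomial \<open>c\<close> whose nonvanishing forces all roots to be simple. Such a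
    \<open>c\<close> arises below as the norm of the derivative of the minimal relation.\<close>
  define Q where "Q v e a c \<longleftrightarrow> (\<forall>k. a k \<in> polyon B) \<and> c \<in> polyon B \<and> (\<exists>x. a e x \<noteq> 0) \<and> (\<exists>x. c x \<noteq> 0) \<and>
      (\<forall>x\<in>X. (\<Sum>k\<le>e. a k x * x v ^ k) = 0) \<and>
      (\<forall>w \<xi>. a e w \<noteq> 0 \<longrightarrow> c w \<noteq> 0 \<longrightarrow> (\<Sum>k\<le>e. a k w * \<xi> ^ k) = 0 \<longrightarrow>
        (\<Sum>k<e. of_nat (Suc k) * a (Suc k) w * \<xi> ^ k) \<noteq> 0)"
    for v and e :: nat and a :: "nat \<Rightarrow> ('v \<Rightarrow> complex) \<Rightarrow> complex" and c :: "('v \<Rightarrow> complex) \<Rightarrow> complex"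
  have "\<exists>e a c. Q v e a c" if v: "v \<in> V - B" for v
  proof -
    have vB: "v \<notin> B" "algebraic_on X B v" using v algB by auto
    obtain e a where ea: "\<And>k. a k \<in> polyon B" "0 < e" "\<exists>x\<in>X. a e x \<noteq> 0"
      "\<And>x. x \<in> X \<Longrightarrow> (\<Sum>k\<le>e. a k x * x v ^ k) = 0"
      "\<And>w \<xi>. w \<in> zcl X B \<Longrightarrow> a e w \<noteq> 0 \<Longrightarrow> (\<Sum>k\<le>e. a k w * \<xi> ^ k) = 0 \<Longrightarrow> w(v := \<xi>) \<in> zcl X (insert v B)"
      "\<exists>x\<in>X. (\<Sum>k<e. of_nat (Suc k) * a (Suc k) x * x v ^ k) \<noteq> 0"
      by (rule minimal_relation[OF vB]) (rule that, assumption+)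
    define \<beta> where "\<beta> = (\<lambda>x. \<Sum>k<e. of_nat (Suc k) * a (Suc k) x * x v ^ k)"
    have \<beta>: "\<beta> \<in> polyon (insert v B)"
      unfolding \<beta>_def by (intro polyon_intros polyon_mono[OF ea(1)]) auto
    then have \<beta>V: "\<beta> \<in> polyon V" by (rule polyon_mono) (use v B(2) in auto)
    have \<beta>0: "\<exists>x\<in>X. \<beta> x \<noteq> 0" using ea(6) by (simp add: \<beta>_def)
    obtain c where c: "c \<in> polyon B" "\<exists>x. c x \<noteq> 0"
      "\<And>V' w. B \<subseteq> V' \<Longrightarrow> \<beta> \<in> polyon V' \<Longrightarrow> w \<in> zcl X V' \<Longrightarrow> c w \<noteq> 0 \<Longrightarrow> \<beta> w \<noteq> 0"
      by (rule nonvanishing_norm[OF irred finV B(2) algB B(3) \<beta>V \<beta>0]) (assumption, rule that, assumption+)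
    have "(\<Sum>k<e. of_nat (Suc k) * a (Suc k) w * \<xi> ^ k) \<noteq> 0"
      if w: "a e w \<noteq> 0" "c w \<noteq> 0" "(\<Sum>k\<le>e. a k w * \<xi> ^ k) = 0" for w \<xi>
    proof -
      have eqB: "p (w(v := \<xi>)) = p w" if "p \<in> polyon B" for p
        by (rule polyon_cong[OF that]) (use v in auto)
      have "w(v := \<xi>) \<in> zcl X (insert v B)"
        using indep_on_zcl[OF B(3)] by (intro ea(5) w) auto
      then have "\<beta> (w(v := \<xi>)) \<noteq> 0"
        using w(2) by (intro c(3)[OF _ \<beta>]) (auto simp: eqB[OF c(1)])
      then show ?thesis by (simp add: \<beta>_def eqB[OF ea(1)])
    qed
    with ea(1,3,4) c(1,2) show ?thesis unfolding Q_def by blast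
  qed
  then have "\<forall>v\<in>V-B. \<exists>e a c. Q v e a c" by blast
  from bchoice[OF this] obtain e where "\<forall>v\<in>V-B. \<exists>a c. Q v (e v) a c" ..
  from bchoice[OF this] obtain a where "\<forall>v\<in>V-B. \<exists>c. Q v (e v) (a v) c" ..
  from bchoice[OF this] obtain c where Q: "\<forall>v\<in>V-B. Q v (e v) (a v) (c v)" ..
  have a: "a v k \<in> polyon B" and c: "c v \<in> polyon B" and a0: "\<exists>x. a v (e v) x \<noteq> 0" and c0: "\<exists>x. c v x \<noteq> 0"
    and rel: "\<And>x. x \<in> X \<Longrightarrow> (\<Sum>k\<le>e v. a v k x * x v ^ k) = 0"
    and simple: "\<And>w \<xi>. a v (e v) w \<noteq> 0 \<Longrightarrow> c v w \<noteq> 0 \<Longrightarrow> (\<Sum>k\<le>e v. a v k w * \<xi> ^ k) = 0 \<Longrightarrow>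
        (\<Sum>k<e v. of_nat (Suc k) * a v (Suc k) w * \<xi> ^ k) \<noteq> 0" if "v \<in> V - B" for v k
    using Q[rule_format, OF that] unfolding Q_def by blast+
  \<comment> \<open>Collects the conditions on a point: it lifts to the graph, no relation drops in
    degree, all roots are simple.\<close>
  define \<delta> where "\<delta> x = \<alpha> x * (\<Prod>v\<in>V-B. a v (e v) x * c v x)" for x
  have "(\<lambda>x. \<delta> x) \<in> polyon B" unfolding \<delta>_def by (intro polyon_intros \<alpha> a c)
  then have \<delta>: "\<delta> \<in> polyon B" by simp
  have "\<exists>x. (\<Prod>v\<in>V-B. a v (e v) x * c v x) \<noteq> 0"
  proof (rule polyon_prod_nonzero[OF finVB])
    fix v assume v: "v \<in> V - B"
    show "(\<lambda>x. a v (e v) x * c v x) \<in> polyon B" by (intro polyon_intros a c v)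
    show "\<exists>x. a v (e v) x * c v x \<noteq> 0"
      by (rule polyon_mult_nonzero[OF a[OF v] c[OF v] a0[OF v] c0[OF v]])
  qed
  moreover have "(\<lambda>x. \<Prod>v\<in>V-B. a v (e v) x * c v x) \<in> polyon B" by (intro polyon_intros a c)
  ultimately have "\<exists>x. \<delta> x \<noteq> 0" unfolding \<delta>_def by (intro polyon_mult_nonzero[OF \<alpha>(1) _ \<alpha>(2)])
  then obtain x0 where x0: "\<delta> x0 \<noteq> 0" ..
  \<comment> \<open>Freezing the coordinates outside \<open>H\<close> at a point with \<delta>
    nonzero turns the condition into one on the \<open>H\<close> coordinates alone.\<close>
  define pt where "pt h = (\<lambda>v. if v \<in> H then h v else x0 v)" for h
  have q: "(\<lambda>h. \<delta> (pt h)) \<in> polyon H"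
    unfolding pt_def by (rule polyon_subst[OF \<delta>]) (auto intro!: polyon_if polyon.const polyon.coord)
  have "\<exists>S \<epsilon> w0 \<phi>. S \<subseteq> V - H \<and> card H + card S = card P \<and> 0 < \<epsilon> \<and> (\<forall>v\<in>H. w0 v = h v) \<and>
      (\<forall>w\<in>polydisc S \<epsilon> w0. \<phi> w \<in> X \<and> (\<forall>v\<in>H \<union> S. \<phi> w v = w v)) \<and>
      (\<forall>v\<in>V. line_holo S \<epsilon> w0 (\<lambda>w. \<phi> w v))" if h: "\<delta> (pt h) \<noteq> 0" for h
  proof -
    define w0 where "w0 = pt h"
    have "\<forall>\<^sub>F w in nearby S w0. \<delta> w \<noteq> 0"
      using tendsto_imp_eventually_ne[OF polyon_tendsto[OF \<delta>]] h by (simp add: w0_def)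
    then obtain \<epsilon>0 where \<epsilon>0: "0 < \<epsilon>0" "\<forall>w\<in>polydisc S \<epsilon>0 w0. \<delta> w \<noteq> 0"
      unfolding eventually_nearby by blast
    have nz: "\<alpha> w \<noteq> 0" "\<And>v. v \<in> V - B \<Longrightarrow> a v (e v) w \<noteq> 0" "\<And>v. v \<in> V - B \<Longrightarrow> c v w \<noteq> 0"
      if "w \<in> polydisc S \<epsilon>0 w0" for w
      using \<epsilon>0(2)[rule_format, OF that] finVB by (auto simp: \<delta>_def)
    define root_data where "root_data v \<epsilon> R r \<longleftrightarrow> 0 < \<epsilon> \<and> \<epsilon> \<le> \<epsilon>0 \<and> finite R \<and>
        (\<forall>i\<in>R. line_holo S \<epsilon> w0 (r i)) \<and>
        (\<forall>w\<in>polydisc S \<epsilon> w0. \<forall>\<xi>. (\<Sum>k\<le>e v. a v k w * \<xi> ^ k) = 0 \<longrightarrow> (\<exists>i\<in>R. \<xi> = r i w))"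
      for v \<epsilon> and R :: "complex set" and r
    have "\<exists>\<epsilon> R r. root_data v \<epsilon> R r" if v: "v \<in> V - B" for v
    proof -
      interpret simple_roots "a v" "e v" B S \<epsilon>0 w0
        by unfold_locales (use a[OF v] finS \<epsilon>0(1) nz(2,3)[OF _ v] simple[OF v] in blast)+
      obtain \<epsilon> R and r :: "complex \<Rightarrow> ('v \<Rightarrow> complex) \<Rightarrow> complex" where
        "0 < \<epsilon>" "\<epsilon> \<le> \<epsilon>0" "finite R" "\<And>i. i \<in> R \<Longrightarrow> line_holo S \<epsilon> w0 (r i)"
        "\<And>w \<xi>. w \<in> polydisc S \<epsilon> w0 \<Longrightarrow> (\<Sum>k\<le>e v. a v k w * \<xi> ^ k) = 0 \<Longrightarrow> \<exists>i\<in>R. \<xi> = r i w"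
        by (rule root_functions) (rule that, assumption+)
      then show ?thesis unfolding root_data_def by blast
    qed
    then have "\<forall>v\<in>V-B. \<exists>\<epsilon> R r. root_data v \<epsilon> R r" by blast
    from bchoice[OF this] obtain \<epsilon>' where "\<forall>v\<in>V-B. \<exists>R r. root_data v (\<epsilon>' v) R r" ..
    from bchoice[OF this] obtain R where "\<forall>v\<in>V-B. \<exists>r. root_data v (\<epsilon>' v) (R v) r" ..
    from bchoice[OF this] obtain r where u: "\<forall>v\<in>V-B. root_data v (\<epsilon>' v) (R v) (r v)" ..
    define \<epsilon> where "\<epsilon> = Min (insert \<epsilon>0 (\<epsilon>' ` (V - B)))"
    have u1: "\<forall>v\<in>V-B. 0 < \<epsilon>' v" using u by (simp add: root_data_def)
    have \<epsilon>: "0 < \<epsilon>" "\<epsilon> \<le> \<epsilon>0" "\<And>v. v \<in> V - B \<Longrightarrow> \<epsilon> \<le> \<epsilon>' v"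
    proof -
      show "0 < \<epsilon>" unfolding \<epsilon>_def using u1 \<epsilon>0(1) finVB by (subst Min_gr_iff) auto
      show "\<epsilon> \<le> \<epsilon>0" unfolding \<epsilon>_def using finVB by (intro Min_le) auto
      show "\<epsilon> \<le> \<epsilon>' v" if "v \<in> V - B" for v
        unfolding \<epsilon>_def using finVB that by (intro Min_le) auto
    qed
    define D where "D = polydisc S \<epsilon> w0"
    have Dsub: "D \<subseteq> polydisc S \<epsilon>0 w0"
      unfolding D_def by (rule polydisc_mono[OF subset_refl \<epsilon>(1,2)])
    have Dsub2: "D \<subseteq> polydisc S (\<epsilon>' v) w0" if v: "v \<in> V - B" for v
      unfolding D_def by (rule polydisc_mono[OF subset_refl \<epsilon>(1) \<epsilon>(3)[OF v]])
    have finR: "finite (R v)" and holo: "\<And>i. i \<in> R v \<Longrightarrow> line_holo S \<epsilon> w0 (r v i)"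
      and allr: "\<And>w \<xi>. w \<in> D \<Longrightarrow> (\<Sum>k\<le>e v. a v k w * \<xi> ^ k) = 0 \<Longrightarrow> \<exists>i\<in>R v. \<xi> = r v i w" if v: "v \<in> V - B" for v
    proof -
      show "finite (R v)" using u v by (simp add: root_data_def)
      show "line_holo S \<epsilon> w0 (r v i)" if "i \<in> R v" for i
        by (rule line_holo_mono[OF _ \<epsilon>(1) \<epsilon>(3)[OF v]]) (use u v that in \<open>simp add: root_data_def\<close>)
      show "\<exists>i\<in>R v. \<xi> = r v i w" if "w \<in> D" "(\<Sum>k\<le>e v. a v k w * \<xi> ^ k) = 0" for w \<xi>
        using u[unfolded root_data_def] v subsetD[OF Dsub2[OF v] that(1)] that(2) by blast
    qed
    \<comment> \<open>A branch is a choice of one root function for every coordinate outside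
      \<open>B\<close>.\<close>
    define C where "C = PiE (V - B) R"
    have finC: "finite C" unfolding C_def using finVB finR by (rule finite_PiE)
    define \<phi> where "\<phi> f w = (\<lambda>v. if v \<in> V - B then r v (f v) w else w v)" for f w
    have holo\<phi>: "line_holo S \<epsilon> w0 (\<lambda>w. \<phi> f w v)" if "f \<in> C" for f v
      using that by (cases "v \<in> V - B") (auto simp: \<phi>_def C_def intro!: holo line_holo_coord)
    \<comment> \<open>Some point of the graph lies over each \<open>w\<close>, and its coordinates
      are values of root functions. At this stage the choice of branch may still depend on
      \<open>w\<close>.\<close>
    have cover: "\<exists>f\<in>C. \<phi> f w \<in> X" if w: "w \<in> D" for w
    proof -
      obtain w' where w': "w' \<in> X" "\<forall>b\<in>B. w' b = w b"
        using \<alpha>(3)[OF nz(1)] w Dsub zcl_X by blast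
      have "\<exists>i\<in>R v. w' v = r v i w" if v: "v \<in> V - B" for v
      proof (rule allr[OF v w])
        have "a v k w' = a v k w" for k
          by (rule polyon_cong[OF a[OF v]]) (use w'(2) in auto)
        with rel[OF v w'(1)] show "(\<Sum>k\<le>e v. a v k w * w' v ^ k) = 0" by simp
      qed
      then have "\<forall>v\<in>V-B. \<exists>i. i \<in> R v \<and> w' v = r v i w" by blast
      from bchoice[OF this] obtain f where f: "\<forall>v\<in>V-B. f v \<in> R v \<and> w' v = r v (f v) w" ..
      have "restrict f (V - B) \<in> C" using f by (auto simp: C_def)
      moreover have "\<phi> (restrict f (V - B)) w \<in> X \<longleftrightarrow> w' \<in> X"
        by (rule X_cong) (use f w'(2) in \<open>auto simp: \<phi>_def\<close>)
      ultimately show ?thesis using w'(1) by blast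
    qed
    \<comment> \<open>If every branch left the graph somewhere, each would violate one equation at
      some point of the polydisc. By the identity theorem these violations would all be nonzero at a
      common \<open>w\<close>, contradicting \<open>cover\<close>.\<close>
    have "\<exists>f\<in>C. \<forall>w\<in>D. \<phi> f w \<in> X"
    proof (rule ccontr)
      assume "\<not> ?thesis"
      then have "\<forall>f\<in>C. \<exists>u. u \<in> V - P \<and> (\<exists>w\<in>D. \<phi> f w u - g u (\<phi> f w) \<noteq> 0)"
        unfolding X_def by fastforce
      from bchoice[OF this] obtain u where u: "\<forall>f\<in>C. u f \<in> V - P \<and> (\<exists>w\<in>D. \<phi> f w (u f) - g (u f) (\<phi> f w) \<noteq> 0)" ..
      define F where "F f w = \<phi> f w (u f) - g (u f) (\<phi> f w)" for f w
      have "line_holo S \<epsilon> w0 (F f)" if f: "f \<in> C" for f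
      proof -
        have "(\<lambda>x. x (u f) - g (u f) x) \<in> polyon V"
          using u f PV by (intro polyon_intros polyon_mono[OF gP]) auto
        from line_holo_polyon[OF this, of S \<epsilon> w0 "\<lambda>v w. \<phi> f w v", OF holo\<phi>[OF f]]
        have "line_holo S \<epsilon> w0 (\<lambda>w. F f w)" unfolding F_def .
        then show ?thesis by simp
      qed
      moreover have "\<exists>w\<in>polydisc S \<epsilon> w0. F f w \<noteq> 0" if "f \<in> C" for f
        using u that unfolding F_def D_def by blast
      ultimately have "\<exists>w\<in>polydisc S \<epsilon> w0. \<forall>f\<in>C. F f w \<noteq> 0"
        by (intro line_holo_nonzero_finite[OF finS \<epsilon>(1) finC, of w0 F])
      then obtain w where w: "w \<in> D" "\<forall>f\<in>C. F f w \<noteq> 0" by (auto simp: D_def)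
      from cover[OF w(1)] obtain f where "f \<in> C" "\<phi> f w \<in> X" by blast
      with w(2) u show False by (auto simp: X_def F_def)
    qed
    then obtain f where f: "f \<in> C" "\<forall>w\<in>D. \<phi> f w \<in> X" by blast
    show ?thesis
    proof (intro exI conjI)
      show "S \<subseteq> V - H" using B(2) by (auto simp: S_def)
      show "\<forall>v\<in>H. w0 v = h v" by (simp add: w0_def pt_def)
      show "\<forall>w\<in>polydisc S \<epsilon> w0. \<phi> f w \<in> X \<and> (\<forall>v\<in>H \<union> S. \<phi> f w v = w v)"
        using f(2) B(1) by (auto simp: D_def \<phi>_def S_def)
      show "\<forall>v\<in>V. line_holo S \<epsilon> w0 (\<lambda>w. \<phi> f w v)" using holo\<phi>[OF f(1)] by blast
    qed (fact cardS \<epsilon>(1))+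
  qed
  moreover have "\<delta> (pt x0) \<noteq> 0" using x0 by (simp add: pt_def)
  ultimately show ?thesis using q by (intro bexI[of _ "\<lambda>h. \<delta> (pt h)"]) blast+
qed

end

section \<open>Square minors and column spaces\<close>

definition sqmat :: "nat \<Rightarrow> (nat \<Rightarrow> nat \<Rightarrow> complex) \<Rightarrow> complex mat" where
  "sqmat d B = mat d d (\<lambda>(i, j). B i j)"

definition sqdet :: "nat \<Rightarrow> (nat \<Rightarrow> nat \<Rightarrow> complex) \<Rightarrow> complex" where
  "sqdet d B = det (sqmat d B)"

definition sqadj :: "nat \<Rightarrow> (nat \<Rightarrow> nat \<Rightarrow> complex) \<Rightarrow> nat \<Rightarrow> nat \<Rightarrow> complex" where
  "sqadj d B i j = adj_mat (sqmat d B) $$ (i, j)"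

lemma sqmat_carrier: "sqmat d B \<in> carrier_mat d d"
  by (simp add: sqmat_def)

lemma sqadj_right:
  assumes "i < d" "j < d"
  shows "(\<Sum>l<d. B i l * sqadj d B l j) = (if i = j then sqdet d B else 0)"
proof -
  have c: "adj_mat (sqmat d B) \<in> carrier_mat d d" by (rule adj_mat(1)[OF sqmat_carrier])
  have "(sqmat d B * adj_mat (sqmat d B)) $$ (i, j) = (sqdet d B \<cdot>\<^sub>m 1\<^sub>m d) $$ (i, j)"
    unfolding sqdet_def by (simp only: adj_mat(2)[OF sqmat_carrier])
  moreover have "(sqmat d B * adj_mat (sqmat d B)) $$ (i, j) = (\<Sum>l<d. B i l * sqadj d B l j)"
    using assms c by (simp add: scalar_prod_def sqmat_def sqadj_def atLeast0LessThan)
  ultimately show ?thesis using assms by simp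
qed

lemma sqadj_left:
  assumes "i < d" "j < d"
  shows "(\<Sum>l<d. sqadj d B i l * B l j) = (if i = j then sqdet d B else 0)"
proof -
  have c: "adj_mat (sqmat d B) \<in> carrier_mat d d" by (rule adj_mat(1)[OF sqmat_carrier])
  have "(adj_mat (sqmat d B) * sqmat d B) $$ (i, j) = (sqdet d B \<cdot>\<^sub>m 1\<^sub>m d) $$ (i, j)"
    unfolding sqdet_def by (simp only: adj_mat(3)[OF sqmat_carrier])
  moreover have "(adj_mat (sqmat d B) * sqmat d B) $$ (i, j) = (\<Sum>l<d. sqadj d B i l * B l j)"
    using assms c by (simp add: scalar_prod_def sqmat_def sqadj_def atLeast0LessThan)
  ultimately show ?thesis using assms by simp
qed

lemma sqdet_full_rank: "sqdet d B \<noteq> 0 \<longleftrightarrow> full_rank d d B"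
proof
  assume det: "sqdet d B \<noteq> 0"
  show "full_rank d d B" unfolding full_rank_def
  proof (intro allI impI)
    fix c k assume c: "\<forall>a<d. (\<Sum>k<d. c k * B a k) = 0" and k: "k < d"
    have "sqdet d B * c k = (\<Sum>j<d. (\<Sum>l<d. sqadj d B k l * B l j) * c j)"
      using k by (simp add: sqadj_left sum.delta if_distrib[of "\<lambda>x. x * _"] cong: if_cong)
    also have "\<dots> = (\<Sum>l<d. sqadj d B k l * (\<Sum>j<d. c j * B l j))"
      unfolding sum_distrib_left sum_distrib_right by (subst sum.swap) (simp add: ac_simps)
    also have "\<dots> = 0" using c by simp
    finally show "c k = 0" using det by simp
  qed
next
  assume fr: "full_rank d d B"
  show "sqdet d B \<noteq> 0"
  proof
    assume "sqdet d B = 0"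
    then obtain v where v: "v \<in> carrier_vec d" "v \<noteq> 0\<^sub>v d" "sqmat d B *\<^sub>v v = 0\<^sub>v d"
      using det_0_iff_vec_prod_zero_field[OF sqmat_carrier] by (auto simp: sqdet_def)
    have "(\<Sum>k<d. v $ k * B a k) = 0" if "a < d" for a
    proof -
      have "(sqmat d B *\<^sub>v v) $ a = 0" using v(3) that by simp
      then show ?thesis
        using that v(1) by (simp add: scalar_prod_def sqmat_def atLeast0LessThan mult.commute)
    qed
    then have "\<forall>k<d. v $ k = 0" using fr by (auto simp: full_rank_def)
    then have "v = 0\<^sub>v d" using v(1) by (intro eq_vecI) auto
    with v(2) show False by simp
  qed
qed

lemma det_polyon:
  assumes "\<And>i j. (\<lambda>x. B x i j) \<in> polyon V"
  shows "(\<lambda>x. det (mat d d (\<lambda>(i, j). B x i j))) \<in> polyon V"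
proof -
  have "det (mat d d (\<lambda>(i, j). B x i j))
      = (\<Sum>p\<in>{p. p permutes {0..<d}}. signof p * (\<Prod>i\<in>{0..<d}. B x i (p i)))" for x
    by (subst det_def'[of _ d]) (auto intro!: sum.cong prod.cong simp: permutes_in_image[of _ "{0..<d}", simplified])
  then show ?thesis using assms by (auto intro!: polyon_intros)
qed

lemma sqdet_polyon: "(\<And>i j. (\<lambda>x. B x i j) \<in> polyon V) \<Longrightarrow> (\<lambda>x. sqdet d (B x)) \<in> polyon V"
  unfolding sqdet_def sqmat_def by (rule det_polyon)

lemma sqadj_polyon:
  assumes B: "\<And>i j. (\<lambda>x. B x i j) \<in> polyon V" and ij: "i < d" "j < d"
  shows "(\<lambda>x. sqadj d (B x) i j) \<in> polyon V"
proof -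
  have "sqadj d (B x) i j = (- 1) ^ (j + i) * det (mat (d - 1) (d - 1)
      (\<lambda>(k, l). B x (if k < j then k else Suc k) (if l < i then l else Suc l)))" for x
  proof -
    have "mat_delete (sqmat d (B x)) j i = mat (d - 1) (d - 1)
      (\<lambda>(k, l). B x (if k < j then k else Suc k) (if l < i then l else Suc l))"
      unfolding mat_delete_def sqmat_def by (rule eq_matI) auto
    then show ?thesis using ij by (simp add: sqadj_def adj_mat_def cofactor_def sqmat_def)
  qed
  then show ?thesis by (auto intro!: polyon_intros det_polyon B)
qed

lemma full_rank_solve:
  assumes "full_rank d d B"
  shows "\<exists>c. \<forall>k<d. (\<Sum>l<d. c l * B k l) = b k"
proof (intro exI allI impI)
  fix k assume k: "k < d"
  have det: "sqdet d B \<noteq> 0" using assms sqdet_full_rank by blast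
  have "(\<Sum>l<d. (\<Sum>j<d. sqadj d B l j * b j / sqdet d B) * B k l)
      = (\<Sum>j<d. (\<Sum>l<d. B k l * sqadj d B l j) * b j / sqdet d B)"
    unfolding sum_distrib_left sum_distrib_right sum_divide_distrib by (subst sum.swap) (simp add: ac_simps)
  also have "\<dots> = b k"
    using k det by (simp add: sqadj_right sum.delta if_distrib[of "\<lambda>x. x * _"] if_distrib[of "\<lambda>x. x / _"] cong: if_cong)
  finally show "(\<Sum>l<d. (\<Sum>j<d. sqadj d B l j * b j / sqdet d B) * B k l) = b k" .
qed

text \<open>Induction on the columns: on the rows chosen so far, the new column is a combination of
  the old ones. A row where this combination fails is the next row of the minor.\<close>

lemma full_rank_minor:
  "full_rank n d A \<Longrightarrow> \<exists>\<rho>\<in>PiE {..<d} (\<lambda>_. {..<n}). inj_on \<rho> {..<d} \<and> full_rank d d (\<lambda>k l. A (\<rho> k) l)"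
proof (induction d)
  case 0
  then show ?case by (auto simp: full_rank_def)
next
  case (Suc d)
  have "full_rank n d A" unfolding full_rank_def
  proof (intro allI impI)
    fix c k assume c: "\<forall>a<n. (\<Sum>k<d. c k * A a k) = 0" and k: "k < d"
    have "\<forall>a<n. (\<Sum>k<Suc d. (c(d := 0)) k * A a k) = 0" using c by simp
    then have "\<forall>k<Suc d. (c(d := 0)) k = 0"
      using Suc.prems unfolding full_rank_def by blast
    with k show "c k = 0" by (metis fun_upd_other less_SucI nat_neq_iff)
  qed
  then obtain \<rho> where \<rho>: "\<rho> \<in> PiE {..<d} (\<lambda>_. {..<n})" "inj_on \<rho> {..<d}" "full_rank d d (\<lambda>k l. A (\<rho> k) l)"
    using Suc.IH by blast
  from full_rank_solve[OF \<rho>(3), of "\<lambda>k. A (\<rho> k) d"] obtain c where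
    c: "\<forall>k<d. (\<Sum>l<d. c l * A (\<rho> k) l) = A (\<rho> k) d" ..
  \<comment> \<open>Otherwise the last column would be a combination of the others on every
    row.\<close>
  have "\<exists>a<n. A a d - (\<Sum>l<d. c l * A a l) \<noteq> 0"
  proof (rule ccontr)
    assume "\<not> ?thesis"
    then have "\<forall>a<n. (\<Sum>k<Suc d. ((\<lambda>l. - c l)(d := 1)) k * A a k) = 0" by (simp add: sum_negf)
    then have "((\<lambda>l. - c l)(d := 1)) d = 0"
      using Suc.prems unfolding full_rank_def by blast
    then show False by simp
  qed
  then obtain a where a: "a < n" "A a d - (\<Sum>l<d. c l * A a l) \<noteq> 0" by blast
  have anot: "a \<notin> \<rho> ` {..<d}" using a(2) c by auto
  show ?case
  proof (intro bexI conjI)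
    show "\<rho>(d := a) \<in> PiE {..<Suc d} (\<lambda>_. {..<n})"
      using \<rho>(1) a(1) by (auto simp: PiE_iff extensional_def less_Suc_eq)
    show "inj_on (\<rho>(d := a)) {..<Suc d}"
      using \<rho>(2) anot by (auto simp: lessThan_Suc inj_on_def)
    show "full_rank (Suc d) (Suc d) (\<lambda>k l. A ((\<rho>(d := a)) k) l)"
      unfolding full_rank_def
    proof (intro allI impI)
      fix x k assume x: "\<forall>i<Suc d. (\<Sum>k<Suc d. x k * A ((\<rho>(d := a)) i) k) = 0" and k: "k < Suc d"
      have "(\<Sum>l<d. (x l + x d * c l) * A (\<rho> i) l) = 0" if i: "i < d" for i
      proof -
        have "(\<Sum>l<d. (x l + x d * c l) * A (\<rho> i) l)
            = (\<Sum>l<d. x l * A (\<rho> i) l) + x d * (\<Sum>l<d. c l * A (\<rho> i) l)"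
          by (simp add: algebra_simps sum.distrib sum_distrib_left)
        also have "\<dots> = 0" using x[rule_format, of i] c i by simp
        finally show ?thesis .
      qed
      then have "\<forall>l<d. x l + x d * c l = 0"
        using \<rho>(3)[unfolded full_rank_def, THEN spec, of "\<lambda>l. x l + x d * c l"] by simp
      then have xl: "x l = - x d * c l" if "l < d" for l using that by (simp add: add_eq_0_iff)
      have "0 = (\<Sum>l<d. x l * A a l) + x d * A a d" using x[rule_format, of d] by simp
      also have "(\<Sum>l<d. x l * A a l) = - x d * (\<Sum>l<d. c l * A a l)"
        unfolding sum_distrib_left by (rule sum.cong) (auto simp: xl)
      finally have "0 = - x d * (\<Sum>l<d. c l * A a l) + x d * A a d" .
      then have "x d * A a d = x d * (\<Sum>l<d. c l * A a l)" by simp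
      then have "x d * (A a d - (\<Sum>l<d. c l * A a l)) = 0" by (simp only: right_diff_distrib) simp
      then have "x d = 0" using a(2) by simp
      with xl k show "x k = 0" by (cases "k = d") auto
    qed
  qed
qed

lemma colspace_column: "k < d \<Longrightarrow> (\<lambda>a. if a < n then A a k else 0) \<in> colspace n d A"
  unfolding colspace_def
  by (intro CollectI exI[of _ "\<lambda>l. if l = k then 1 else 0"])
    (auto simp: fun_eq_iff sum.delta if_distrib[of "\<lambda>x. x * _"] cong: if_cong)

lemma colspace_mono:
  assumes "\<And>a k. a < n \<Longrightarrow> k < d \<Longrightarrow> A a k = (\<Sum>l<d. B a l * G l k)"
  shows "colspace n d A \<subseteq> colspace n d B"
proof
  fix v assume "v \<in> colspace n d A"
  then obtain c where c: "v = (\<lambda>a. if a < n then (\<Sum>k<d. c k * A a k) else 0)"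
    by (auto simp: colspace_def)
  have "(\<Sum>k<d. c k * A a k) = (\<Sum>l<d. (\<Sum>k<d. c k * G l k) * B a l)" if "a < n" for a
  proof -
    have "(\<Sum>k<d. c k * A a k) = (\<Sum>k<d. \<Sum>l<d. c k * (B a l * G l k))"
      using that by (simp add: assms sum_distrib_left)
    also have "\<dots> = (\<Sum>l<d. (\<Sum>k<d. c k * G l k) * B a l)"
      unfolding sum_distrib_right by (subst sum.swap) (simp add: ac_simps)
    finally show ?thesis .
  qed
  then show "v \<in> colspace n d B"
    unfolding colspace_def c by (auto simp: fun_eq_iff intro!: exI[of _ "\<lambda>l. \<Sum>k<d. c k * G l k"])
qed

lemma full_rank_le:
  assumes "full_rank n d A"
  shows "d \<le> n"
proof -
  obtain \<rho> where "\<rho> \<in> PiE {..<d} (\<lambda>_. {..<n})" "inj_on \<rho> {..<d}"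
    using full_rank_minor[OF assms] by blast
  then have "card {..<d} \<le> card {..<n}" by (intro card_inj_on_le[of \<rho>]) auto
  then show ?thesis by simp
qed

text \<open>If the columns of \<open>B\<close> pair to zero with those of \<open>A\<close>, then on the rows of an invertible
  minor of \<open>A\<close> the matrix \<open>B\<close> is determined by its other rows, so those rows have full rank.\<close>
lemma full_rank_orthogonal:
  assumes A: "full_rank n d A" and B: "full_rank n e B"
    and orth: "\<And>k l. k < d \<Longrightarrow> l < e \<Longrightarrow> (\<Sum>a<n. A a k * B a l) = 0"
  shows "d + e \<le> n"
proof -
  obtain \<rho> where \<rho>: "\<rho> \<in> PiE {..<d} (\<lambda>_. {..<n})" "inj_on \<rho> {..<d}" "full_rank d d (\<lambda>k l. A (\<rho> k) l)"
    using full_rank_minor[OF A] by blast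
  define R where "R = \<rho> ` {..<d}"
  have R: "R \<subseteq> {..<n}" "card R = d" using \<rho>(1,2) by (auto simp: R_def card_image)
  define m where "m = n - d"
  have "card ({..<n} - R) = m" using R by (simp add: m_def card_Diff_subset finite_subset)
  then obtain f where f: "bij_betw f {..<m} ({..<n} - R)"
    using ex_bij_betw_nat_finite[of "{..<n} - R"] by (auto simp: atLeast0LessThan)
  have det: "sqdet d (\<lambda>k l. A (\<rho> k) l) \<noteq> 0" using \<rho>(3) sqdet_full_rank by blast
  have "full_rank m e (\<lambda>a l. B (f a) l)" unfolding full_rank_def
  proof (intro allI impI)
    fix c l assume c: "\<forall>a<m. (\<Sum>l<e. c l * B (f a) l) = 0" and l: "l < e"
    define v where "v a = (\<Sum>l<e. c l * B a l)" for a
    have v0: "v a = 0" if "a \<in> {..<n} - R" for a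
    proof -
      from that f obtain i where "i < m" "a = f i" by (auto simp: bij_betw_def)
      with c show ?thesis by (simp add: v_def)
    qed
    have "(\<Sum>j<d. v (\<rho> j) * A (\<rho> j) k) = 0" if k: "k < d" for k
    proof -
      have "(\<Sum>j<d. v (\<rho> j) * A (\<rho> j) k) = (\<Sum>a\<in>R. v a * A a k)"
        unfolding R_def by (subst sum.reindex[OF \<rho>(2)]) simp
      also have "\<dots> = (\<Sum>a<n. v a * A a k)"
        by (rule sum.mono_neutral_left) (use R v0 in auto)
      also have "\<dots> = (\<Sum>l<e. c l * (\<Sum>a<n. A a k * B a l))"
        unfolding v_def sum_distrib_left sum_distrib_right by (subst sum.swap) (simp add: ac_simps)
      also have "\<dots> = 0" using orth[OF k] by simp
      finally show ?thesis .
    qed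
    note vA = this
    have "v (\<rho> i) = 0" if i: "i < d" for i
    proof -
      have "sqdet d (\<lambda>k l. A (\<rho> k) l) * v (\<rho> i) = (\<Sum>j<d. v (\<rho> j) * (\<Sum>k<d. A (\<rho> j) k * sqadj d (\<lambda>k l. A (\<rho> k) l) k i))"
        using i by (simp add: sqadj_right[where B = "\<lambda>k l. A (\<rho> k) l"] sum.delta if_distrib[of "\<lambda>x. _ * x"] cong: if_cong)
      also have "\<dots> = (\<Sum>k<d. (\<Sum>j<d. v (\<rho> j) * A (\<rho> j) k) * sqadj d (\<lambda>k l. A (\<rho> k) l) k i)"
        unfolding sum_distrib_left sum_distrib_right by (subst sum.swap) (simp add: ac_simps)
      also have "\<dots> = 0" using vA by simp
      finally show ?thesis using det by simp
    qed
    then have "v a = 0" if "a < n" for a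
      using v0 that by (cases "a \<in> R") (auto simp: R_def)
    then show "c l = 0" using B l by (simp add: full_rank_def v_def)
  qed
  from full_rank_le[OF this] have "e \<le> m" .
  moreover have "d \<le> n" using full_rank_le[OF A] .
  ultimately show ?thesis by (simp add: m_def)
qed

section \<open>Charts of the product of Grassmannians\<close>

type_synonym sidx = "bool \<times> nat \<times> nat \<times> nat"
type_synonym hidx = "nat \<times> nat \<times> nat \<times> nat"

locale channel =
  fixes K :: nat and d M N :: "nat \<Rightarrow> nat"
begin

text \<open>\<open>True\<close> marks the receive side \<open>V i\<close> and \<open>False\<close>
  the transmit side \<open>U i\<close>, as in the indices of \<open>stiefel\<close>.\<close>

definition nn :: "bool \<Rightarrow> nat \<Rightarrow> nat" where
  "nn b i = (if b then N i else M i)"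

abbreviation strat :: "(sidx \<Rightarrow> complex) \<Rightarrow> strat" where
  "strat X \<equiv> strat_of K d M N X"

abbreviation stief :: "(sidx \<Rightarrow> complex) set" where
  "stief \<equiv> stiefel K d M N"

abbreviation span_of :: "(sidx \<Rightarrow> complex) \<Rightarrow> bool \<Rightarrow> nat \<Rightarrow> (nat \<Rightarrow> complex) set" where
  "span_of X b i \<equiv> colspace (nn b i) (d i) (\<lambda>a k. X (b, i, a, k))"

lemma stief_iff:
  "X \<in> stief \<longleftrightarrow> (\<forall>b i a k. X (b, i, a, k) \<noteq> 0 \<longrightarrow> i < K \<and> a < nn b i \<and> k < d i) \<and>
     (\<forall>b. \<forall>i<K. full_rank (nn b i) (d i) (\<lambda>a k. X (b, i, a, k)))"
  unfolding stiefel_def nn_def by (simp add: all_bool_eq) blast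

lemma strat_eq_iff:
  "strat X = strat X' \<longleftrightarrow> (\<forall>b. \<forall>i<K. span_of X b i = span_of X' b i)"
  unfolding strat_of_def nn_def by (auto simp: all_bool_eq fun_eq_iff)

lemma strat_grass_prod: "X \<in> stief \<Longrightarrow> strat X \<in> grass_prod K d M N"
  unfolding stief_iff strat_of_def grass_prod_def grass_def
  by (auto simp: all_bool_eq nn_def)

lemma grass_prod_strat:
  assumes "s \<in> grass_prod K d M N"
  shows "\<exists>X\<in>stief. s = strat X"
proof -
  obtain U V where s: "s = (U, V)" by fastforce
  have "\<exists>A. full_rank (nn b i) (d i) A \<and> (if b then V i else U i) = colspace (nn b i) (d i) A" if "i < K" for b i
    using assms that by (auto simp: s grass_prod_def grass_def nn_def)
  note ex = this
  define A where "A b i = (SOME A. full_rank (nn b i) (d i) A \<and> (if b then V i else U i) = colspace (nn b i) (d i) A)" for b i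
  have A: "full_rank (nn b i) (d i) (A b i)" "(if b then V i else U i) = colspace (nn b i) (d i) (A b i)" if "i < K" for b i
    using someI_ex[OF ex[OF that, of b]] unfolding A_def by blast+
  define X where "X = (\<lambda>(b, i, a, k). if i < K \<and> a < nn b i \<and> k < d i then A b i a k else 0)"
  have fr: "full_rank (nn b i) (d i) (\<lambda>a k. X (b, i, a, k)) \<longleftrightarrow> full_rank (nn b i) (d i) (A b i)" if "i < K" for b i
    unfolding full_rank_def X_def using that by simp
  have cs: "span_of X b i = colspace (nn b i) (d i) (A b i)" if "i < K" for b i
    unfolding colspace_def X_def using that by (simp cong: if_cong)
  have "X \<in> stief" unfolding stief_iff using fr A(1) by (auto simp: X_def split: if_splits)
  moreover have "strat X = s"
  proof -
    have "V i = span_of X True i" "U i = span_of X False i" if "i < K" for i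
      using A(2)[OF that, of True] A(2)[OF that, of False] cs[OF that] by simp_all
    moreover have "U i = {}" "V i = {}" if "\<not> i < K" for i
      using assms that by (auto simp: s grass_prod_def)
    ultimately show ?thesis by (auto simp: s strat_of_def nn_def fun_eq_iff)
  qed
  ultimately show ?thesis by blast
qed

text \<open>A chart selects \<open>d i\<close> pivot rows for each of the 2 \<open>K\<close>
  subspaces. The rows are ordered, so several charts may describe the same open set; what matters is
  that charts are finite in number and cover the product.\<close>

definition charts :: "(bool \<times> nat \<Rightarrow> nat \<Rightarrow> nat) set" where
  "charts = PiE (UNIV \<times> {..<K}) (\<lambda>(b, i). {\<rho> \<in> PiE {..<d i} (\<lambda>_. {..<nn b i}). inj_on \<rho> {..<d i}})"

lemma finite_charts: "finite charts"
  unfolding charts_def by (intro finite_PiE) (auto intro!: finite_PiE)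

lemma chartD:
  assumes "\<rho> \<in> charts" "i < K"
  shows "inj_on (\<rho> (b, i)) {..<d i}" "k < d i \<Longrightarrow> \<rho> (b, i) k < nn b i"
  using assms by (auto simp: charts_def PiE_iff)

lemma chart_inj: "\<rho> \<in> charts \<Longrightarrow> i < K \<Longrightarrow> k < d i \<Longrightarrow> l < d i \<Longrightarrow> \<rho> (b, i) k = \<rho> (b, i) l \<longleftrightarrow> k = l"
  using chartD(1)[of \<rho> i b] by (auto simp: inj_on_eq_iff)

definition rows :: "(bool \<times> nat \<Rightarrow> nat \<Rightarrow> nat) \<Rightarrow> bool \<Rightarrow> nat \<Rightarrow> nat set" where
  "rows \<rho> b i = \<rho> (b, i) ` {..<d i}"

lemma rows: "\<rho> \<in> charts \<Longrightarrow> i < K \<Longrightarrow> rows \<rho> b i \<subseteq> {..<nn b i}"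
  "\<rho> \<in> charts \<Longrightarrow> i < K \<Longrightarrow> card (rows \<rho> b i) = d i"
  by (auto simp: rows_def chartD card_image)

lemma card_free:
  assumes "\<rho> \<in> charts" "i < K"
  shows "card ({..<nn b i} - rows \<rho> b i) = nn b i - d i"
  using rows[OF assms, of b] by (subst card_Diff_subset) (auto simp: rows_def)

text \<open>The section of the chart \<open>\<rho>\<close>: the rows selected by \<open>\<rho>\<close> form an identity matrix, the
  remaining entries are the affine coordinates.\<close>
definition sect :: "(bool \<times> nat \<Rightarrow> nat \<Rightarrow> nat) \<Rightarrow> (sidx + hidx \<Rightarrow> complex) \<Rightarrow> sidx \<Rightarrow> complex" where
  "sect \<rho> x = (\<lambda>(b, i, a, k). if i < K \<and> k < d i \<and> a < nn b i then
      (if a \<in> rows \<rho> b i then (if a = \<rho> (b, i) k then 1 else 0) else x (Inl (b, i, a, k))) else 0)"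

text \<open>The free chart coordinates of the users in \<open>A\<close> only; proper subsets of
  users are needed for the bounds on \<open>tA\<close>.\<close>

definition yvars :: "(bool \<times> nat \<Rightarrow> nat \<Rightarrow> nat) \<Rightarrow> nat set \<Rightarrow> (sidx + hidx) set" where
  "yvars \<rho> A = Inl ` {(b, i, a, k). i \<in> A \<and> a \<in> {..<nn b i} - rows \<rho> b i \<and> k < d i}"

lemma sect_stief:
  assumes "\<rho> \<in> charts"
  shows "sect \<rho> x \<in> stief"
  unfolding stief_iff
proof (intro conjI allI impI)
  fix b i assume i: "i < K"
  show "full_rank (nn b i) (d i) (\<lambda>a k. sect \<rho> x (b, i, a, k))"
    unfolding full_rank_def
  proof (intro allI impI)
    fix c k assume c: "\<forall>a<nn b i. (\<Sum>k<d i. c k * sect \<rho> x (b, i, a, k)) = 0" and k: "k < d i"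
    have "(\<Sum>l<d i. c l * sect \<rho> x (b, i, \<rho> (b, i) k, l)) = (\<Sum>l<d i. if l = k then c l else 0)"
      using chartD(2)[OF assms i] k i by (intro sum.cong) (auto simp: sect_def rows_def chart_inj[OF assms])
    then show "c k = 0" using c chartD(2)[OF assms i k] k by (simp add: sum.delta)
  qed
qed (auto simp: sect_def split: if_splits)

lemma sect_cong:
  assumes "\<And>v. v \<in> yvars \<rho> {..<K} \<Longrightarrow> x v = y v"
  shows "sect \<rho> x = sect \<rho> y"
  unfolding sect_def by (rule ext) (auto simp: yvars_def intro!: assms)

lemma sect_polyon: "i \<in> A \<Longrightarrow> (\<lambda>x. sect \<rho> x (b, i, a, k)) \<in> polyon (yvars \<rho> A)"
  unfolding sect_def by (auto intro!: polyon_if polyon.const polyon.coord simp: yvars_def)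

lemma sect_polyon_all: "(\<lambda>x. sect \<rho> x v) \<in> polyon (yvars \<rho> {..<K})"
proof -
  obtain b i a k where v: "v = (b, i, a, k)" by (cases v) auto
  show ?thesis
  proof (cases "i < K")
    case True
    then show ?thesis unfolding v by (intro sect_polyon) simp
  next
    case False
    then have "(\<lambda>x. sect \<rho> x v) = (\<lambda>x. 0)" by (auto simp: v sect_def)
    then show ?thesis using polyon.const by metis
  qed
qed

definition minor :: "(bool \<times> nat \<Rightarrow> nat \<Rightarrow> nat) \<Rightarrow> (sidx \<Rightarrow> complex) \<Rightarrow> bool \<Rightarrow> nat \<Rightarrow> nat \<Rightarrow> nat \<Rightarrow> complex" where
  "minor \<rho> X b i k l = X (b, i, \<rho> (b, i) k, l)"

definition minordet :: "(bool \<times> nat \<Rightarrow> nat \<Rightarrow> nat) \<Rightarrow> (sidx \<Rightarrow> complex) \<Rightarrow> bool \<Rightarrow> nat \<Rightarrow> complex" where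
  "minordet \<rho> X b i = sqdet (d i) (minor \<rho> X b i)"

text \<open>The matrix times the adjugate of its selected minor. Division by the determinant of the
  minor turns the pivot block into the identity.\<close>

definition numer :: "(bool \<times> nat \<Rightarrow> nat \<Rightarrow> nat) \<Rightarrow> (sidx \<Rightarrow> complex) \<Rightarrow> sidx \<Rightarrow> complex" where
  "numer \<rho> X = (\<lambda>(b, i, a, k). \<Sum>l<d i. X (b, i, a, l) * sqadj (d i) (minor \<rho> X b i) l k)"

definition coords :: "(bool \<times> nat \<Rightarrow> nat \<Rightarrow> nat) \<Rightarrow> (sidx \<Rightarrow> complex) \<Rightarrow> sidx + hidx \<Rightarrow> complex" where
  "coords \<rho> X = (\<lambda>v. case v of Inl (b, i, a, k) \<Rightarrow> numer \<rho> X (b, i, a, k) / minordet \<rho> X b i | Inr _ \<Rightarrow> 0)"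

lemma chart_exists:
  assumes "X \<in> stief"
  shows "\<exists>\<rho>\<in>charts. \<forall>b. \<forall>i<K. minordet \<rho> X b i \<noteq> 0"
proof -
  have "\<forall>p\<in>UNIV \<times> {..<K}. \<exists>r. r \<in> PiE {..<d (snd p)} (\<lambda>_. {..<nn (fst p) (snd p)}) \<and> inj_on r {..<d (snd p)} \<and>
      full_rank (d (snd p)) (d (snd p)) (\<lambda>k l. X (fst p, snd p, r k, l))"
    using assms full_rank_minor by (fastforce simp: stief_iff Bex_def)
  from bchoice[OF this] obtain r where r: "\<forall>p\<in>UNIV \<times> {..<K}. r p \<in> PiE {..<d (snd p)} (\<lambda>_. {..<nn (fst p) (snd p)}) \<and>
     inj_on (r p) {..<d (snd p)} \<and> full_rank (d (snd p)) (d (snd p)) (\<lambda>k l. X (fst p, snd p, r p k, l))" ..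
  have "restrict r (UNIV \<times> {..<K}) \<in> charts" unfolding charts_def
    by (rule restrict_PiE_iff[THEN iffD2]) (use r in auto)
  moreover have "minordet (restrict r (UNIV \<times> {..<K})) X b i \<noteq> 0" if "i < K" for b i
    unfolding minordet_def sqdet_full_rank using r[rule_format, of "(b, i)"] that
    by (simp add: minor_def[abs_def])
  ultimately show ?thesis by blast
qed

lemma numer_minor:
  assumes "m < d i" "k < d i"
  shows "numer \<rho> X (b, i, \<rho> (b, i) m, k) = (if m = k then minordet \<rho> X b i else 0)"
  using sqadj_right[OF assms, of "minor \<rho> X b i"] by (simp add: numer_def minordet_def minor_def)

lemma sect_coords:
  assumes \<rho>: "\<rho> \<in> charts" and det: "minordet \<rho> X b i \<noteq> 0" and i: "i < K" "a < nn b i" "k < d i"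
  shows "sect \<rho> (coords \<rho> X) (b, i, a, k) = numer \<rho> X (b, i, a, k) / minordet \<rho> X b i"
proof (cases "a \<in> rows \<rho> b i")
  case True
  then obtain m where m: "m < d i" "a = \<rho> (b, i) m" by (auto simp: rows_def)
  have "a = \<rho> (b, i) k \<longleftrightarrow> m = k" using chart_inj[OF \<rho> i(1)] m i(3) by auto
  moreover have "numer \<rho> X (b, i, a, k) = (if m = k then minordet \<rho> X b i else 0)"
    unfolding m(2) by (rule numer_minor[OF m(1) i(3)])
  ultimately show ?thesis using True i det by (simp add: sect_def)
qed (use i in \<open>simp add: sect_def coords_def\<close>)

lemma numer_expand:
  assumes "k < d i"
  shows "(\<Sum>l<d i. numer \<rho> X (b, i, a, l) * X (b, i, \<rho> (b, i) l, k)) = minordet \<rho> X b i * X (b, i, a, k)"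
proof -
  have "(\<Sum>l<d i. numer \<rho> X (b, i, a, l) * X (b, i, \<rho> (b, i) l, k))
      = (\<Sum>m<d i. X (b, i, a, m) * (\<Sum>l<d i. sqadj (d i) (minor \<rho> X b i) m l * minor \<rho> X b i l k))"
    unfolding numer_def minor_def prod.case sum_distrib_left sum_distrib_right by (subst sum.swap) (simp add: ac_simps)
  also have "\<dots> = minordet \<rho> X b i * X (b, i, a, k)"
    using assms by (simp add: sqadj_left minordet_def sum.delta if_distrib[of "\<lambda>x. _ * x"] cong: if_cong)
  finally show ?thesis .
qed

text \<open>The section matrix is the given one times the inverse of its pivot block, which leaves
  the column space unchanged.\<close>

lemma strat_sect_coords:
  assumes \<rho>: "\<rho> \<in> charts" and det: "\<And>b i. i < K \<Longrightarrow> minordet \<rho> X b i \<noteq> 0"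
  shows "strat (sect \<rho> (coords \<rho> X)) = strat X"
  unfolding strat_eq_iff
proof (intro allI impI equalityI)
  fix b i assume i: "i < K"
  show "span_of (sect \<rho> (coords \<rho> X)) b i \<subseteq> span_of X b i"
    by (rule colspace_mono[where G = "\<lambda>l k. sqadj (d i) (minor \<rho> X b i) l k / minordet \<rho> X b i"])
      (simp add: sect_coords[OF \<rho> det[OF i] i] numer_def sum_divide_distrib)
  show "span_of X b i \<subseteq> span_of (sect \<rho> (coords \<rho> X)) b i"
  proof (rule colspace_mono[where G = "\<lambda>l k. X (b, i, \<rho> (b, i) l, k)"])
    fix a k assume a: "a < nn b i" "k < d i"
    have "(\<Sum>l<d i. sect \<rho> (coords \<rho> X) (b, i, a, l) * X (b, i, \<rho> (b, i) l, k))
        = (\<Sum>l<d i. numer \<rho> X (b, i, a, l) * X (b, i, \<rho> (b, i) l, k)) / minordet \<rho> X b i"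
      using a by (simp add: sect_coords[OF \<rho> det[OF i] i] sum_divide_distrib)
    also have "\<dots> = X (b, i, a, k)" using numer_expand[OF a(2)] det[OF i] by simp
    finally show "X (b, i, a, k) = (\<Sum>l<d i. sect \<rho> (coords \<rho> X) (b, i, a, l) * X (b, i, \<rho> (b, i) l, k))" ..
  qed
qed

text \<open>A matrix with the column space of a section equals the section times its own pivot
  block, because the section has the identity there. Full rank then makes this block invertible, and
  dividing by it recovers the entries of the section.\<close>

lemma coords_unique:
  assumes \<rho>: "\<rho> \<in> charts" and X: "X \<in> stief" and eq: "strat X = strat (sect \<rho> x)" and i: "i < K"
  shows "minordet \<rho> X b i \<noteq> 0"
    "a \<in> {..<nn b i} - rows \<rho> b i \<Longrightarrow> k < d i \<Longrightarrow> coords \<rho> X (Inl (b, i, a, k)) = x (Inl (b, i, a, k))"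
proof -
  let ?S = "\<lambda>a k. sect \<rho> x (b, i, a, k)"
  have S_top: "?S (\<rho> (b, i) m) l = (if m = l then 1 else 0)" if "m < d i" "l < d i" for m l
    using that i chartD(2)[OF \<rho> i] by (auto simp: sect_def rows_def chart_inj[OF \<rho>])
  have fac: "X (b, i, a, k) = (\<Sum>l<d i. ?S a l * X (b, i, \<rho> (b, i) l, k))" if a: "a < nn b i" and k: "k < d i" for a k
  proof -
    have "(\<lambda>a. if a < nn b i then X (b, i, a, k) else 0) \<in> span_of (sect \<rho> x) b i"
    proof -
      have "span_of X b i = span_of (sect \<rho> x) b i" using eq i unfolding strat_eq_iff by blast
      with colspace_column[OF k, of "nn b i" "\<lambda>a k. X (b, i, a, k)"] show ?thesis by simp
    qed
    then obtain c where c: "(\<lambda>a. if a < nn b i then X (b, i, a, k) else 0) = (\<lambda>a. if a < nn b i then \<Sum>l<d i. c l * ?S a l else 0)"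
      by (auto simp: colspace_def)
    have Xc: "X (b, i, a, k) = (\<Sum>l<d i. c l * ?S a l)" if "a < nn b i" for a
      using fun_cong[OF c, of a] that by simp
    have "X (b, i, \<rho> (b, i) m, k) = c m" if "m < d i" for m
      using that chartD(2)[OF \<rho> i that] by (simp add: Xc S_top sum.delta if_distrib[of "\<lambda>x. _ * x"] cong: if_cong)
    then show ?thesis using Xc[OF a] by (simp add: mult.commute)
  qed
  have "full_rank (d i) (d i) (minor \<rho> X b i)" unfolding full_rank_def
  proof (intro allI impI)
    fix c k assume c: "\<forall>a<d i. (\<Sum>k<d i. c k * minor \<rho> X b i a k) = 0" and k: "k < d i"
    have "(\<Sum>k<d i. c k * X (b, i, a, k)) = 0" if "a < nn b i" for a
    proof -
      have "(\<Sum>k<d i. c k * X (b, i, a, k)) = (\<Sum>l<d i. ?S a l * (\<Sum>k<d i. c k * minor \<rho> X b i l k))"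
        unfolding sum_distrib_left minor_def by (subst sum.swap) (simp add: fac[OF that] sum_distrib_left ac_simps)
      then show ?thesis using c by simp
    qed
    then show "c k = 0" using X i k unfolding stief_iff full_rank_def by blast
  qed
  then show det: "minordet \<rho> X b i \<noteq> 0" unfolding minordet_def sqdet_full_rank .
  assume a: "a \<in> {..<nn b i} - rows \<rho> b i" and k: "k < d i"
  have "numer \<rho> X (b, i, a, k) = (\<Sum>m<d i. ?S a m * (\<Sum>l<d i. minor \<rho> X b i m l * sqadj (d i) (minor \<rho> X b i) l k))"
    unfolding numer_def prod.case sum_distrib_left
    by (subst sum.swap) (use a in \<open>simp add: fac sum_distrib_left sum_distrib_right minor_def ac_simps\<close>)
  also have "\<dots> = ?S a k * minordet \<rho> X b i"
    using k by (simp add: sqadj_right minordet_def sum.delta if_distrib[of "\<lambda>x. _ * x"] cong: if_cong)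
  finally show "coords \<rho> X (Inl (b, i, a, k)) = x (Inl (b, i, a, k))"
    using det a k i by (simp add: coords_def sect_def)
qed

lemma grass_prod_chart:
  assumes "s \<in> grass_prod K d M N"
  obtains \<rho> x where "\<rho> \<in> charts" "s = strat (sect \<rho> x)"
proof -
  obtain X where X: "X \<in> stief" "s = strat X" using grass_prod_strat[OF assms] by blast
  obtain \<rho> where "\<rho> \<in> charts" "\<forall>b. \<forall>i<K. minordet \<rho> X b i \<noteq> 0" using chart_exists[OF X(1)] by blast
  with strat_sect_coords[of \<rho> X] X(2) that show thesis by metis
qed

definition alldet :: "(bool \<times> nat \<Rightarrow> nat \<Rightarrow> nat) \<Rightarrow> (sidx \<Rightarrow> complex) \<Rightarrow> complex" where
  "alldet \<rho> X = (\<Prod>p\<in>UNIV \<times> {..<K}. minordet \<rho> X (fst p) (snd p))"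

lemma minor_polyon: "(\<lambda>X. minor \<rho> X b i k l) \<in> polyon UNIV"
  unfolding minor_def by (rule polyon.coord) simp

lemma minordet_polyon: "(\<lambda>X. minordet \<rho> X b i) \<in> polyon UNIV"
  unfolding minordet_def by (rule sqdet_polyon[OF minor_polyon])

lemma alldet_polyon: "(\<lambda>X. alldet \<rho> X) \<in> polyon UNIV"
  unfolding alldet_def by (intro polyon_prod minordet_polyon)

lemma alldet_nonzero: "alldet \<rho> X \<noteq> 0 \<longleftrightarrow> (\<forall>b. \<forall>i<K. minordet \<rho> X b i \<noteq> 0)"
  by (auto simp: alldet_def)

text \<open>Links the chart to the quotient topology: closed sets are defined by polynomials in
  matrix entries, while chart coordinates are rational in them with only pivot determinants in the
  denominators.\<close>

lemma clear_denominators: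
  assumes "f \<in> polyon (yvars \<rho> {..<K})"
  shows "\<exists>m p. p \<in> polyon UNIV \<and> (\<forall>X. alldet \<rho> X \<noteq> 0 \<longrightarrow> p X = alldet \<rho> X ^ m * f (coords \<rho> X))"
  using assms
proof (induction rule: polyon.induct)
  case (const c)
  show ?case by (rule exI[of _ 0], rule exI[of _ "\<lambda>X. c"]) (simp add: polyon.const)
next
  case (coord v)
  then obtain b i a k where v: "v = Inl (b, i, a, k)" "i < K" "k < d i" by (auto simp: yvars_def)
  define p where "p = (\<lambda>X. (\<Prod>q\<in>UNIV \<times> {..<K} - {(b, i)}. minordet \<rho> X (fst q) (snd q)) * numer \<rho> X (b, i, a, k))"
  have "p \<in> polyon UNIV" unfolding p_def numer_def prod.case
    using v(3) by (intro polyon_intros minordet_polyon sqadj_polyon minor_polyon) auto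
  moreover have "p X = alldet \<rho> X ^ 1 * coords \<rho> X v" if "alldet \<rho> X \<noteq> 0" for X
  proof -
    have "alldet \<rho> X = minordet \<rho> X b i * (\<Prod>q\<in>UNIV \<times> {..<K} - {(b, i)}. minordet \<rho> X (fst q) (snd q))"
      unfolding alldet_def by (subst prod.remove[of _ "(b, i)"]) (use v in auto)
    moreover have "minordet \<rho> X b i \<noteq> 0" using that v by (simp add: alldet_nonzero)
    ultimately show ?thesis by (simp add: p_def v coords_def)
  qed
  ultimately show ?case by blast
next
  case (add f g)
  then obtain m p m' p' where p: "p \<in> polyon UNIV" "\<forall>X. alldet \<rho> X \<noteq> 0 \<longrightarrow> p X = alldet \<rho> X ^ m * f (coords \<rho> X)"
    "p' \<in> polyon UNIV" "\<forall>X. alldet \<rho> X \<noteq> 0 \<longrightarrow> p' X = alldet \<rho> X ^ m' * g (coords \<rho> X)" by blast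
  show ?case
    by (rule exI[of _ "m + m'"], rule exI[of _ "\<lambda>X. alldet \<rho> X ^ m' * p X + alldet \<rho> X ^ m * p' X"])
      (auto intro!: polyon_intros alldet_polyon p simp: p power_add algebra_simps)
next
  case (mult f g)
  then obtain m p m' p' where p: "p \<in> polyon UNIV" "\<forall>X. alldet \<rho> X \<noteq> 0 \<longrightarrow> p X = alldet \<rho> X ^ m * f (coords \<rho> X)"
    "p' \<in> polyon UNIV" "\<forall>X. alldet \<rho> X \<noteq> 0 \<longrightarrow> p' X = alldet \<rho> X ^ m' * g (coords \<rho> X)" by blast
  show ?case
    by (rule exI[of _ "m + m'"], rule exI[of _ "\<lambda>X. p X * p' X"])
      (auto intro!: polyon_intros p simp: p power_add algebra_simps)
qed

text \<open>The set is the complement of the chart together with the zeros of \<open>f\<close>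
  inside it. On the Stiefel variety it is cut out by one equation, the cleared numerator of
  \<open>f\<close> times all pivot determinants. With \<open>f\<close> constantly one it is the
  complement of the chart.\<close>

lemma chart_complement_closed:
  assumes \<rho>: "\<rho> \<in> charts" and f: "f \<in> polyon (yvars \<rho> {..<K})"
  shows "grass_closed K d M N {s \<in> grass_prod K d M N. \<forall>x. s = strat (sect \<rho> x) \<longrightarrow> f x = 0}"
    (is "grass_closed _ _ _ _ ?C")
proof -
  obtain m p where p: "p \<in> polyon UNIV" "\<And>X. alldet \<rho> X \<noteq> 0 \<Longrightarrow> p X = alldet \<rho> X ^ m * f (coords \<rho> X)"
    using clear_denominators[OF f] by blast
  have "strat X \<in> ?C \<longleftrightarrow> alldet \<rho> X * p X = 0" if X: "X \<in> stief" for X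
  proof
    assume C: "strat X \<in> ?C"
    show "alldet \<rho> X * p X = 0"
    proof (rule ccontr)
      assume nz: "alldet \<rho> X * p X \<noteq> 0"
      then have ad: "alldet \<rho> X \<noteq> 0" by simp
      with strat_sect_coords[OF \<rho>, of X] have "strat X = strat (sect \<rho> (coords \<rho> X))"
        by (simp add: alldet_nonzero)
      with C have "f (coords \<rho> X) = 0" by blast
      with p(2)[OF ad] nz show False by simp
    qed
  next
    assume z: "alldet \<rho> X * p X = 0"
    have "f x = 0" if x: "strat X = strat (sect \<rho> x)" for x
    proof -
      have det: "alldet \<rho> X \<noteq> 0" using coords_unique(1)[OF \<rho> X x] by (simp add: alldet_nonzero)
      have "f (coords \<rho> X) = f x"
        by (rule polyon_cong[OF f]) (auto simp: yvars_def coords_unique(2)[OF \<rho> X x])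
      with p(2)[OF det] z det show ?thesis by simp
    qed
    with strat_grass_prod[OF X] show "strat X \<in> ?C" by blast
  qed
  then have "{X \<in> stief. strat X \<in> ?C} = {X \<in> stief. \<forall>q\<in>{\<lambda>X. alldet \<rho> X * p X}. q X = 0}" by auto
  moreover have "{\<lambda>X. alldet \<rho> X * p X} \<subseteq> polyfun"
    using polyon_polyfun[OF polyon.mult[OF alldet_polyon p(1)]] by blast
  ultimately show ?thesis unfolding grass_closed_def zariski_closed_in_def by blast
qed

section \<open>Interference equations in a chart\<close>

text \<open>By bilinearity it suffices to test the columns that span the two subspaces.\<close>

lemma feasible_iff:
  assumes "X \<in> stief"
  shows "strat X \<in> feasible K d M N h \<longleftrightarrow> (\<forall>i<K. \<forall>j<K. i \<noteq> j \<longrightarrow> (\<forall>k<d i. \<forall>l<d j.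
    (\<Sum>a<N i. \<Sum>b<M j. X (True, i, a, k) * h (i, j, a, b) * X (False, j, b, l)) = 0))" (is "_ \<longleftrightarrow> ?R")
proof
  assume F: "strat X \<in> feasible K d M N h"
  show ?R
  proof (intro allI impI)
    fix i j k l assume ij: "i < K" "j < K" "i \<noteq> j" and k: "k < d i" and l: "l < d j"
    let ?v = "\<lambda>a. if a < N i then X (True, i, a, k) else 0"
    let ?u = "\<lambda>a. if a < M j then X (False, j, a, l) else 0"
    have vu: "?v \<in> snd (strat X) i" "?u \<in> fst (strat X) j"
      using ij k l colspace_column[OF k, of "N i" "\<lambda>a k. X (True, i, a, k)"]
        colspace_column[OF l, of "M j" "\<lambda>a k. X (False, j, a, k)"] by (auto simp: strat_of_def)
    have "\<forall>v\<in>snd (strat X) i. \<forall>u\<in>fst (strat X) j. (\<Sum>a<N i. \<Sum>b<M j. v a * h (i, j, a, b) * u b) = 0"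
      using F ij by (auto simp: feasible_def case_prod_unfold)
    from bspec[OF bspec[OF this vu(1)] vu(2)] show "(\<Sum>a<N i. \<Sum>b<M j. X (True, i, a, k) * h (i, j, a, b) * X (False, j, b, l)) = 0" by simp
  qed
next
  assume R: ?R
  have "(\<Sum>a<N i. \<Sum>b<M j. v a * h (i, j, a, b) * u b) = 0"
    if ij: "i < K" "j < K" "i \<noteq> j" and v: "v \<in> snd (strat X) i" and u: "u \<in> fst (strat X) j" for i j u v
  proof -
    obtain c where c: "v = (\<lambda>a. if a < N i then (\<Sum>k<d i. c k * X (True, i, a, k)) else 0)"
      using v ij by (auto simp: strat_of_def colspace_def)
    obtain e where e: "u = (\<lambda>a. if a < M j then (\<Sum>k<d j. e k * X (False, j, a, k)) else 0)"
      using u ij by (auto simp: strat_of_def colspace_def)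
    have "(\<Sum>a<N i. \<Sum>b<M j. v a * h (i, j, a, b) * u b)
        = (\<Sum>a<N i. \<Sum>b<M j. \<Sum>k<d i. \<Sum>l<d j. c k * e l * (X (True, i, a, k) * h (i, j, a, b) * X (False, j, b, l)))"
      unfolding c e by (intro sum.cong refl) (simp add: sum_distrib_left sum_distrib_right ac_simps)
    also have "\<dots> = (\<Sum>a<N i. \<Sum>k<d i. \<Sum>l<d j. \<Sum>b<M j. c k * e l * (X (True, i, a, k) * h (i, j, a, b) * X (False, j, b, l)))"
      by (rule sum.cong[OF refl], subst sum.swap, rule sum.cong[OF refl], rule sum.swap)
    also have "\<dots> = (\<Sum>k<d i. \<Sum>l<d j. \<Sum>a<N i. \<Sum>b<M j. c k * e l * (X (True, i, a, k) * h (i, j, a, b) * X (False, j, b, l)))"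
      by (subst sum.swap, rule sum.cong[OF refl], rule sum.swap)
    also have "\<dots> = (\<Sum>k<d i. \<Sum>l<d j. c k * e l * (\<Sum>a<N i. \<Sum>b<M j. X (True, i, a, k) * h (i, j, a, b) * X (False, j, b, l)))"
      by (simp add: sum_distrib_left)
    also have "\<dots> = 0" using R ij by simp
    finally show ?thesis .
  qed
  then show "strat X \<in> feasible K d M N h"
    using strat_grass_prod[OF assms] by (cases "strat X") (auto simp: feasible_def)
qed

definition hvars :: "(sidx + hidx) set" where
  "hvars = Inr ` {(i, j, a, b). i < K \<and> j < K \<and> i \<noteq> j \<and> a < N i \<and> b < M j}"

definition eqns :: "nat set \<Rightarrow> hidx set" where
  "eqns A = (SIGMA i:A. SIGMA j:A - {i}. {..<d i} \<times> {..<d j})"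

text \<open>The channel entry at the two pivot rows belonging to columns \<open>k\<close> and
  \<open>l\<close>. Identity blocks on both sides make its coefficient one in its own equation and
  zero in the other equations for the same pair of users.\<close>

definition pivot :: "(bool \<times> nat \<Rightarrow> nat \<Rightarrow> nat) \<Rightarrow> hidx \<Rightarrow> sidx + hidx" where
  "pivot \<rho> = (\<lambda>(i, j, k, l). Inr (i, j, \<rho> (True, i) k, \<rho> (False, j) l))"

definition vars :: "(bool \<times> nat \<Rightarrow> nat \<Rightarrow> nat) \<Rightarrow> nat set \<Rightarrow> (sidx + hidx) set" where
  "vars \<rho> A = yvars \<rho> A \<union> hvars"

definition params :: "(bool \<times> nat \<Rightarrow> nat \<Rightarrow> nat) \<Rightarrow> nat set \<Rightarrow> (sidx + hidx) set" where
  "params \<rho> A = vars \<rho> A - pivot \<rho> ` eqns A"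

text \<open>The inverse images recover the columns \<open>k\<close> and \<open>l\<close> from the
  pivot rows. Entries with both indices in pivot rows are left out of the sum, so no pivot entry is
  expressed through another one.\<close>

definition solve :: "(bool \<times> nat \<Rightarrow> nat \<Rightarrow> nat) \<Rightarrow> sidx + hidx \<Rightarrow> (sidx + hidx \<Rightarrow> complex) \<Rightarrow> complex" where
  "solve \<rho> u x = (case u of Inl _ \<Rightarrow> 0 | Inr (i, j, a0, b0) \<Rightarrow>
     - (\<Sum>(a, b)\<in>{..<N i} \<times> {..<M j} - rows \<rho> True i \<times> rows \<rho> False j.
         sect \<rho> x (True, i, a, inv_into {..<d i} (\<rho> (True, i)) a0) * x (Inr (i, j, a, b)) *
         sect \<rho> x (False, j, b, inv_into {..<d j} (\<rho> (False, j)) b0)))"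

definition bil :: "(bool \<times> nat \<Rightarrow> nat \<Rightarrow> nat) \<Rightarrow> (sidx + hidx \<Rightarrow> complex) \<Rightarrow> hidx \<Rightarrow> complex" where
  "bil \<rho> x = (\<lambda>(i, j, k, l). \<Sum>a<N i. \<Sum>b<M j.
     sect \<rho> x (True, i, a, k) * x (Inr (i, j, a, b)) * sect \<rho> x (False, j, b, l))"

lemma finite_yvars: "finite A \<Longrightarrow> finite (yvars \<rho> A)"
proof -
  assume "finite A"
  have "{(b, i, a, k). i \<in> A \<and> a \<in> {..<nn b i} - rows \<rho> b i \<and> k < d i}
      = (SIGMA b:UNIV. SIGMA i:A. SIGMA a:{..<nn b i} - rows \<rho> b i. {..<d i})" by auto
  then show ?thesis unfolding yvars_def using \<open>finite A\<close> by (auto intro!: finite_SigmaI)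
qed

lemma finite_hvars: "finite hvars"
proof -
  have "{(i, j, a, b). i < K \<and> j < K \<and> i \<noteq> j \<and> a < N i \<and> b < M j}
      \<subseteq> (SIGMA i:{..<K}. SIGMA j:{..<K}. {..<N i} \<times> {..<M j})" by auto
  then have "finite {(i, j, a, b). i < K \<and> j < K \<and> i \<noteq> j \<and> a < N i \<and> b < M j}"
    by (rule finite_subset) auto
  then show ?thesis by (simp add: hvars_def)
qed

lemma pivot_hvars:
  assumes "\<rho> \<in> charts" "A \<subseteq> {..<K}"
  shows "pivot \<rho> ` eqns A \<subseteq> hvars"
proof
  fix v assume "v \<in> pivot \<rho> ` eqns A"
  then obtain i j k l where v: "v = Inr (i, j, \<rho> (True, i) k, \<rho> (False, j) l)" "i \<in> A" "j \<in> A" "i \<noteq> j" "k < d i" "l < d j"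
    by (auto simp: pivot_def eqns_def)
  have ij: "i < K" "j < K" using v assms(2) by auto
  have "\<rho> (True, i) k < N i" "\<rho> (False, j) l < M j"
    using chartD(2)[OF assms(1) ij(1) v(5), of True] chartD(2)[OF assms(1) ij(2) v(6), of False]
    by (simp_all add: nn_def)
  with ij v show "v \<in> hvars" by (simp add: hvars_def)
qed

lemma inj_pivot:
  assumes "\<rho> \<in> charts" "A \<subseteq> {..<K}"
  shows "inj_on (pivot \<rho>) (eqns A)"
proof (rule inj_onI)
  fix e e' assume mem: "e \<in> eqns A" "e' \<in> eqns A" and eq: "pivot \<rho> e = pivot \<rho> e'"
  obtain i j k l where e1: "e = (i, j, k, l)" by (cases e)
  obtain i' j' k' l' where e1': "e' = (i', j', k', l')" by (cases e')
  have e: "e = (i, j, k, l)" "i \<in> A" "j \<in> A" "k < d i" "l < d j"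
    and e': "e' = (i', j', k', l')" "k' < d i'" "l' < d j'"
    using mem by (auto simp: eqns_def e1 e1')
  have ij: "i < K" "j < K" using e assms(2) by auto
  from eq e e' chart_inj[OF assms(1) ij(1), of k k' True] chart_inj[OF assms(1) ij(2), of l l' False]
  show "e = e'" by (auto simp: pivot_def)
qed

text \<open>The double sum is split by whether both rows are pivot rows. On that block the identity
  matrices leave the single pivot entry; the rest of the sum is the solved expression.\<close>

lemma bil_solve:
  assumes \<rho>: "\<rho> \<in> charts" and A: "A \<subseteq> {..<K}" and e: "e \<in> eqns A"
  shows "bil \<rho> x e = x (pivot \<rho> e) - solve \<rho> (pivot \<rho> e) x"
proof -
  obtain i j k l where e': "e = (i, j, k, l)" "i \<in> A" "j \<in> A" "i \<noteq> j" "k < d i" "l < d j"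
    using e by (auto simp: eqns_def)
  have ij: "i < K" "j < K" using e' A by auto
  let ?R = "rows \<rho> True i \<times> rows \<rho> False j" and ?T = "{..<N i} \<times> {..<M j}"
  let ?t = "\<lambda>(a, b). sect \<rho> x (True, i, a, k) * x (Inr (i, j, a, b)) * sect \<rho> x (False, j, b, l)"
  have R: "?R \<subseteq> ?T" using rows(1)[OF \<rho> ij(1), of True] rows(1)[OF \<rho> ij(2), of False] by (auto simp: nn_def)
  have finT: "finite ?T" by simp
  have "bil \<rho> x e = sum ?t ?T" by (simp add: bil_def e' sum.cartesian_product)
  also have "\<dots> = sum ?t (?T - ?R) + sum ?t ?R" by (rule sum.subset_diff[OF R finT])
  also have "sum ?t ?R = (\<Sum>p\<in>?R. if p = (\<rho> (True, i) k, \<rho> (False, j) l) then x (pivot \<rho> e) else 0)"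
  proof (rule sum.cong[OF refl])
    fix p assume p: "p \<in> ?R"
    then have "fst p < nn True i" "snd p < nn False j" using R by (auto simp: nn_def)
    with p ij e' show "?t p = (if p = (\<rho> (True, i) k, \<rho> (False, j) l) then x (pivot \<rho> e) else 0)"
      by (cases p) (simp add: sect_def pivot_def)
  qed
  also have "\<dots> = x (pivot \<rho> e)"
    using e' finite_subset[OF R finT] by (simp add: sum.delta rows_def)
  also have "sum ?t (?T - ?R) = - solve \<rho> (pivot \<rho> e) x"
    using e' chartD(1)[OF \<rho> ij(1), of True] chartD(1)[OF \<rho> ij(2), of False]
    by (simp add: solve_def pivot_def inv_into_f_f)
  finally show ?thesis by simp
qed

text \<open>The solved expression uses only chart coordinates and channel entries outside the pivot
  block, and none of these is a pivot of any equation. The system is therefore solved explicitly,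
  without recursion.\<close>

lemma graph_vars:
  assumes \<rho>: "\<rho> \<in> charts" and A: "A \<subseteq> {..<K}"
  shows "graph (vars \<rho> A) (params \<rho> A) (solve \<rho>)"
proof
  show "finite (vars \<rho> A)" unfolding vars_def
    using finite_yvars[OF finite_subset[OF A]] finite_hvars by simp
  show "params \<rho> A \<subseteq> vars \<rho> A" by (auto simp: params_def)
  fix u assume "u \<in> vars \<rho> A - params \<rho> A"
  then obtain i j k l where u: "u = Inr (i, j, \<rho> (True, i) k, \<rho> (False, j) l)" "i \<in> A" "j \<in> A" "i \<noteq> j"
    by (auto simp: params_def pivot_def eqns_def)
  have ij: "i < K" "j < K" using u A by auto
  have Y: "yvars \<rho> A \<subseteq> params \<rho> A"
    using pivot_hvars[OF \<rho> A] by (auto simp: params_def vars_def yvars_def hvars_def)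
  have sect: "(\<lambda>x. sect \<rho> x (b, i', a, k)) \<in> polyon (params \<rho> A)" if "i' \<in> A" for b i' a k
    by (rule polyon_mono[OF sect_polyon[OF that] Y])
  have coord: "(\<lambda>x. x (Inr (i, j, a, b))) \<in> polyon (params \<rho> A)"
    if "(a, b) \<in> {..<N i} \<times> {..<M j} - rows \<rho> True i \<times> rows \<rho> False j" for a b
  proof (rule polyon.coord)
    have "Inr (i, j, a, b) \<notin> pivot \<rho> ` eqns A" using that by (auto simp: pivot_def eqns_def rows_def)
    then show "Inr (i, j, a, b) \<in> params \<rho> A"
      using that ij u(4) by (auto simp: params_def vars_def hvars_def)
  qed
  have eq: "solve \<rho> u = (\<lambda>x. - (\<Sum>p\<in>{..<N i} \<times> {..<M j} - rows \<rho> True i \<times> rows \<rho> False j.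
      sect \<rho> x (True, i, fst p, inv_into {..<d i} (\<rho> (True, i)) (\<rho> (True, i) k)) * x (Inr (i, j, fst p, snd p)) *
      sect \<rho> x (False, j, snd p, inv_into {..<d j} (\<rho> (False, j)) (\<rho> (False, j) l))))"
    by (simp add: solve_def u case_prod_unfold fun_eq_iff)
  show "solve \<rho> u \<in> polyon (params \<rho> A)" unfolding eq
    by (intro polyon_uminus polyon_sum polyon.mult sect[OF u(2)] sect[OF u(3)] coord) simp
qed

lemma graph_X_iff:
  assumes \<rho>: "\<rho> \<in> charts" and A: "A \<subseteq> {..<K}"
  shows "x \<in> graph.X (vars \<rho> A) (params \<rho> A) (solve \<rho>) \<longleftrightarrow> (\<forall>e\<in>eqns A. bil \<rho> x e = 0)"
proof -
  have "vars \<rho> A - params \<rho> A = pivot \<rho> ` eqns A"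
    using pivot_hvars[OF \<rho> A] by (auto simp: params_def vars_def)
  then show ?thesis
    unfolding graph.X_def[OF graph_vars[OF \<rho> A]] by (auto simp: bil_solve[OF \<rho> A])
qed

lemma feasible_sect_iff:
  assumes "\<rho> \<in> charts" "\<And>u. u \<in> hvars \<Longrightarrow> x u = case_sum (\<lambda>_. 0) h u"
  shows "strat (sect \<rho> x) \<in> feasible K d M N h \<longleftrightarrow> (\<forall>e\<in>eqns {..<K}. bil \<rho> x e = 0)"
proof -
  have h: "h (i, j, a, b) = x (Inr (i, j, a, b))" if "i < K" "j < K" "i \<noteq> j" "a < N i" "b < M j" for i j a b
    using assms(2)[of "Inr (i, j, a, b)"] that by (simp add: hvars_def)
  have "(\<forall>e\<in>eqns {..<K}. bil \<rho> x e = 0) \<longleftrightarrow> (\<forall>i<K. \<forall>j<K. i \<noteq> j \<longrightarrow> (\<forall>k<d i. \<forall>l<d j. bil \<rho> x (i, j, k, l) = 0))"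
    by (auto simp: eqns_def)
  moreover have "bil \<rho> x (i, j, k, l)
      = (\<Sum>a<N i. \<Sum>b<M j. sect \<rho> x (True, i, a, k) * h (i, j, a, b) * sect \<rho> x (False, j, b, l))"
    if "i < K" "j < K" "i \<noteq> j" for i j k l
    unfolding bil_def prod.case using that by (intro sum.cong refl) (simp add: h)
  ultimately show ?thesis unfolding feasible_iff[OF sect_stief[OF assms(1)]] by auto
qed

text \<open>A chart of G(d, n) has d (n - d) free entries, and each equation removes its own channel
  entry.\<close>

lemma card_params:
  assumes \<rho>: "\<rho> \<in> charts" and A: "A \<subseteq> {..<K}"
  shows "int (card (params \<rho> A)) = int (card hvars) + tA d M N A"
proof -
  have finA: "finite A" using A finite_subset by blast
  have dn: "d i \<le> nn b i" if "i \<in> A" for b i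
    using card_mono[OF _ rows(1)[OF \<rho>, of i b]] rows(2)[OF \<rho>, of i b] that A by auto
  have "{(b, i, a, k). i \<in> A \<and> a \<in> {..<nn b i} - rows \<rho> b i \<and> k < d i}
      = (SIGMA b:UNIV. SIGMA i:A. ({..<nn b i} - rows \<rho> b i) \<times> {..<d i})" by auto
  then have "card (yvars \<rho> A) = (\<Sum>b\<in>UNIV. \<Sum>i\<in>A. card (({..<nn b i} - rows \<rho> b i) \<times> {..<d i}))"
    unfolding yvars_def using finA by (simp add: card_image card_SigmaI)
  also have "\<dots> = (\<Sum>b\<in>UNIV. \<Sum>i\<in>A. (nn b i - d i) * d i)"
    using A by (intro sum.cong refl) (auto simp: card_cartesian_product card_free[OF \<rho>])
  also have "int \<dots> = (\<Sum>b\<in>UNIV. \<Sum>i\<in>A. int (d i) * (int (nn b i) - int (d i)))"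
    unfolding of_nat_sum using dn by (intro sum.cong refl) (simp add: of_nat_diff)
  also have "\<dots> = (\<Sum>i\<in>A. int (d i) * (int (N i) - int (d i)) + int (d i) * (int (M i) - int (d i)))"
    by (simp add: UNIV_bool nn_def sum.distrib)
  finally have Y: "int (card (yvars \<rho> A)) = (\<Sum>i\<in>A. int (d i) * (int (N i) - int (d i)) + int (d i) * (int (M i) - int (d i)))" .
  have "card (pivot \<rho> ` eqns A) = card (eqns A)" by (rule card_image[OF inj_pivot[OF \<rho> A]])
  also have "\<dots> = (\<Sum>i\<in>A. \<Sum>j\<in>A-{i}. d i * d j)"
    unfolding eqns_def using finA by (simp add: card_SigmaI card_cartesian_product)
  finally have E: "int (card (pivot \<rho> ` eqns A)) = (\<Sum>i\<in>A. \<Sum>j\<in>A-{i}. int (d i) * int (d j))" by simp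
  have "card (vars \<rho> A) = card (yvars \<rho> A) + card hvars"
    unfolding vars_def using finite_yvars[OF finA] finite_hvars
    by (intro card_Un_disjoint) (auto simp: yvars_def hvars_def)
  moreover have sub: "pivot \<rho> ` eqns A \<subseteq> vars \<rho> A" using pivot_hvars[OF \<rho> A] by (auto simp: vars_def)
  have finV: "finite (vars \<rho> A)" using finite_yvars[OF finA] finite_hvars by (simp add: vars_def)
  have "card (params \<rho> A) + card (pivot \<rho> ` eqns A) = card (vars \<rho> A)"
    unfolding params_def using card_Diff_subset[OF finite_subset[OF sub finV] sub] card_mono[OF finV sub] by simp
  ultimately show ?thesis unfolding tA_def Y[symmetric] E[symmetric] by linarith
qed

section \<open>Calculus of generic properties\<close>

text \<open>Conditions arise as polynomials on the joint space of strategies and channels. A point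
  where \<open>q\<close> is nonzero is truncated to its channel coordinates, which are all that
  \<open>q\<close> sees, to show that the open set is nonempty.\<close>

lemma genericI:
  assumes q: "q \<in> polyon hvars" "\<exists>x. q x \<noteq> 0"
    and Q: "\<And>h. h \<in> chan_space K M N \<Longrightarrow> q (case_sum (\<lambda>_. 0) h) \<noteq> 0 \<Longrightarrow> Q h"
  shows "generic K M N Q"
  unfolding generic_def
proof (intro exI conjI)
  have "(\<lambda>h. q (\<lambda>v. case_sum (\<lambda>_. 0) h v)) \<in> polyon UNIV"
    by (rule polyon_subst[OF q(1)]) (auto simp: hvars_def intro!: polyon.coord)
  then show "{\<lambda>h. q (case_sum (\<lambda>_. 0) h)} \<subseteq> polyfun" using polyon_polyfun by auto
  obtain x where x: "q x \<noteq> 0" using q(2) ..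
  define h where "h u = (if Inr u \<in> hvars then x (Inr u) else 0)" for u
  have "h \<in> chan_space K M N" by (auto simp: chan_space_def h_def hvars_def split: if_splits)
  moreover have "q (case_sum (\<lambda>_. 0) h) = q x"
    by (rule polyon_cong[OF q(1)]) (auto simp: h_def hvars_def)
  ultimately show "{h \<in> chan_space K M N. \<exists>p\<in>{\<lambda>h. q (case_sum (\<lambda>_. 0) h)}. p h \<noteq> 0} \<noteq> {}" using x by auto
qed (use Q in auto)

text \<open>The common witness lies on the line joining the two given channels, hence again in the
  linear space \<open>chan_space\<close>.\<close>

lemma generic_conj:
  assumes "generic K M N Q" "generic K M N R"
  shows "generic K M N (\<lambda>h. Q h \<and> R h)"
proof -
  obtain p x where p: "p \<in> polyfun" "x \<in> chan_space K M N" "p x \<noteq> 0"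
    "\<And>h. h \<in> chan_space K M N \<Longrightarrow> p h \<noteq> 0 \<Longrightarrow> Q h"
    using assms(1) unfolding generic_def by blast
  obtain q y where q: "q \<in> polyfun" "y \<in> chan_space K M N" "q y \<noteq> 0"
    "\<And>h. h \<in> chan_space K M N \<Longrightarrow> q h \<noteq> 0 \<Longrightarrow> R h"
    using assms(2) unfolding generic_def by blast
  from polyon_nonzero_common[of p UNIV q x y, OF polyfun_polyon[OF p(1)] polyfun_polyon[OF q(1)] p(3) q(3)]
  obtain z where z: "p (\<lambda>v. x v + z * (y v - x v)) \<noteq> 0 \<and> q (\<lambda>v. x v + z * (y v - x v)) \<noteq> 0" ..
  have "(\<lambda>v. x v + z * (y v - x v)) \<in> chan_space K M N"
  proof -
    have "i < K \<and> j < K \<and> i \<noteq> j \<and> a < N i \<and> b < M j"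
      if "x (i, j, a, b) + z * (y (i, j, a, b) - x (i, j, a, b)) \<noteq> 0" for i j a b
    proof -
      have "x (i, j, a, b) \<noteq> 0 \<or> y (i, j, a, b) \<noteq> 0" using that by auto
      then show ?thesis using p(2) q(2) unfolding chan_space_def by blast
    qed
    then show ?thesis by (auto simp: chan_space_def)
  qed
  with z have "{h \<in> chan_space K M N. \<exists>r\<in>{\<lambda>h. p h * q h}. r h \<noteq> 0} \<noteq> {}" by auto
  moreover have "{\<lambda>h. p h * q h} \<subseteq> polyfun" using polyfun.pf_mult[OF p(1) q(1)] by simp
  moreover have "\<forall>h\<in>chan_space K M N. (\<exists>r\<in>{\<lambda>h. p h * q h}. r h \<noteq> 0) \<longrightarrow> Q h \<and> R h" using p(4) q(4) by simp
  ultimately show ?thesis unfolding generic_def by (intro exI[of _ "{\<lambda>h. p h * q h}"] conjI)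
qed

lemma generic_all:
  assumes "finite I" "\<And>i. i \<in> I \<Longrightarrow> generic K M N (Q i)"
  shows "generic K M N (\<lambda>h. \<forall>i\<in>I. Q i h)"
  using assms
proof (induction I rule: finite_induct)
  case empty
  show ?case by (rule genericI[of "\<lambda>_. 1"]) (auto intro: polyon.const)
next
  case (insert i I)
  then show ?case using generic_conj[of "Q i" "\<lambda>h. \<forall>i\<in>I. Q i h"] by simp
qed

lemma generic_mono:
  "generic K M N Q \<Longrightarrow> (\<And>h. h \<in> chan_space K M N \<Longrightarrow> Q h \<Longrightarrow> R h) \<Longrightarrow> generic K M N R"
  unfolding generic_def by blast

end

section \<open>Krull dimension of the feasible variety\<close>

text \<open>The functions with index below \<open>k\<close> are algebraically independent on
  \<open>W k\<close>. In the induction step the relation is expanded in the last function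
  \<open>f k\<close>, and its lowest power is cancelled on the irreducible set
  \<open>W (Suc k)\<close>. Restriction to \<open>W k\<close>, where \<open>f k\<close> vanishes,
  leaves a relation among the earlier functions.\<close>

lemma chain_independent:
  fixes W :: "nat \<Rightarrow> ('v \<Rightarrow> complex) set" and f :: "nat \<Rightarrow> ('v \<Rightarrow> complex) \<Rightarrow> complex"
  assumes irr: "\<And>k. k \<le> n \<Longrightarrow> irred_on Y (W k)" and W: "\<And>k. k < n \<Longrightarrow> W k \<subseteq> W (Suc k)" "W 0 \<noteq> {}"
    and f: "\<And>k. k < n \<Longrightarrow> f k \<in> polyon Y" "\<And>k x. k < n \<Longrightarrow> x \<in> W k \<Longrightarrow> f k x = 0"
      "\<And>k. k < n \<Longrightarrow> \<exists>x\<in>W (Suc k). f k x \<noteq> 0"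
  shows "k \<le> n \<Longrightarrow> p \<in> polyon {..<k} \<Longrightarrow> \<forall>x\<in>W k. p (\<lambda>i. f i x) = 0 \<Longrightarrow> p w = 0"
proof (induction k arbitrary: p w)
  case 0
  obtain x where "x \<in> W 0" using W(2) by blast
  with 0 have "p (\<lambda>i. f i x) = 0" by blast
  moreover have "p w = p (\<lambda>i. f i x)" by (rule polyon_cong[OF 0(2)]) simp
  ultimately show ?case by simp
next
  case (Suc k)
  have k: "k < n" using Suc.prems(1) by simp
  obtain m a where a: "\<And>j. a j \<in> polyon {..<k}" "\<And>x. p x = (\<Sum>j<m. a j x * x k ^ j)"
    using polyon_expand[of p k "{..<k}"] Suc.prems(2) by (auto simp: lessThan_Suc)
  show ?case
  proof (rule ccontr)
    assume pw: "p w \<noteq> 0"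
    then obtain j1 where j1: "j1 < m" "a j1 w \<noteq> 0"
      unfolding a(2) by (metis (no_types, lifting) lessThan_iff mult_eq_0_iff sum.neutral)
    define j0 where "j0 = (LEAST j. \<exists>w. a j w \<noteq> 0)"
    have ex: "\<exists>w. a j1 w \<noteq> 0" using j1 by blast
    have j0: "\<exists>w. a j0 w \<noteq> 0" "j0 \<le> j1"
      unfolding j0_def using LeastI[of "\<lambda>j. \<exists>w. a j w \<noteq> 0", OF ex] Least_le[of "\<lambda>j. \<exists>w. a j w \<noteq> 0", OF ex] by blast+
    have below: "a j x = 0" if "j < j0" for j x
      using not_less_Least[of j "\<lambda>j. \<exists>w. a j w \<noteq> 0"] that by (auto simp: j0_def)
    define b where "b j x = a j (\<lambda>i. f i x)" for j x
    have b: "(\<lambda>x. b j x) \<in> polyon Y" for j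
      unfolding b_def by (rule polyon_subst[OF a(1)]) (use f(1) k in auto)
    define S where "S x = (\<Sum>i<m-j0. b (j0 + i) x * f k x ^ i)" for x
    have "(\<lambda>x. S x) \<in> polyon Y" unfolding S_def by (intro polyon_intros b f(1)[OF k])
    then have S: "S \<in> polyon Y" by simp
    have "f k x ^ j0 * S x = 0" if "x \<in> W (Suc k)" for x
    proof -
      have "f k x ^ j0 * S x = (\<Sum>i<m-j0. b (j0 + i) x * f k x ^ (j0 + i))"
        by (simp add: S_def sum_distrib_left power_add ac_simps)
      also have "\<dots> = (\<Sum>j\<in>{j0..<m}. b j x * f k x ^ j)"
        by (rule sum.reindex_bij_witness[of _ "\<lambda>j. j - j0" "\<lambda>j. j0 + j"]) auto
      also have "\<dots> = (\<Sum>j<m. b j x * f k x ^ j)"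
        by (rule sum.mono_neutral_left) (auto simp: below b_def)
      also have "\<dots> = 0" using Suc.prems(3) that by (simp add: a(2) b_def)
      finally show ?thesis .
    qed
    moreover have "\<exists>x\<in>W (Suc k). f k x ^ j0 \<noteq> 0" using f(3)[OF k] by auto
    ultimately have S0: "\<forall>x\<in>W (Suc k). S x = 0"
      using irred_onD[OF irr[OF Suc.prems(1)] polyon_power[OF f(1)[OF k]] S] by blast
    have "b j0 x = 0" if x: "x \<in> W k" for x
    proof -
      obtain r where r: "m - j0 = Suc r" using j0(2) j1(1) by (metis Suc_diff_Suc le_less_trans)
      have "S x = b j0 x"
        by (simp add: S_def r f(2)[OF k x] sum.lessThan_Suc_shift del: sum.lessThan_Suc)
      with S0 x W(1)[OF k] show ?thesis by auto
    qed
    then have "a j0 w' = 0" for w'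
      using k by (intro Suc.IH[OF _ a(1)]) (auto simp: b_def)
    with j0(1) show False by blast
  qed
qed

lemma grass_closed_equations:
  assumes "grass_closed K d M N D"
  shows "\<exists>P. P \<subseteq> polyfun \<and> (\<forall>X\<in>stiefel K d M N. strat_of K d M N X \<in> D \<longleftrightarrow> (\<forall>p\<in>P. p X = 0))"
proof -
  obtain P where P: "P \<subseteq> polyfun" "{X \<in> stiefel K d M N. strat_of K d M N X \<in> D} = {X \<in> stiefel K d M N. \<forall>p\<in>P. p X = 0}"
    using assms unfolding grass_closed_def zariski_closed_in_def by blast
  have "strat_of K d M N X \<in> D \<longleftrightarrow> (\<forall>p\<in>P. p X = 0)" if "X \<in> stiefel K d M N" for X
    using arg_cong[OF P(2), of "\<lambda>A. X \<in> A"] that by simp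
  with P(1) show ?thesis by blast
qed

text \<open>Provides Zariski closures of arbitrary subsets; the equations of the intersection are
  all equations of its members.\<close>

lemma grass_closed_Inter:
  assumes "\<D> \<noteq> {}" "\<And>D. D \<in> \<D> \<Longrightarrow> grass_closed K d M N D"
  shows "grass_closed K d M N (\<Inter>\<D>)"
proof -
  let ?S = "stiefel K d M N"
  have "\<forall>D\<in>\<D>. \<exists>P. P \<subseteq> polyfun \<and> (\<forall>X\<in>?S. strat_of K d M N X \<in> D \<longleftrightarrow> (\<forall>p\<in>P. p X = 0))"
    by (rule ballI, rule grass_closed_equations, rule assms(2))
  from bchoice[OF this] obtain P where
    P: "\<forall>D\<in>\<D>. P D \<subseteq> polyfun \<and> (\<forall>X\<in>?S. strat_of K d M N X \<in> D \<longleftrightarrow> (\<forall>p\<in>P D. p X = 0))" ..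
  then have "{X \<in> ?S. strat_of K d M N X \<in> \<Inter>\<D>} = {X \<in> ?S. \<forall>p\<in>(\<Union>D\<in>\<D>. P D). p X = 0}" by auto
  moreover have "(\<Union>D\<in>\<D>. P D) \<subseteq> polyfun" using P by blast
  moreover have "\<Inter>\<D> \<subseteq> grass_prod K d M N" using assms unfolding grass_closed_def by blast
  ultimately show ?thesis unfolding grass_closed_def zariski_closed_in_def by blast
qed

text \<open>The top square block makes \<open>H\<close> injective, so \<open>H\<close> times
  \<open>U\<close> keeps rank \<open>e\<close>; its columns are orthogonal to those of
  \<open>V\<close> in dimension \<open>n\<close>.\<close>

lemma bilinear_bound:
  assumes H: "full_rank m m H" "m \<le> n" and U: "full_rank m e U" and V: "full_rank n f V"
    and orth: "\<And>k l. k < f \<Longrightarrow> l < e \<Longrightarrow> (\<Sum>a<n. \<Sum>b<m. V a k * H a b * U b l) = 0"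
  shows "e + f \<le> n"
proof (rule full_rank_orthogonal[OF _ V])
  show "full_rank n e (\<lambda>a l. \<Sum>b<m. H a b * U b l)"
    unfolding full_rank_def
  proof (intro allI impI)
    fix c l assume c: "\<forall>a<n. (\<Sum>l<e. c l * (\<Sum>b<m. H a b * U b l)) = 0" and l: "l < e"
    have "(\<Sum>b<m. (\<Sum>l<e. c l * U b l) * H a b) = 0" if "a < m" for a
    proof -
      have "(\<Sum>b<m. (\<Sum>l<e. c l * U b l) * H a b) = (\<Sum>l<e. c l * (\<Sum>b<m. H a b * U b l))"
        unfolding sum_distrib_left sum_distrib_right by (subst sum.swap) (simp add: ac_simps)
      with c that H(2) show ?thesis by simp
    qed
    then have "\<forall>b<m. (\<Sum>l<e. c l * U b l) = 0"
      using H(1)[unfolded full_rank_def, THEN spec, of "\<lambda>b. \<Sum>l<e. c l * U b l"] by simp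
    then show "c l = 0" using U l by (simp add: full_rank_def)
  qed
  fix l k assume "l < e" "k < f"
  have "(\<Sum>a<n. (\<Sum>b<m. H a b * U b l) * V a k) = (\<Sum>a<n. \<Sum>b<m. V a k * H a b * U b l)"
    by (simp add: sum_distrib_right sum_distrib_left ac_simps)
  then show "(\<Sum>a<n. (\<Sum>b<m. H a b * U b l) * V a k) = 0"
    using orth[OF \<open>k < f\<close> \<open>l < e\<close>] by simp
qed

context channel
begin

abbreviation pt :: "(hidx \<Rightarrow> complex) \<Rightarrow> sidx + hidx \<Rightarrow> complex" where
  "pt h \<equiv> case_sum (\<lambda>_. 0) h"

abbreviation feas :: "(hidx \<Rightarrow> complex) \<Rightarrow> strat set" where
  "feas h \<equiv> feasible K d M N h"

abbreviation fclosed :: "(hidx \<Rightarrow> complex) \<Rightarrow> strat set \<Rightarrow> bool" where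
  "fclosed h \<equiv> sub_closed (grass_closed K d M N) (feas h)"

abbreviation Y :: "(bool \<times> nat \<Rightarrow> nat \<Rightarrow> nat) \<Rightarrow> (sidx + hidx) set" where
  "Y \<rho> \<equiv> yvars \<rho> {..<K}"

abbreviation GX :: "(bool \<times> nat \<Rightarrow> nat \<Rightarrow> nat) \<Rightarrow> nat set \<Rightarrow> (sidx + hidx \<Rightarrow> complex) set" where
  "GX \<rho> A \<equiv> graph.X (vars \<rho> A) (params \<rho> A) (solve \<rho>)"

definition fibre :: "(bool \<times> nat \<Rightarrow> nat \<Rightarrow> nat) \<Rightarrow> nat set \<Rightarrow> (hidx \<Rightarrow> complex) \<Rightarrow> (sidx + hidx \<Rightarrow> complex) set" where
  "fibre \<rho> A h = {x \<in> GX \<rho> A. \<forall>v\<in>hvars. x v = pt h v}"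

text \<open>Replaces the channel part of a point by \<open>h\<close>. Chart coordinates are disjoint
  from channel coordinates, so the strategy does not change.\<close>

definition adjust :: "(hidx \<Rightarrow> complex) \<Rightarrow> (sidx + hidx \<Rightarrow> complex) \<Rightarrow> sidx + hidx \<Rightarrow> complex" where
  "adjust h x = (\<lambda>v. if v \<in> hvars then pt h v else x v)"

lemma yvars_hvars: "yvars \<rho> A \<inter> hvars = {}"
  by (auto simp: yvars_def hvars_def)

lemma sect_adjust: "sect \<rho> (adjust h x) = sect \<rho> x"
  by (rule sect_cong) (use yvars_hvars in \<open>auto simp: adjust_def\<close>)

lemma adjust_polyon:
  assumes "f \<in> polyon (Y \<rho>)"
  shows "f (adjust h x) = f x"
  by (rule polyon_cong[OF assms]) (use yvars_hvars in \<open>auto simp: adjust_def\<close>)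

lemma polyfun_sect:
  assumes "p \<in> polyfun"
  shows "(\<lambda>x. p (sect \<rho> x)) \<in> polyon (Y \<rho>)"
  using polyon_subst[OF polyfun_polyon[OF assms], of "\<lambda>v x. sect \<rho> x v" "Y \<rho>"] sect_polyon_all by simp

lemma fibre_feasible:
  assumes "\<rho> \<in> charts" "x \<in> fibre \<rho> {..<K} h"
  shows "strat (sect \<rho> x) \<in> feas h"
  using assms feasible_sect_iff[OF assms(1), of x h] graph_X_iff[OF assms(1) subset_refl]
  by (simp add: fibre_def)

lemma adjust_fibre:
  assumes "\<rho> \<in> charts" "strat (sect \<rho> x) \<in> feas h"
  shows "adjust h x \<in> fibre \<rho> {..<K} h"
proof -
  have "adjust h x u = pt h u" if "u \<in> hvars" for u using that by (simp add: adjust_def)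
  then show ?thesis
    using assms feasible_sect_iff[OF assms(1), of "adjust h x" h] graph_X_iff[OF assms(1) subset_refl]
    by (simp add: fibre_def sect_adjust)
qed

lemma feasible_chart:
  assumes "s \<in> feas h"
  obtains \<rho> x where "\<rho> \<in> charts" "x \<in> fibre \<rho> {..<K} h" "s = strat (sect \<rho> x)"
proof -
  have "s \<in> grass_prod K d M N" using assms by (auto simp: feasible_def)
  then obtain \<rho> x where "\<rho> \<in> charts" "s = strat (sect \<rho> x)" by (rule grass_prod_chart)
  with that[of \<rho> "adjust h x"] adjust_fibre[of \<rho> x h] assms show thesis by (simp add: sect_adjust)
qed

lemma sect_inj:
  assumes "\<rho> \<in> charts" "strat (sect \<rho> x) = strat (sect \<rho> y)" "v \<in> Y \<rho>"
  shows "x v = y v"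
proof -
  obtain b i a k where v: "v = Inl (b, i, a, k)" "i < K" "a \<in> {..<nn b i} - rows \<rho> b i" "k < d i"
    using assms(3) by (auto simp: yvars_def)
  show ?thesis
    using coords_unique(2)[OF assms(1) sect_stief[OF assms(1), of x] refl v(2-4)]
      coords_unique(2)[OF assms(1) sect_stief[OF assms(1), of x] assms(2) v(2-4)]
    by (simp add: v(1))
qed

lemma sect_inj_polyon:
  assumes "\<rho> \<in> charts" "strat (sect \<rho> x) = strat (sect \<rho> y)" "f \<in> polyon (Y \<rho>)"
  shows "f x = f y"
  by (rule polyon_cong[OF assms(3)]) (rule sect_inj[OF assms(1,2)])

text \<open>The graph has \<open>tA\<close> more parameters than there are channel entries, so more
  than \<open>tA\<close> chart coordinates together with the channel entries are too many to be
  independent.\<close>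

lemma generic_fibre:
  assumes \<rho>: "\<rho> \<in> charts" and A: "A \<subseteq> {..<K}"
  shows "generic K M N (\<lambda>h. \<forall>T\<subseteq>yvars \<rho> A. tA d M N A < int (card T) \<longrightarrow> \<not> indep_on (fibre \<rho> A h) T)"
proof -
  interpret graph "vars \<rho> A" "params \<rho> A" "solve \<rho>" by (rule graph_vars[OF \<rho> A])
  have H: "hvars \<subseteq> vars \<rho> A" and Yv: "vars \<rho> A - hvars = yvars \<rho> A"
    using yvars_hvars by (auto simp: vars_def)
  obtain q where q: "q \<in> polyon hvars" "\<exists>x. q x \<noteq> 0"
    "\<And>h T. q h \<noteq> 0 \<Longrightarrow> T \<subseteq> yvars \<rho> A \<Longrightarrow> card (params \<rho> A) < card hvars + card T \<Longrightarrow>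
      \<not> indep_on {x \<in> X. \<forall>v\<in>hvars. x v = h v} T"
    using generic_fibre_dependent[OF H] unfolding Yv by blast
  show ?thesis
  proof (rule genericI[OF q(1,2)], intro allI impI)
    fix h T assume h: "q (pt h) \<noteq> 0" and T: "T \<subseteq> yvars \<rho> A" "tA d M N A < int (card T)"
    have "card (params \<rho> A) < card hvars + card T" using card_params[OF \<rho> A] T(2) by linarith
    from q(3)[OF h T(1) this] show "\<not> indep_on (fibre \<rho> A h) T" by (simp add: fibre_def)
  qed
qed

lemma not_indep_empty: "\<not> indep_on X {} \<Longrightarrow> X = {}"
proof (rule ccontr)
  assume "\<not> indep_on X {}" "X \<noteq> {}"
  then obtain p x y where p: "p \<in> polyon {}" "\<forall>x\<in>X. p x = 0" "p y \<noteq> 0" "x \<in> X"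
    by (auto simp: indep_on_def)
  have "p y = p x" by (rule polyon_cong[OF p(1)]) simp
  with p show False by simp
qed

text \<open>If the number is negative, already the empty family of coordinates exceeds it. It is
  then dependent on the fibre for the users in \<open>A\<close>, so that fibre is empty. A feasible
  strategy would give a point there, since the equations within \<open>A\<close> are among those of
  all users.\<close>

lemma generic_tA:
  assumes A: "A \<subseteq> {..<K}"
  shows "generic K M N (\<lambda>h. feas h \<noteq> {} \<longrightarrow> 0 \<le> tA d M N A)"
proof (rule generic_mono[OF generic_all[OF finite_charts generic_fibre[OF _ A]]])
  fix h assume h: "\<forall>\<rho>\<in>charts. \<forall>T\<subseteq>yvars \<rho> A. tA d M N A < int (card T) \<longrightarrow> \<not> indep_on (fibre \<rho> A h) T"
  show "feas h \<noteq> {} \<longrightarrow> 0 \<le> tA d M N A"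
  proof (intro impI, rule ccontr)
    assume "feas h \<noteq> {}" and t: "\<not> 0 \<le> tA d M N A"
    then obtain s where s: "s \<in> feas h" by blast
    obtain \<rho> x where x: "\<rho> \<in> charts" "x \<in> fibre \<rho> {..<K} h" using feasible_chart[OF s] by blast
    have "eqns A \<subseteq> eqns {..<K}" using A by (auto simp: eqns_def)
    then have "x \<in> fibre \<rho> A h"
      using x graph_X_iff[OF x(1) subset_refl] graph_X_iff[OF x(1) A] by (auto simp: fibre_def)
    moreover have "\<not> indep_on (fibre \<rho> A h) {}" using h x(1) t by simp
    ultimately show False using not_indep_empty by blast
  qed
qed

text \<open>A holomorphic parametrization of part of the fibre by a polydisc whose dimension is the
  expected one.\<close>

definition branch :: "(bool \<times> nat \<Rightarrow> nat \<Rightarrow> nat) \<Rightarrow> (hidx \<Rightarrow> complex) \<Rightarrow> bool" where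
  "branch \<rho> h \<longleftrightarrow> (\<exists>S \<epsilon> w0 \<phi>. S \<subseteq> Y \<rho> \<and> int (card S) = tA d M N {..<K} \<and> 0 < \<epsilon> \<and>
     (\<forall>w\<in>polydisc S \<epsilon> w0. \<phi> w \<in> fibre \<rho> {..<K} h \<and> (\<forall>v\<in>S. \<phi> w v = w v)) \<and>
     (\<forall>v\<in>Y \<rho>. line_holo S \<epsilon> w0 (\<lambda>w. \<phi> w v)))"

text \<open>If the channel entries are dependent on the graph, the projection is not dominant. A
  relation among them then excludes generic channels, whose fibres are empty, and the implication is
  vacuous.\<close>

lemma generic_branch_fibre:
  assumes \<rho>: "\<rho> \<in> charts"
  shows "generic K M N (\<lambda>h. fibre \<rho> {..<K} h \<noteq> {} \<longrightarrow> branch \<rho> h)"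
proof -
  interpret graph "vars \<rho> {..<K}" "params \<rho> {..<K}" "solve \<rho>" by (rule graph_vars[OF \<rho> subset_refl])
  have H: "hvars \<subseteq> vars \<rho> {..<K}" and Yv: "vars \<rho> {..<K} - hvars = Y \<rho>"
    using yvars_hvars by (auto simp: vars_def)
  show ?thesis
  proof (cases "indep_on X hvars")
    case True
    obtain q where q: "q \<in> polyon hvars" "\<exists>x. q x \<noteq> 0"
      "\<forall>h. q h \<noteq> 0 \<longrightarrow> (\<exists>S \<epsilon> w0 \<phi>. S \<subseteq> Y \<rho> \<and> card hvars + card S = card (params \<rho> {..<K}) \<and> 0 < \<epsilon> \<and> (\<forall>v\<in>hvars. w0 v = h v) \<and>
      (\<forall>w\<in>polydisc S \<epsilon> w0. \<phi> w \<in> X \<and> (\<forall>v\<in>hvars \<union> S. \<phi> w v = w v)) \<and>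
      (\<forall>v\<in>vars \<rho> {..<K}. line_holo S \<epsilon> w0 (\<lambda>w. \<phi> w v)))"
      using generic_branch[OF H True] unfolding Yv by auto
    show ?thesis
    proof (rule genericI[OF q(1,2)], intro impI)
      fix h assume h: "q (pt h) \<noteq> 0"
      obtain S \<epsilon> w0 \<phi> where S: "S \<subseteq> Y \<rho>" "card hvars + card S = card (params \<rho> {..<K})" "0 < \<epsilon>" "\<forall>v\<in>hvars. w0 v = pt h v"
        "\<forall>w\<in>polydisc S \<epsilon> w0. \<phi> w \<in> X \<and> (\<forall>v\<in>hvars \<union> S. \<phi> w v = w v)"
        "\<forall>v\<in>vars \<rho> {..<K}. line_holo S \<epsilon> w0 (\<lambda>w. \<phi> w v)"
        using q(3)[rule_format, OF h] by auto
      show "branch \<rho> h" unfolding branch_def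
      proof (rule exI[of _ S], rule exI[of _ \<epsilon>], rule exI[of _ w0], rule exI[of _ \<phi>], intro conjI ballI)
        show "S \<subseteq> Y \<rho>" "0 < \<epsilon>" by fact+
        show "int (card S) = tA d M N {..<K}" using card_params[OF \<rho> subset_refl] S(2) by linarith
        fix w assume w: "w \<in> polydisc S \<epsilon> w0"
        have "\<phi> w v = pt h v" if v: "v \<in> hvars" for v
        proof -
          have "v \<notin> S" using v S(1) yvars_hvars by blast
          then have "w v = w0 v" using w by (simp add: polydisc_def)
          with S(4,5) w v show ?thesis by simp
        qed
        then show "\<phi> w \<in> fibre \<rho> {..<K} h" using S(5) w by (simp add: fibre_def)
        show "\<phi> w v = w v" if "v \<in> S" for v using S(5) w that by blast
      next
        show "line_holo S \<epsilon> w0 (\<lambda>w. \<phi> w v)" if "v \<in> Y \<rho>" for v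
          using S(6) that by (auto simp: vars_def)
      qed
    qed
  next
    case False
    then obtain q x where q: "q \<in> polyon hvars" "\<forall>x\<in>X. q x = 0" "q x \<noteq> 0" by (auto simp: indep_on_def)
    have "fibre \<rho> {..<K} h = {}" if h: "q (pt h) \<noteq> 0" for h
    proof (rule ccontr)
      assume "fibre \<rho> {..<K} h \<noteq> {}"
      then obtain y where y: "y \<in> X" "\<forall>v\<in>hvars. y v = pt h v" by (auto simp: fibre_def)
      have "q y = q (pt h)" by (rule polyon_cong[OF q(1)]) (use y in auto)
      with q(2) y(1) h show False by simp
    qed
    then show ?thesis by (intro genericI[OF q(1)]) (use q(3) in auto)
  qed
qed

section \<open>Upper bound for chains of irreducible closed sets\<close>

text \<open>The chart is taken around a point of the smallest member \<open>Z 0\<close>, so it meets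
  every member. The traces \<open>W k\<close> in this one chart stay irreducible and strictly
  increasing, and functions separating consecutive traces are algebraically independent.\<close>

lemma chain_length_le:
  assumes ind: "\<And>\<rho> T. \<rho> \<in> charts \<Longrightarrow> T \<subseteq> Y \<rho> \<Longrightarrow> indep_on (fibre \<rho> {..<K} h) T \<Longrightarrow> card T \<le> t"
    and Z: "\<And>k. k \<le> n \<Longrightarrow> irreducible_closed (fclosed h) (Z k)"
      "\<And>k. k < n \<Longrightarrow> Z k \<subset> Z (Suc k)"
  shows "n \<le> t"
proof -
  define cl where "cl = fclosed h"
  have irr: "A \<in> Collect cl \<Longrightarrow> B \<in> Collect cl \<Longrightarrow> Z k \<subseteq> A \<union> B \<Longrightarrow> Z k \<subseteq> A \<or> Z k \<subseteq> B" if "k \<le> n" for k A B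
    using Z(1)[OF that] unfolding irreducible_closed_def cl_def by blast
  have clI: "feas h \<inter> D \<in> Collect cl" if "grass_closed K d M N D" for D
    using that by (auto simp: cl_def sub_closed_def)
  have Zcl: "\<exists>D. grass_closed K d M N D \<and> Z k = feas h \<inter> D" if "k \<le> n" for k
    using Z(1)[OF that] by (simp add: irreducible_closed_def sub_closed_def)
  obtain s0 where s0: "s0 \<in> Z 0" using Z(1)[of 0] by (auto simp: irreducible_closed_def)
  have ZF: "Z k \<subseteq> feas h" if "k \<le> n" for k using Zcl[OF that] by blast
  obtain \<rho> x0 where \<rho>: "\<rho> \<in> charts" and x0: "x0 \<in> fibre \<rho> {..<K} h" "s0 = strat (sect \<rho> x0)"
    using feasible_chart s0 ZF[of 0] by blast
  have Z0: "Z 0 \<subseteq> Z k" if "k \<le> n" for k using that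
    by (induction k) (use Z(2) in \<open>auto simp: Suc_le_eq\<close>)
  define W where "W k = {x \<in> fibre \<rho> {..<K} h. strat (sect \<rho> x) \<in> Z k}" for k
  define C where "C f = {s \<in> grass_prod K d M N. \<forall>x. s = strat (sect \<rho> x) \<longrightarrow> f x = 0}"
    for f :: "(sidx + hidx \<Rightarrow> complex) \<Rightarrow> complex"
  have C: "feas h \<inter> C f \<in> Collect cl" if "f \<in> polyon (Y \<rho>)" for f
    unfolding C_def by (rule clI[OF chart_complement_closed[OF \<rho> that]])
  have notC: "\<exists>x. s = strat (sect \<rho> x) \<and> f x \<noteq> 0" if "s \<in> feas h" "s \<notin> C f" for s f
    using that by (auto simp: C_def feasible_def)
  have adjW: "adjust h x \<in> W k" if "strat (sect \<rho> x) \<in> Z k" "k \<le> n" for x k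
    using that adjust_fibre[OF \<rho>, of x h] ZF[OF that(2)] by (auto simp: W_def sect_adjust)
  have irrW: "irred_on (Y \<rho>) (W k)" if k: "k \<le> n" for k
    unfolding irred_on_def
  proof (intro ballI impI)
    fix f g assume f: "f \<in> polyon (Y \<rho>)" and g: "g \<in> polyon (Y \<rho>)" and fg: "\<forall>x\<in>W k. f x * g x = 0"
    have "Z k \<subseteq> (feas h \<inter> C f) \<union> (feas h \<inter> C g)"
    proof (rule ccontr)
      assume "\<not> ?thesis"
      then obtain s where s: "s \<in> Z k" "s \<in> feas h" "s \<notin> C f" "s \<notin> C g" using ZF[OF k] by blast
      obtain x where x: "s = strat (sect \<rho> x)" "f x \<noteq> 0" using notC[OF s(2,3)] by blast
      obtain y where y: "s = strat (sect \<rho> y)" "g y \<noteq> 0" using notC[OF s(2,4)] by blast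
      have "g x = g y" by (rule sect_inj_polyon[OF \<rho> _ g]) (use x y in simp)
      then have "f (adjust h x) * g (adjust h x) \<noteq> 0"
        using x(2) y(2) by (simp add: adjust_polyon[OF f] adjust_polyon[OF g])
      moreover have "adjust h x \<in> W k" using adjW[OF _ k] s(1) x(1) by simp
      ultimately show False using fg by blast
    qed
    from irr[OF k C[OF f] C[OF g] this] have "Z k \<subseteq> C f \<or> Z k \<subseteq> C g" by blast
    then show "(\<forall>x\<in>W k. f x = 0) \<or> (\<forall>x\<in>W k. g x = 0)" by (auto simp: W_def C_def)
  qed
  have "\<exists>f. f \<in> polyon (Y \<rho>) \<and> (\<forall>x\<in>W k. f x = 0) \<and> (\<exists>x\<in>W (Suc k). f x \<noteq> 0)" if k: "k < n" for k
  proof -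
    have k': "k \<le> n" "Suc k \<le> n" using k by auto
    obtain D where D: "grass_closed K d M N D" "Z k = feas h \<inter> D" using Zcl[OF k'(1)] by blast
    have one: "(\<lambda>_. 1) \<in> polyon (Y \<rho>)" by (rule polyon.const)
    \<comment> \<open>\<open>Z (Suc k)\<close> is irreducible, strictly larger than
      \<open>Z k\<close>, and meets the chart at \<open>s0\<close>. Hence it has a point in the
      chart outside \<open>Z k\<close>, and strictness survives in the chart.\<close>
    have "\<not> Z (Suc k) \<subseteq> (feas h \<inter> D) \<union> (feas h \<inter> C (\<lambda>_. 1))"
    proof
      assume "Z (Suc k) \<subseteq> (feas h \<inter> D) \<union> (feas h \<inter> C (\<lambda>_. 1))"
      from irr[OF k'(2) clI[OF D(1)] C[OF one] this] have "Z (Suc k) \<subseteq> Z k \<or> Z (Suc k) \<subseteq> C (\<lambda>_. 1)"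
        using D(2) by blast
      moreover have "s0 \<notin> C (\<lambda>_. 1)" using x0 by (auto simp: C_def)
      ultimately show False using Z(2)[OF k] Z0[OF k'(2)] s0 by blast
    qed
    then obtain s where s: "s \<in> Z (Suc k)" "s \<in> feas h" "s \<notin> D" "s \<notin> C (\<lambda>_. 1)"
      using ZF[OF k'(2)] by blast
    obtain x where x: "s = strat (sect \<rho> x)" using notC[OF s(2,4)] by blast
    obtain P where P: "P \<subseteq> polyfun" and PD: "\<And>X. X \<in> stief \<Longrightarrow> strat X \<in> D \<longleftrightarrow> (\<forall>p\<in>P. p X = 0)"
      using grass_closed_equations[OF D(1)] by blast
    obtain p where p: "p \<in> P" "p (sect \<rho> x) \<noteq> 0"
      using PD[OF sect_stief[OF \<rho>, of x]] s(3) x by auto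
    have "(\<lambda>x. p (sect \<rho> x)) \<in> polyon (Y \<rho>)" using p(1) P by (intro polyfun_sect) blast
    moreover have "\<forall>x\<in>W k. p (sect \<rho> x) = 0"
      using PD[OF sect_stief[OF \<rho>]] p(1) D(2) by (auto simp: W_def)
    moreover have "adjust h x \<in> W (Suc k)" using adjW[OF _ k'(2)] s(1) x by simp
    then have "\<exists>x\<in>W (Suc k). p (sect \<rho> x) \<noteq> 0"
      using p(2) by (intro bexI[of _ "adjust h x"]) (simp_all add: sect_adjust)
    ultimately show ?thesis by (intro exI[of _ "\<lambda>x. p (sect \<rho> x)"] conjI)
  qed
  then have "\<forall>k\<in>{..<n}. \<exists>f. f \<in> polyon (Y \<rho>) \<and> (\<forall>x\<in>W k. f x = 0) \<and> (\<exists>x\<in>W (Suc k). f x \<noteq> 0)" by simp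
  from bchoice[OF this] obtain f where
    f: "\<forall>k\<in>{..<n}. f k \<in> polyon (Y \<rho>) \<and> (\<forall>x\<in>W k. f k x = 0) \<and> (\<exists>x\<in>W (Suc k). f k x \<noteq> 0)" ..
  have fY: "f k \<in> polyon (Y \<rho>)" and f0: "x \<in> W k \<Longrightarrow> f k x = 0" and fS: "\<exists>x\<in>W (Suc k). f k x \<noteq> 0" if "k < n" for k x
    using f that by blast+
  have W0: "x0 \<in> W k" if "k \<le> n" for k using x0 Z0[OF that] s0 by (auto simp: W_def)
  have fin: "finite (Y \<rho>)" by (rule finite_yvars) simp
  have indep0: "indep_on (W n) {}" using not_indep_empty W0[of n] by blast
  have ne: "W n \<noteq> {}" using W0[of n] by blast
  \<comment> \<open>A transcendence basis of the top trace is also independent on the larger fibre,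
    to which the assumed bound applies.\<close>
  obtain B where "{} \<subseteq> B" and B: "B \<subseteq> Y \<rho>" "indep_on (W n) B" "\<And>v. v \<in> Y \<rho> \<Longrightarrow> algebraic_on (W n) B v"
    by (rule exists_basis[OF fin ne empty_subsetI indep0]) (rule that, assumption+)
  have "W n \<subseteq> fibre \<rho> {..<K} h" by (auto simp: W_def)
  then have "indep_on (fibre \<rho> {..<K} h) B" using B(2) unfolding indep_on_def by blast
  then have cardB: "card B \<le> t" using ind[OF \<rho> B(1)] by blast
  show "n \<le> t"
  proof (rule ccontr)
    assume "\<not> n \<le> t"
    then have "\<exists>p\<in>polyon {..<n}. (\<exists>w. p w \<noteq> 0) \<and> (\<forall>x\<in>W n. p (\<lambda>u. f u x) = 0)"
      using cardB by (intro dependent_of_algebraic[OF irrW[OF order_refl] fin B(1,3)] fY) auto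
    then obtain p w where p: "p \<in> polyon {..<n}" "p w \<noteq> 0" "\<forall>x\<in>W n. p (\<lambda>u. f u x) = 0" by blast
    have "p w = 0"
    proof (rule chain_independent[of n "Y \<rho>" W f n p w])
      show "W k \<subseteq> W (Suc k)" if "k < n" for k using Z(2)[OF that] by (auto simp: W_def)
      show "W 0 \<noteq> {}" using W0[of 0] by blast
    qed (use p in \<open>auto intro: irrW fY f0 fS\<close>)
    with p(2) show False by simp
  qed
qed

section \<open>Lower bound: a chain from a holomorphic branch\<close>

text \<open>Irreducibility of the closures needs no knowledge of their equations: if neither of two
  closed sets contained the image of a polydisc, two pulled back equations would be nonzero at a
  common parameter.\<close>

lemma chain_exists:
  assumes \<rho>: "\<rho> \<in> charts" and br: "branch \<rho> h"
  obtains Z where "\<And>k. k \<le> nat (tA d M N {..<K}) \<Longrightarrow> irreducible_closed (fclosed h) (Z k)"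
    "\<And>k. k < nat (tA d M N {..<K}) \<Longrightarrow> Z k \<subset> Z (Suc k)"
proof -
  define t where "t = nat (tA d M N {..<K})"
  obtain S \<epsilon> w0 \<phi> where S: "S \<subseteq> Y \<rho>" "int (card S) = tA d M N {..<K}" and \<epsilon>: "0 < \<epsilon>"
    and \<phi>: "\<forall>w\<in>polydisc S \<epsilon> w0. \<phi> w \<in> fibre \<rho> {..<K} h \<and> (\<forall>v\<in>S. \<phi> w v = w v)"
    and holo: "\<forall>v\<in>Y \<rho>. line_holo S \<epsilon> w0 (\<lambda>w. \<phi> w v)"
    using br unfolding branch_def by blast
  have finS: "finite S" using S(1) finite_yvars[of "{..<K}"] finite_subset by blast
  have "card S = t" using S(2) by (simp add: t_def)
  then obtain f where f: "bij_betw f {..<t} S"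
    using ex_bij_betw_nat_finite[OF finS] by (auto simp: atLeast0LessThan)
  \<comment> \<open>A flag of polydiscs: in the \<open>k\<close>-th only the first \<open>k\<close>
    parameters move, the others stay at the centre.\<close>
  define pd where "pd k = polydisc (f ` {..<k}) \<epsilon> w0" for k
  have fS: "f ` {..<k} \<subseteq> S" if "k \<le> t" for k using f that by (auto simp: bij_betw_def)
  have pdS: "pd k \<subseteq> polydisc S \<epsilon> w0" if "k \<le> t" for k
    unfolding pd_def by (rule polydisc_mono[OF fS[OF that] \<epsilon> order_refl])
  have pd_mono: "pd k \<subseteq> pd (Suc k)" for k
    unfolding pd_def by (rule polydisc_mono[OF _ \<epsilon> order_refl]) auto
  define \<gamma> where "\<gamma> w = strat (sect \<rho> (\<phi> w))" for w
  have \<gamma>F: "\<gamma> w \<in> feas h" if "w \<in> polydisc S \<epsilon> w0" for w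
    unfolding \<gamma>_def using \<phi> that by (intro fibre_feasible[OF \<rho>]) blast
  have F_sub: "feas h \<subseteq> grass_prod K d M N" by (auto simp: feasible_def)
  define cls where "cls k = {D. grass_closed K d M N D \<and> \<gamma> ` pd k \<subseteq> D}" for k
  \<comment> \<open>The closure of the image is formed in the product of Grassmannians and then cut
    down to the feasible strategies.\<close>
  define Z where "Z k = feas h \<inter> \<Inter>(cls k)" for k
  have "grass_closed K d M N (grass_prod K d M N)"
    unfolding grass_closed_def zariski_closed_in_def
    by (intro conjI exI[of _ "{}"]) (auto intro: strat_grass_prod)
  then have cls_ne: "cls k \<noteq> {}" if "k \<le> t" for k
    using \<gamma>F pdS[OF that] F_sub by (auto simp: cls_def)
  have \<gamma>Z: "\<gamma> w \<in> Z k" if "w \<in> pd k" "k \<le> t" for w k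
    using \<gamma>F pdS[OF that(2)] that(1) by (auto simp: Z_def cls_def)
  show thesis
  proof (rule that[of Z, folded t_def])
    fix k assume k: "k \<le> t"
    show "irreducible_closed (fclosed h) (Z k)"
      unfolding irreducible_closed_def
    proof (intro conjI allI impI)
      show "fclosed h (Z k)"
      proof -
        have "grass_closed K d M N (\<Inter>(cls k))"
          by (rule grass_closed_Inter[OF cls_ne[OF k]]) (simp add: cls_def)
        then show ?thesis unfolding sub_closed_def Z_def by blast
      qed
      have "w0 \<in> pd k" unfolding pd_def by (rule polydisc_center[OF \<epsilon>])
      from \<gamma>Z[OF this k] show "Z k \<noteq> {}" by blast
      fix A B
      assume "fclosed h A" "fclosed h B"
        and ZAB: "Z k \<subseteq> A \<union> B"
      then obtain DA DB where DA: "grass_closed K d M N DA" "A = feas h \<inter> DA"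
        and DB: "grass_closed K d M N DB" "B = feas h \<inter> DB" by (auto simp: sub_closed_def)
      have sep: "\<exists>p. line_holo S \<epsilon> w0 (\<lambda>u. p (sect \<rho> (\<phi> u))) \<and> p (sect \<rho> (\<phi> w)) \<noteq> 0 \<and> (\<forall>u. \<gamma> u \<in> D \<longrightarrow> p (sect \<rho> (\<phi> u)) = 0)"
        if D: "grass_closed K d M N D" and w: "\<gamma> w \<notin> D" for D w
      proof -
        obtain P where P: "P \<subseteq> polyfun" and PD: "\<And>X. X \<in> stief \<Longrightarrow> strat X \<in> D \<longleftrightarrow> (\<forall>p\<in>P. p X = 0)"
          using grass_closed_equations[OF D] by blast
        obtain p where p: "p \<in> P" "p (sect \<rho> (\<phi> w)) \<noteq> 0"
          using PD[OF sect_stief[OF \<rho>, of "\<phi> w"]] w by (auto simp: \<gamma>_def)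
        have "(\<lambda>x. p (sect \<rho> x)) \<in> polyon (Y \<rho>)" using p(1) P by (intro polyfun_sect) blast
        from line_holo_polyon[OF this, of S \<epsilon> w0 "\<lambda>v w. \<phi> w v"] holo
        have "line_holo S \<epsilon> w0 (\<lambda>u. p (sect \<rho> (\<phi> u)))" by simp
        moreover have "\<forall>u. \<gamma> u \<in> D \<longrightarrow> p (sect \<rho> (\<phi> u)) = 0"
          using PD[OF sect_stief[OF \<rho>]] p(1) by (auto simp: \<gamma>_def)
        ultimately show ?thesis using p(2) by blast
      qed
      have "\<gamma> ` pd k \<subseteq> DA \<or> \<gamma> ` pd k \<subseteq> DB"
      proof (rule ccontr)
        assume "\<not> ?thesis"
        then obtain w w' where w: "w \<in> pd k" "\<gamma> w \<notin> DA" and w': "w' \<in> pd k" "\<gamma> w' \<notin> DB" by blast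
        obtain p where p: "line_holo S \<epsilon> w0 (\<lambda>u. p (sect \<rho> (\<phi> u)))" "p (sect \<rho> (\<phi> w)) \<noteq> 0" "\<forall>u. \<gamma> u \<in> DA \<longrightarrow> p (sect \<rho> (\<phi> u)) = 0"
          using sep[OF DA(1) w(2)] by blast
        obtain p' where p': "line_holo S \<epsilon> w0 (\<lambda>u. p' (sect \<rho> (\<phi> u)))" "p' (sect \<rho> (\<phi> w')) \<noteq> 0" "\<forall>u. \<gamma> u \<in> DB \<longrightarrow> p' (sect \<rho> (\<phi> u)) = 0"
          using sep[OF DB(1) w'(2)] by blast
        have "\<exists>u\<in>polydisc (f ` {..<k}) \<epsilon> w0. p (sect \<rho> (\<phi> u)) \<noteq> 0 \<and> p' (sect \<rho> (\<phi> u)) \<noteq> 0"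
          by (rule line_holo_nonzero_common[where f = "\<lambda>u. p (sect \<rho> (\<phi> u))" and g = "\<lambda>u. p' (sect \<rho> (\<phi> u))" and w = w and w' = w',
                OF finS fS[OF k] p(1) p'(1) \<epsilon> w(1)[unfolded pd_def] p(2) w'(1)[unfolded pd_def] p'(2)])
        then obtain u where u: "u \<in> pd k" "p (sect \<rho> (\<phi> u)) \<noteq> 0" "p' (sect \<rho> (\<phi> u)) \<noteq> 0" by (auto simp: pd_def)
        from \<gamma>Z[OF u(1) k] ZAB DA(2) DB(2) have "\<gamma> u \<in> DA \<or> \<gamma> u \<in> DB" by blast
        with p(3) p'(3) u show False by blast
      qed
      then have "DA \<in> cls k \<or> DB \<in> cls k" using DA(1) DB(1) by (auto simp: cls_def)
      then show "Z k \<subseteq> A \<or> Z k \<subseteq> B" unfolding Z_def DA(2) DB(2) by blast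
    qed
  next
    fix k assume k: "k < t"
    have inj: "inj_on f {..<t}" using f by (simp add: bij_betw_def)
    have fk: "f k \<in> S" "f k \<notin> f ` {..<k}"
    proof -
      show "f k \<in> S" using f k by (auto simp: bij_betw_def)
      show "f k \<notin> f ` {..<k}"
      proof
        assume "f k \<in> f ` {..<k}"
        then obtain i where "i < k" "f k = f i" by blast
        with inj_onD[OF inj, of k i] k show False by simp
      qed
    qed
    \<comment> \<open>This equation holds on the image of the \<open>k\<close>-th polydisc, where
      the parameter \<open>f k\<close> is frozen, and so on its closure. It fails at
      \<open>w1\<close>, which shifts that parameter, so the inclusion is strict.\<close>
    define c where "c = (\<lambda>x :: sidx + hidx \<Rightarrow> complex. x (f k) - w0 (f k))"
    have c: "c \<in> polyon (Y \<rho>)" unfolding c_def using fk S(1) by (intro polyon_intros) auto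
    define C where "C = {s \<in> grass_prod K d M N. \<forall>x. s = strat (sect \<rho> x) \<longrightarrow> c x = 0}"
    have Ccl: "grass_closed K d M N C" unfolding C_def by (rule chart_complement_closed[OF \<rho> c])
    have \<gamma>C: "\<gamma> w \<in> C \<longleftrightarrow> w (f k) = w0 (f k)" if w: "w \<in> polydisc S \<epsilon> w0" for w
    proof -
      have "c x = w (f k) - w0 (f k)" if "\<gamma> w = strat (sect \<rho> x)" for x
      proof -
        have "c x = c (\<phi> w)" by (rule sect_inj_polyon[OF \<rho> _ c]) (use that in \<open>simp add: \<gamma>_def\<close>)
        also have "\<dots> = w (f k) - w0 (f k)" using \<phi> w fk(1) by (simp add: c_def)
        finally show ?thesis .
      qed
      then show ?thesis using \<gamma>F[OF w] F_sub unfolding C_def by (auto simp: \<gamma>_def)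
    qed
    have "\<gamma> ` pd k \<subseteq> C"
    proof
      fix s assume "s \<in> \<gamma> ` pd k"
      then obtain w where w: "w \<in> pd k" "s = \<gamma> w" by blast
      then have "w (f k) = w0 (f k)" using fk(2) by (simp add: pd_def polydisc_def)
      then show "s \<in> C" using \<gamma>C w pdS[of k] k by auto
    qed
    then have ZC: "Z k \<subseteq> C" using Ccl by (auto simp: Z_def cls_def)
    define w1 where "w1 = w0(f k := w0 (f k) + of_real (\<epsilon> / 2))"
    have w1: "w1 \<in> pd (Suc k)"
      using \<epsilon> by (auto simp: w1_def pd_def polydisc_def norm_divide)
    then have "\<gamma> w1 \<in> Z (Suc k)" by (rule \<gamma>Z) (use k in simp)
    moreover have "\<gamma> w1 \<notin> C"
      using \<gamma>C[of w1] w1 pdS[of "Suc k"] k \<epsilon> by (auto simp: w1_def)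
    moreover have "cls (Suc k) \<subseteq> cls k" using image_mono[OF pd_mono[of k], of \<gamma>] by (auto simp: cls_def)
    then have "Z k \<subseteq> Z (Suc k)" unfolding Z_def by blast
    ultimately show "Z k \<subset> Z (Suc k)" using ZC by blast
  qed
qed

section \<open>Pairwise bound on the signal dimensions\<close>

text \<open>The determinant of a block of distinct channel entries is not identically zero:
  injectivity of \<open>c\<close> allows the block to be the identity matrix.\<close>

lemma sqdet_generic:
  assumes "\<And>a b. a < m \<Longrightarrow> b < m \<Longrightarrow> c a b \<in> hvars" "\<And>a b a' b'. c a b = c a' b' \<Longrightarrow> a = a' \<and> b = b'"
  shows "generic K M N (\<lambda>h. full_rank m m (\<lambda>a b. pt h (c a b)))"
proof -
  define q where "q x = sqdet m (\<lambda>a b. if a < m \<and> b < m then x (c a b) else 0)" for x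
  have fr: "q x \<noteq> 0 \<longleftrightarrow> full_rank m m (\<lambda>a b. x (c a b))" for x
    unfolding q_def sqdet_full_rank full_rank_def by simp
  have "(\<lambda>x. q x) \<in> polyon hvars" unfolding q_def
    by (rule sqdet_polyon) (auto intro!: polyon_if polyon.const polyon.coord assms(1))
  then have q: "q \<in> polyon hvars" by simp
  have "\<exists>x. q x \<noteq> 0"
  proof
    define x where "x v = (if \<exists>a. v = c a a then 1 else 0 :: complex)" for v
    have xc: "x (c a b) = (if a = b then 1 else 0)" for a b using assms(2) by (auto simp: x_def)
    show "q x \<noteq> 0" unfolding fr full_rank_def xc
      by (simp add: if_distrib[of "\<lambda>t. _ * t"] sum.delta cong: if_cong)
  qed
  then show ?thesis by (intro genericI[OF q]) (simp_all add: fr)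
qed

text \<open>The smaller of the two sides carries the invertible block. If the receiver is smaller,
  the channel matrix is transposed and the two subspaces exchange roles.\<close>

lemma generic_pair:
  assumes ij: "i < K" "j < K" "i \<noteq> j"
  shows "generic K M N (\<lambda>h. feas h \<noteq> {} \<longrightarrow> d i + d j \<le> max (N i) (M j))"
proof -
  have strats: "\<exists>X\<in>stief. \<forall>k<d i. \<forall>l<d j. (\<Sum>a<N i. \<Sum>b<M j. X (True, i, a, k) * h (i, j, a, b) * X (False, j, b, l)) = 0"
    if F: "feas h \<noteq> {}" for h
  proof -
    obtain s where s: "s \<in> feas h" using F by blast
    then have "s \<in> grass_prod K d M N" by (auto simp: feasible_def)
    then obtain X where X: "X \<in> stief" "s = strat X" using grass_prod_strat by blast
    show ?thesis using s ij unfolding X(2) feasible_iff[OF X(1)] by (intro bexI[OF _ X(1)]) blast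
  qed
  show ?thesis
  proof (cases "M j \<le> N i")
    case True
    have "generic K M N (\<lambda>h. full_rank (M j) (M j) (\<lambda>a b. pt h (Inr (i, j, a, b))))"
      by (rule sqdet_generic) (use ij True in \<open>auto simp: hvars_def\<close>)
    then show ?thesis
    proof (rule generic_mono, intro impI)
      fix h assume fr: "full_rank (M j) (M j) (\<lambda>a b. pt h (Inr (i, j, a, b)))" and "feas h \<noteq> {}"
      from strats[OF this(2)] obtain X where X: "X \<in> stief"
        "\<And>k l. k < d i \<Longrightarrow> l < d j \<Longrightarrow> (\<Sum>a<N i. \<Sum>b<M j. X (True, i, a, k) * h (i, j, a, b) * X (False, j, b, l)) = 0" by blast
      have "full_rank (M j) (d j) (\<lambda>a k. X (False, j, a, k))" "full_rank (N i) (d i) (\<lambda>a k. X (True, i, a, k))"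
        using X(1) ij by (simp_all add: stiefel_def)
      from bilinear_bound[OF fr True this] X(2) have "d j + d i \<le> N i" by simp
      then show "d i + d j \<le> max (N i) (M j)" by simp
    qed
  next
    case False
    then have le: "N i \<le> M j" by simp
    have "generic K M N (\<lambda>h. full_rank (N i) (N i) (\<lambda>a b. pt h (Inr (i, j, b, a))))"
      by (rule sqdet_generic) (use ij le in \<open>auto simp: hvars_def\<close>)
    then show ?thesis
    proof (rule generic_mono, intro impI)
      fix h assume fr: "full_rank (N i) (N i) (\<lambda>a b. pt h (Inr (i, j, b, a)))" and "feas h \<noteq> {}"
      from strats[OF this(2)] obtain X where X: "X \<in> stief"
        "\<And>k l. k < d i \<Longrightarrow> l < d j \<Longrightarrow> (\<Sum>a<N i. \<Sum>b<M j. X (True, i, a, k) * h (i, j, a, b) * X (False, j, b, l)) = 0" by blast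
      have fr': "full_rank (N i) (d i) (\<lambda>a k. X (True, i, a, k))" "full_rank (M j) (d j) (\<lambda>a k. X (False, j, a, k))"
        using X(1) ij by (simp_all add: stiefel_def)
      have "d i + d j \<le> M j"
      proof (rule bilinear_bound[OF fr le fr'])
        fix k l assume kl: "k < d j" "l < d i"
        have "(\<Sum>b<M j. \<Sum>a<N i. X (False, j, b, k) * pt h (Inr (i, j, a, b)) * X (True, i, a, l))
            = (\<Sum>a<N i. \<Sum>b<M j. X (True, i, a, l) * h (i, j, a, b) * X (False, j, b, k))"
          by (subst sum.swap) (simp add: ac_simps)
        then show "(\<Sum>b<M j. \<Sum>a<N i. X (False, j, b, k) * pt h (Inr (i, j, a, b)) * X (True, i, a, l)) = 0"
          using X(2)[OF kl(2,1)] by simp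
      qed
      then show "d i + d j \<le> max (N i) (M j)" by simp
    qed
  qed
qed

lemma feasible_rank_bound:
  assumes "feas h \<noteq> {}" "i < K"
  shows "d i \<le> min (M i) (N i)"
proof -
  obtain s where "s \<in> grass_prod K d M N" using assms(1) by (auto simp: feasible_def)
  then obtain X where "X \<in> stief" using grass_prod_strat by blast
  then have "full_rank (M i) (d i) (\<lambda>a k. X (False, i, a, k))" "full_rank (N i) (d i) (\<lambda>a k. X (True, i, a, k))"
    using assms(2) by (simp_all add: stiefel_def)
  then show ?thesis using full_rank_le by simp
qed

text \<open>The supremum is attained: \<open>dep\<close> bounds every chain, and \<open>br\<close>,
  used in a chart containing a feasible strategy, yields a chain of exactly that length.\<close>

lemma feas_dim_eq:
  assumes ne: "feas h \<noteq> {}" and t: "0 \<le> tA d M N {..<K}"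
    and dep: "\<forall>\<rho>\<in>charts. \<forall>T\<subseteq>Y \<rho>. tA d M N {..<K} < int (card T) \<longrightarrow> \<not> indep_on (fibre \<rho> {..<K} h) T"
    and br: "\<forall>\<rho>\<in>charts. fibre \<rho> {..<K} h \<noteq> {} \<longrightarrow> branch \<rho> h"
  shows "feas_dim K d M N h = enat (nat (tA d M N {..<K}))"
  unfolding feas_dim_def krull_dim_def
proof (rule antisym[OF Sup_least Sup_upper])
  have ind: "card T \<le> nat (tA d M N {..<K})"
    if "\<rho> \<in> charts" "T \<subseteq> Y \<rho>" "indep_on (fibre \<rho> {..<K} h) T" for \<rho> T
  proof (rule ccontr)
    assume "\<not> ?thesis"
    then have "tA d M N {..<K} < int (card T)" using t by linarith
    with dep that show False by blast
  qed
  fix e assume "e \<in> {enat n |n. \<exists>Z. (\<forall>k\<le>n. irreducible_closed (fclosed h) (Z k)) \<and> (\<forall>k<n. Z k \<subset> Z (Suc k))}"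
  then obtain n Z where n: "e = enat n" "\<forall>k\<le>n. irreducible_closed (fclosed h) (Z k)"
    "\<forall>k<n. Z k \<subset> Z (Suc k)" by blast
  have "n \<le> nat (tA d M N {..<K})"
    by (rule chain_length_le[of h _ n Z]) (use ind n in blast)+
  then show "e \<le> enat (nat (tA d M N {..<K}))" using n(1) by simp
next
  obtain s where "s \<in> feas h" using ne by blast
  then obtain \<rho> x where "\<rho> \<in> charts" "x \<in> fibre \<rho> {..<K} h" by (rule feasible_chart)
  then have "\<rho> \<in> charts" "branch \<rho> h" using br by auto
  then obtain Z where "\<And>k. k \<le> nat (tA d M N {..<K}) \<Longrightarrow> irreducible_closed (fclosed h) (Z k)"
    "\<And>k. k < nat (tA d M N {..<K}) \<Longrightarrow> Z k \<subset> Z (Suc k)"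
    by (rule chain_exists) (rule that, assumption+)
  then show "enat (nat (tA d M N {..<K})) \<in> {enat n |n. \<exists>Z. (\<forall>k\<le>n. irreducible_closed (fclosed h) (Z k)) \<and> (\<forall>k<n. Z k \<subset> Z (Suc k))}"
    by blast
qed

end

theorem theorem2:
  fixes K :: nat and d M N :: "nat \<Rightarrow> nat"
  assumes "K \<ge> 1"
    and "\<forall>i<K. d i \<ge> 1 \<and> M i \<ge> 1 \<and> N i \<ge> 1"
  shows "generic K M N (\<lambda>h. feasible K d M N h \<noteq> {} \<longrightarrow>
           (tA d M N {..<K} \<ge> 0 \<and> feas_dim K d M N h = enat (nat (tA d M N {..<K})))
         \<and> (\<forall>i<K. d i \<le> min (M i) (N i))
         \<and> (\<forall>i<K. \<forall>j<K. i \<noteq> j \<longrightarrow> d i + d j \<le> max (N i) (M j))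
         \<and> (\<forall>A \<subseteq> {..<K}. tA d M N A \<ge> 0))"
proof -
  interpret channel K d M N .
  let ?pairs = "{(i, j). i < K \<and> j < K \<and> i \<noteq> j}"
  have "?pairs \<subseteq> {..<K} \<times> {..<K}" by auto
  then have fin: "finite ?pairs" by (rule finite_subset) simp
  have "generic K M N (\<lambda>h. \<forall>p\<in>?pairs. feas h \<noteq> {} \<longrightarrow> d (fst p) + d (snd p) \<le> max (N (fst p)) (M (snd p)))"
    by (intro generic_all[OF fin] generic_pair) auto
  moreover have "generic K M N (\<lambda>h. \<forall>A\<in>Pow {..<K}. feas h \<noteq> {} \<longrightarrow> 0 \<le> tA d M N A)"
    by (intro generic_all generic_tA) auto
  moreover have "generic K M N (\<lambda>h. \<forall>\<rho>\<in>charts. \<forall>T\<subseteq>Y \<rho>. tA d M N {..<K} < int (card T) \<longrightarrow> \<not> indep_on (fibre \<rho> {..<K} h) T)"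
    by (intro generic_all[OF finite_charts] generic_fibre subset_refl)
  moreover have "generic K M N (\<lambda>h. \<forall>\<rho>\<in>charts. fibre \<rho> {..<K} h \<noteq> {} \<longrightarrow> branch \<rho> h)"
    by (intro generic_all[OF finite_charts] generic_branch_fibre)
  \<comment> \<open>Each of the four statements is already a finite intersection over pairs, subsets
    or charts, so a nonempty open set remains.\<close>
  ultimately have "generic K M N (\<lambda>h.
      ((\<forall>p\<in>?pairs. feas h \<noteq> {} \<longrightarrow> d (fst p) + d (snd p) \<le> max (N (fst p)) (M (snd p))) \<and>
       (\<forall>A\<in>Pow {..<K}. feas h \<noteq> {} \<longrightarrow> 0 \<le> tA d M N A)) \<and>
      (\<forall>\<rho>\<in>charts. \<forall>T\<subseteq>Y \<rho>. tA d M N {..<K} < int (card T) \<longrightarrow> \<not> indep_on (fibre \<rho> {..<K} h) T) \<and>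
      (\<forall>\<rho>\<in>charts. fibre \<rho> {..<K} h \<noteq> {} \<longrightarrow> branch \<rho> h))"
    by (intro generic_conj)
  then show ?thesis
  proof (rule generic_mono, intro impI)
    fix h
    assume h: "((\<forall>p\<in>?pairs. feas h \<noteq> {} \<longrightarrow> d (fst p) + d (snd p) \<le> max (N (fst p)) (M (snd p))) \<and>
       (\<forall>A\<in>Pow {..<K}. feas h \<noteq> {} \<longrightarrow> 0 \<le> tA d M N A)) \<and>
      (\<forall>\<rho>\<in>charts. \<forall>T\<subseteq>Y \<rho>. tA d M N {..<K} < int (card T) \<longrightarrow> \<not> indep_on (fibre \<rho> {..<K} h) T) \<and>
      (\<forall>\<rho>\<in>charts. fibre \<rho> {..<K} h \<noteq> {} \<longrightarrow> branch \<rho> h)" and ne: "feas h \<noteq> {}"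
    note h1 = conjunct1[OF conjunct1[OF h]] and h2 = conjunct2[OF conjunct1[OF h]] and h3 = conjunct2[OF h]
    have tA: "0 \<le> tA d M N A" if "A \<subseteq> {..<K}" for A using h2 ne that by simp
    have "feas_dim K d M N h = enat (nat (tA d M N {..<K}))"
      by (rule feas_dim_eq[OF ne tA[OF subset_refl] conjunct1[OF h3] conjunct2[OF h3]])
    moreover have "d i + d j \<le> max (N i) (M j)" if "i < K" "j < K" "i \<noteq> j" for i j
      using bspec[OF h1, of "(i, j)"] ne that by simp
    ultimately show "(0 \<le> tA d M N {..<K} \<and> feas_dim K d M N h = enat (nat (tA d M N {..<K})))
         \<and> (\<forall>i<K. d i \<le> min (M i) (N i))
         \<and> (\<forall>i<K. \<forall>j<K. i \<noteq> j \<longrightarrow> d i + d j \<le> max (N i) (M j))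
         \<and> (\<forall>A \<subseteq> {..<K}. 0 \<le> tA d M N A)"
      using tA[OF subset_refl] by (intro conjI allI impI feasible_rank_bound[OF ne] tA subset_refl)
  qed
qed

end
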